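(* Let $X=\mathbb{C}^2/\Lambda$ be a two-dimensional non-compact theta toroidal group. Then, with the definition of Bott--Chern cohomology $H^{r,s}_{BC}(X)$ given in the context and $h^{r,s}_{BC}=\dim_{\mathbb{C}}H^{r,s}_{BC}(X)$, one has $$h^{0,0}_{BC}=1,\quad h^{1,0}_{BC}=h^{0,1}_{BC}=2,\quad h^{2,0}_{BC}=h^{0,2}_{BC}=1,\quad h^{1,1}_{BC}=3,\quad h^{2,1}_{BC}=h^{1,2}_{BC}=1,\quad h^{2,2}_{BC}=0.$$
   Context: A toroidal group is a connected abelian complex Lie group with no non-constant holomorphic functions; it is always a quotient $\mathbb{C}^n/\Lambda$ by a discrete subgroup. It is a theta toroidal group if all the cohomology groups $H^{r,s}(X,\mathcal{O})$ (the Dolbeault cohomology groups, i.e. $H^s(X,\Omega^r)$) are finite-dimensional. Every two-dimensional non-compact theta toroidal group can be written as $X=\mathbb{C}^2/\Lambda_{\tau,\alpha,\beta}$ with $\Lambda_{\tau,\alpha,\beta}=\mathbb{Z}(0,1)+\mathbb{Z}(1,\alpha)+\mathbb{Z}(\tau,\beta)$, where $\tau\in\mathbb{C}$, $\operatorname{Im}\tau>0$, and $\alpha,\beta\in\mathbb{R}$. Notation: $\mathcal{A}^{r,s}(X)$ is the space of complex-valued $C^\infty$ $(r,s)$-forms on $X$, $\mathcal{A}=\mathcal{A}^{0,0}$; $\Omega^r(X)$ is the space of holomorphic $r$-forms, and $\overline{\Omega}^s(X)$ the space of antiholomorphic $s$-forms (complex conjugates of holomorphic $s$-forms), with $\Omega^0=\mathcal{O}$,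 $\overline{\Omega}^0=\overline{\mathcal{O}}$. Definition of Bott--Chern cohomology used here: $$H^{r,s}_{BC}(X)=\begin{cases}\dfrac{\operatorname{Ker}d\cap\mathcal{A}^{r,s}(X)}{\partial\bar\partial\mathcal{A}^{r-1,s-1}(X)} & r\ge1,\ s\ge1,\\[2ex] \dfrac{\operatorname{Ker}d\cap\mathcal{A}^{r,0}(X)}{\partial\Omega^{r-1}(X)} & r\ge1,\ s=0,\\[2ex] \dfrac{\operatorname{Ker}d\cap\mathcal{A}^{0,s}(X)}{\bar\partial\,\overline{\Omega}^{s-1}(X)} & r=0,\ s\ge1,\\[2ex] \operatorname{Ker}d\cap\mathcal{A}(X) & r=s=0.\end{cases}$$ *)

theory Defs
  imports "HOL-Analysis.Analysis" "HOL-Library.Function_Algebras"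
begin

section \<open>Dimension of a quotient of vector spaces\<close>

text \<open>
  \<open>basis_modulo sc U W B\<close>: the classes of the elements of \<open>B\<close> are pairwise distinct and form
  a finite basis of the vector space \<open>U / W\<close>, where \<open>W\<close> is a subspace of the subspace \<open>U\<close>.
\<close>

definition basis_modulo ::
  "('k::field \<Rightarrow> 'v::ab_group_add \<Rightarrow> 'v) \<Rightarrow> 'v set \<Rightarrow> 'v set \<Rightarrow> 'v set \<Rightarrow> bool" where
  "basis_modulo sc U W B \<longleftrightarrow>
     finite B \<and> B \<subseteq> U \<and>
     (\<forall>u\<in>U. \<exists>c. u - (\<Sum>b\<in>B. sc (c b) b) \<in> W) \<and>
     (\<forall>c. (\<Sum>b\<in>B. sc (c b) b) \<in> W \<longrightarrow> (\<forall>b\<in>B. c b = 0))"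

definition quotient_dim ::
  "('k::field \<Rightarrow> 'v::ab_group_add \<Rightarrow> 'v) \<Rightarrow> 'v set \<Rightarrow> 'v set \<Rightarrow> enat" where
  "quotient_dim sc U W =
     (if \<exists>B. basis_modulo sc U W B
      then enat (card (SOME B. basis_modulo sc U W B))
      else \<infinity>)"


section \<open>Discrete subgroups and the quotient group\<close>

definition discrete_subgroup :: "(complex ^ 'n) set \<Rightarrow> bool" where
  "discrete_subgroup \<Lambda> \<longleftrightarrow>
     0 \<in> \<Lambda> \<and> (\<forall>x\<in>\<Lambda>. \<forall>y\<in>\<Lambda>. x - y \<in> \<Lambda>) \<and> discrete \<Lambda>"

definition coset_space :: "(complex ^ 'n) set \<Rightarrow> (complex ^ 'n) set set" where
  "coset_space \<Lambda> = UNIV // {(x, y). y - x \<in> \<Lambda>}"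

definition quotient_group_topology :: "(complex ^ 'n) set \<Rightarrow> (complex ^ 'n) set topology" where
  "quotient_group_topology \<Lambda> = topology (\<lambda>\<U>. \<U> \<subseteq> coset_space \<Lambda> \<and> open (\<Union>\<U>))"

lemma openin_quotient_group_topology:
  fixes \<Lambda> :: "(complex ^ 'n) set"
  assumes "discrete_subgroup \<Lambda>"
  shows "openin (quotient_group_topology \<Lambda>) \<U> \<longleftrightarrow> \<U> \<subseteq> coset_space \<Lambda> \<and> open (\<Union>\<U>)"
proof -
  let ?r = "{(x, y). y - x \<in> \<Lambda>}"
  have z: "0 \<in> \<Lambda>" and d: "\<And>x y. x \<in> \<Lambda> \<Longrightarrow> y \<in> \<Lambda> \<Longrightarrow> x - y \<in> \<Lambda>"
    using assms by (auto simp: discrete_subgroup_def)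
  have m: "- x \<in> \<Lambda>" if "x \<in> \<Lambda>" for x using d[OF z that] by simp
  have eq: "equiv UNIV ?r"
  proof (rule equivI)
    show "refl ?r" using z by (auto simp: refl_on_def)
    show "sym ?r"
    proof (rule symI, clarsimp)
      fix x y assume "y - x \<in> \<Lambda>" then show "x - y \<in> \<Lambda>" using m[of "y - x"] by simp
    qed
    show "trans ?r"
    proof (rule transI, clarsimp)
      fix x y w assume "y - x \<in> \<Lambda>" "w - y \<in> \<Lambda>"
      then show "w - x \<in> \<Lambda>" using d[of "w - y" "- (y - x)", OF _ m] by (simp add: algebra_simps)
    qed
  qed auto
  have disj: "A = B \<or> A \<inter> B = {}" if "A \<in> coset_space \<Lambda>" "B \<in> coset_space \<Lambda>" for A B
    using quotient_disj[OF eq] that by (simp add: coset_space_def)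
  have "istopology (\<lambda>\<U>. \<U> \<subseteq> coset_space \<Lambda> \<and> open (\<Union>\<U>))"
    unfolding istopology_def
  proof (intro conjI allI impI)
    fix S T
    assume S: "S \<subseteq> coset_space \<Lambda> \<and> open (\<Union>S)" and T: "T \<subseteq> coset_space \<Lambda> \<and> open (\<Union>T)"
    have "\<Union>(S \<inter> T) = \<Union>S \<inter> \<Union>T"
    proof
      show "\<Union>S \<inter> \<Union>T \<subseteq> \<Union>(S \<inter> T)"
      proof
        fix x assume "x \<in> \<Union>S \<inter> \<Union>T"
        then obtain A B where AB: "A \<in> S" "B \<in> T" "x \<in> A" "x \<in> B" by auto
        then have "A = B" using disj[of A B] S T by blast
        then show "x \<in> \<Union>(S \<inter> T)" using AB by blast
      qed
    qed auto
    then show "open (\<Union>(S \<inter> T))" using S T by auto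
    show "S \<inter> T \<subseteq> coset_space \<Lambda>" using S by blast
  next
    fix K :: "(complex ^ 'n) set set set"
    assume K: "\<forall>k\<in>K. k \<subseteq> coset_space \<Lambda> \<and> open (\<Union>k)"
    show "\<Union>K \<subseteq> coset_space \<Lambda>" using K by blast
    have "\<Union>(\<Union>K) = (\<Union>k\<in>K. \<Union>k)" by blast
    then show "open (\<Union>(\<Union>K))" using K by auto
  qed
  then show ?thesis by (simp add: quotient_group_topology_def topology_inverse')
qed


section \<open>Functions on the quotient\<close>

text \<open>Functions on \<open>\<complex>\<^sup>n / \<Lambda>\<close> are identified with \<open>\<Lambda>\<close>-periodic functions on \<open>\<complex>\<^sup>n\<close>.\<close>

definition periodic_wrt :: "'a::plus set \<Rightarrow> ('a \<Rightarrow> 'b) \<Rightarrow> bool" where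
  "periodic_wrt \<Lambda> f \<longleftrightarrow> (\<forall>l\<in>\<Lambda>. \<forall>z. f (z + l) = f z)"

text \<open>Differentiability is real: all directional derivatives up to order \<open>k\<close> exist and are continuous.\<close>

primrec times_cont_diff ::
  "nat \<Rightarrow> ('a::real_normed_vector \<Rightarrow> 'b::real_normed_vector) \<Rightarrow> bool" where
  "times_cont_diff 0 f \<longleftrightarrow> continuous_on UNIV f"
| "times_cont_diff (Suc k) f \<longleftrightarrow>
     (\<forall>x. f differentiable (at x)) \<and>
     (\<forall>v. times_cont_diff k (\<lambda>x. frechet_derivative f (at x) v))"

definition smooth :: "('a::real_normed_vector \<Rightarrow> 'b::real_normed_vector) \<Rightarrow> bool" where
  "smooth f \<longleftrightarrow> (\<forall>k. times_cont_diff k f)"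

definition entire :: "(complex ^ 'n \<Rightarrow> complex) \<Rightarrow> bool" where
  "entire f \<longleftrightarrow>
     (\<forall>z. \<exists>D. (f has_derivative D) (at z) \<and> (\<forall>c v. D (c *s v) = c * D v))"

text \<open>Respectively \<open>\<partial>/\<partial>z\<^sub>k\<close> and \<open>\<partial>/\<partial>cnj z\<^sub>k\<close>.\<close>

definition wirtinger :: "'n \<Rightarrow> (complex ^ 'n \<Rightarrow> complex) \<Rightarrow> complex ^ 'n \<Rightarrow> complex" where
  "wirtinger k f z = (frechet_derivative f (at z) (axis k 1)
               - \<i> * frechet_derivative f (at z) (axis k \<i>)) / 2"

definition wirtinger_bar :: "'n \<Rightarrow> (complex ^ 'n \<Rightarrow> complex) \<Rightarrow> complex ^ 'n \<Rightarrow> complex" where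
  "wirtinger_bar k f z = (frechet_derivative f (at z) (axis k 1)
                  + \<i> * frechet_derivative f (at z) (axis k \<i>)) / 2"


section \<open>Differential forms\<close>

text \<open>
  A form \<open>\<omega>\<close> on \<open>\<complex>\<^sup>n\<close> is given by its coefficients in the global translation-invariant frame:
  \<open>\<omega> = (\<Sum>I J. \<omega> I J \<cdot> dz\<^sub>I \<and> dzbar\<^sub>J)\<close>, where \<open>dz\<^sub>I\<close> is the wedge product of the
  \<open>dz\<^sub>i\<close>, \<open>i \<in> I\<close>, in increasing order, and similarly for \<open>dzbar\<^sub>J\<close>. As the frame is
  invariant, forms on \<open>\<complex>\<^sup>n / \<Lambda>\<close> are the forms with \<open>\<Lambda>\<close>-periodic coefficients.
\<close>

type_synonym 'n form = "'n set \<Rightarrow> 'n set \<Rightarrow> complex ^ 'n \<Rightarrow> complex"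

definition form_scale :: "complex \<Rightarrow> 'n::finite form \<Rightarrow> 'n form" where
  "form_scale c \<omega> = (\<lambda>I J z. c * \<omega> I J z)"

lemma vector_space_form_scale: "vector_space (form_scale :: complex \<Rightarrow> 'n::finite form \<Rightarrow> 'n form)"
  by standard (auto simp: form_scale_def fun_eq_iff algebra_simps)

text \<open>The sign of \<open>dz\<^sub>k \<and> dz\<^sub>I\<close>, for \<open>k \<notin> I\<close>, relative to the ordered wedge product.\<close>

definition wedge_sign :: "'n::linorder \<Rightarrow> 'n set \<Rightarrow> complex" where
  "wedge_sign k I = (- 1) ^ card {i \<in> I. i < k}"

definition del :: "'n::{finite, linorder} form \<Rightarrow> 'n form" where
  "del \<omega> = (\<lambda>I J z. \<Sum>k\<in>I. wedge_sign k (I - {k}) * wirtinger k (\<omega> (I - {k}) J) z)"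

text \<open>The factor \<open>(-1)\<^bsup>|I|\<^esup>\<close> comes from moving \<open>dzbar\<^sub>k\<close> past \<open>dz\<^sub>I\<close>.\<close>

definition delbar :: "'n::{finite, linorder} form \<Rightarrow> 'n form" where
  "delbar \<omega> = (\<lambda>I J z.
     (- 1) ^ card I * (\<Sum>k\<in>J. wedge_sign k (J - {k}) * wirtinger_bar k (\<omega> I (J - {k})) z))"

definition ext_d :: "'n::{finite, linorder} form \<Rightarrow> 'n form" where
  "ext_d \<omega> = del \<omega> + delbar \<omega>"

text \<open>Conjugation: \<open>dzbar\<^sub>J \<and> dz\<^sub>I = (-1)\<^bsup>|I||J|\<^esup> dz\<^sub>I \<and> dzbar\<^sub>J\<close>.\<close>

definition conj_form :: "'n::finite form \<Rightarrow> 'n form" where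
  "conj_form \<omega> = (\<lambda>I J z. (- 1) ^ (card I * card J) * cnj (\<omega> J I z))"

definition smooth_forms :: "(complex ^ 'n::finite) set \<Rightarrow> nat \<Rightarrow> nat \<Rightarrow> 'n form set" where
  "smooth_forms \<Lambda> r s =
     {\<omega>. \<forall>I J. if card I = r \<and> card J = s then smooth (\<omega> I J) \<and> periodic_wrt \<Lambda> (\<omega> I J)
               else \<omega> I J = 0}"

definition holomorphic_forms :: "(complex ^ 'n::finite) set \<Rightarrow> nat \<Rightarrow> 'n form set" where
  "holomorphic_forms \<Lambda> r =
     {\<omega>. \<forall>I J. if card I = r \<and> J = {} then entire (\<omega> I J) \<and> periodic_wrt \<Lambda> (\<omega> I J)
               else \<omega> I J = 0}"

definition antiholomorphic_forms :: "(complex ^ 'n::finite) set \<Rightarrow> nat \<Rightarrow> 'n form set" where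
  "antiholomorphic_forms \<Lambda> s = conj_form ` holomorphic_forms \<Lambda> s"


section \<open>Dolbeault and Bott--Chern cohomology\<close>

definition dolbeault_dim :: "(complex ^ 'n::{finite, linorder}) set \<Rightarrow> nat \<Rightarrow> nat \<Rightarrow> enat" where
  "dolbeault_dim \<Lambda> r s =
     quotient_dim form_scale
       {\<omega> \<in> smooth_forms \<Lambda> r s. delbar \<omega> = 0}
       (if s = 0 then {0} else delbar ` smooth_forms \<Lambda> r (s - 1))"

definition bott_chern_cocycles ::
  "(complex ^ 'n::{finite, linorder}) set \<Rightarrow> nat \<Rightarrow> nat \<Rightarrow> 'n form set" where
  "bott_chern_cocycles \<Lambda> r s = {\<omega> \<in> smooth_forms \<Lambda> r s. ext_d \<omega> = 0}"

definition bott_chern_coboundaries ::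
  "(complex ^ 'n::{finite, linorder}) set \<Rightarrow> nat \<Rightarrow> nat \<Rightarrow> 'n form set" where
  "bott_chern_coboundaries \<Lambda> r s =
     (if r \<ge> 1 \<and> s \<ge> 1 then (\<lambda>\<omega>. del (delbar \<omega>)) ` smooth_forms \<Lambda> (r - 1) (s - 1)
      else if r \<ge> 1 then del ` holomorphic_forms \<Lambda> (r - 1)
      else if s \<ge> 1 then delbar ` antiholomorphic_forms \<Lambda> (s - 1)
      else {0})"

definition bott_chern_dim :: "(complex ^ 'n::{finite, linorder}) set \<Rightarrow> nat \<Rightarrow> nat \<Rightarrow> enat" where
  "bott_chern_dim \<Lambda> r s =
     quotient_dim form_scale (bott_chern_cocycles \<Lambda> r s) (bott_chern_coboundaries \<Lambda> r s)"


section \<open>Theta toroidal groups\<close>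

definition toroidal :: "(complex ^ 'n) set \<Rightarrow> bool" where
  "toroidal \<Lambda> \<longleftrightarrow>
     discrete_subgroup \<Lambda> \<and> (\<forall>f. entire f \<and> periodic_wrt \<Lambda> f \<longrightarrow> f constant_on UNIV)"

definition theta_toroidal :: "(complex ^ 'n::{finite, linorder}) set \<Rightarrow> bool" where
  "theta_toroidal \<Lambda> \<longleftrightarrow> toroidal \<Lambda> \<and> (\<forall>r s. dolbeault_dim \<Lambda> r s \<noteq> \<infinity>)"

end

theory Submission
  imports Defs "HOL-Computational_Algebra.Fundamental_Theorem_Algebra"
begin

text \<open>
  Let \<open>A\<close> be the space of smooth \<open>\<Lambda>\<close>-periodic functions. As the quotient is not compact but toroidal,
  \<open>\<Lambda>\<close> spans a real hyperplane, the kernel of a real coordinate \<open>h\<close>, and there is a vector \<open>e\<close> with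
  \<open>h e = 1\<close>. No Fourier series are needed: finiteness of the Dolbeault cohomology is used only
  through linear algebra.

  Integration along \<open>e\<close> makes \<open>D\<^sub>e - \<mu>\<close> surjective on \<open>A\<close> for every \<open>\<mu>\<close>, while on the
  finite-dimensional \<open>H\<^bsup>0,2\<^esup>\<close> some product of such operators vanishes; hence \<open>H\<^bsup>0,2\<^esup> = 0\<close>.
  On \<open>H\<^bsup>0,1\<^esup>\<close> lattice translations act trivially, so a common eigenvector of the \<open>\<partial>/\<partial>z\<^sub>k\<close> yields a
  periodic entire exponential, which must be constant; hence the derivatives along \<open>\<Lambda>\<close> act by zero.
  Every closed \<open>(0,1)\<close>-form is therefore cohomologous to its average over the maximal compact subgroup,
  which depends on \<open>h\<close> only, and so to a constant form.

  Applied to rows of coefficients and, by conjugation, to columns, this reduces every Bott--Chern class to a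
  constant form. Among the constant forms the only relations come from functions of \<open>h\<close>, again by
  averaging; for instance \<open>\<partial>\<partial>bar (h\<^sup>2)\<close> is the one relation between the four constant \<open>(1,1)\<close>-forms.
\<close>

section \<open>Linear algebra modulo a subspace\<close>

text \<open>Surjectivity of D_e - \<mu> settles H^{0,2} because there every periodic function is a
  cocycle. On (0,1)-forms a solution found coefficient by coefficient need not be closed, which is
  why H^{0,1} needs eigenvectors instead. The exponential obtained from them is holomorphic for a
  cohomological reason: the conjugate derivatives act by zero on H^{0,1}, so D_w acts as the sum of
  the w_k times the derivatives in z_k, and its eigenvalue is complex-linear in w. A nilpotent part
  for the eigenvalue 0 is excluded separately, because D_v of a periodic function has mean zero
  along a period v. The numbers come from \<theta>, the coefficient vector of del h, which is not 0.
  Two constant (0,1)-forms satisfy the one relation delbar h, whence 2 - 1 in bidegrees (2,1) and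
  (1,2); four constant (1,1)-forms satisfy one relation, whence 4 - 1; in (2,2) the vanishing of
  H^{0,2}, used once for del and once for delbar, removes everything.\<close>

lemma (in vector_space) dependent_modulo:
  assumes W: "subspace W" and "finite B" "finite I" "card B < card I"
    and "\<And>i. i \<in> I \<Longrightarrow> \<exists>c. u i - (\<Sum>b\<in>B. scale (c b) b) \<in> W"
  shows "\<exists>a. (\<exists>i\<in>I. a i \<noteq> 0) \<and> (\<Sum>i\<in>I. scale (a i) (u i)) \<in> W"
  using assms(2-)
proof (induction B arbitrary: I u rule: finite_induct)
  case empty
  then obtain j where "j \<in> I" by fastforce
  with empty have "(\<Sum>i\<in>I. scale (if i = j then 1 else 0) (u i)) \<in> W"
    by (simp add: if_distrib[of "\<lambda>x. scale x _"] sum.delta cong: if_cong)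
  with \<open>j \<in> I\<close> show ?case by (intro exI[of _ "\<lambda>i. if i = j then 1 else 0"]) auto
next
  case (insert b B)
  from insert.prems(3) obtain c where
    c: "\<And>i. i \<in> I \<Longrightarrow> u i - (\<Sum>x\<in>insert b B. scale (c i x) x) \<in> W"
    by metis
  show ?case
  proof (cases "\<forall>i\<in>I. c i b = 0")
    case True
    have "\<exists>c. u i - (\<Sum>x\<in>B. scale (c x) x) \<in> W" if "i \<in> I" for i
      using c[OF that] True that insert.hyps by auto
    then show ?thesis using insert.IH[of I u] insert.prems insert.hyps by auto
  next
    case False
    then obtain j where j: "j \<in> I" "c j b \<noteq> 0" by blast
    \<comment> \<open>The generator \<open>b\<close> is eliminated with \<open>u j\<close> as pivot;
      \<open>r i\<close> is the multiplier of Gaussian elimination.\<close>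
    define r where "r i = c i b / c j b" for i
    have "\<exists>c. (u i - scale (r i) (u j)) - (\<Sum>x\<in>B. scale (c x) x) \<in> W" if "i \<in> I - {j}" for i
    proof -
      have "(u i - (\<Sum>x\<in>insert b B. scale (c i x) x))
              - scale (r i) (u j - (\<Sum>x\<in>insert b B. scale (c j x) x)) \<in> W"
        using c[of i] c[of j] that j W by (auto intro: subspace_diff subspace_scale)
      also have "(u i - (\<Sum>x\<in>insert b B. scale (c i x) x))
              - scale (r i) (u j - (\<Sum>x\<in>insert b B. scale (c j x) x))
          = (u i - scale (r i) (u j)) - (\<Sum>x\<in>B. scale (c i x - r i * c j x) x)"
        using insert.hyps j
        by (simp add: scale_right_diff_distrib scale_left_diff_distrib sum_subtractf
            scale_sum_right scale_right_distrib r_def algebra_simps)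
      finally show ?thesis by (rule exI[of _ "\<lambda>x. c i x - r i * c j x"])
    qed
    moreover have "card B < card (I - {j})"
      using insert.prems insert.hyps j by simp
    ultimately obtain a where a: "\<exists>i\<in>I - {j}. a i \<noteq> 0"
        "(\<Sum>i\<in>I - {j}. scale (a i) (u i - scale (r i) (u j))) \<in> W"
      using insert.IH[of "I - {j}" "\<lambda>i. u i - scale (r i) (u j)"] insert.prems by auto
    \<comment> \<open>The coefficient at the pivot collects what the elimination subtracted, so a
      relation between the reduced vectors becomes one between the \<open>u i\<close>.\<close>
    define a' where "a' i = (if i = j then - (\<Sum>i\<in>I - {j}. a i * r i) else a i)" for i
    have "(\<Sum>i\<in>I. scale (a' i) (u i)) = scale (a' j) (u j) + (\<Sum>i\<in>I - {j}. scale (a' i) (u i))"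
      using insert.prems j by (simp add: sum.remove)
    also have "(\<Sum>i\<in>I - {j}. scale (a' i) (u i)) = (\<Sum>i\<in>I - {j}. scale (a i) (u i))"
      by (intro sum.cong) (auto simp: a'_def)
    also have "scale (a' j) (u j) + (\<Sum>i\<in>I - {j}. scale (a i) (u i))
        = (\<Sum>i\<in>I - {j}. scale (a i) (u i - scale (r i) (u j)))"
      by (simp add: a'_def scale_right_diff_distrib sum_subtractf scale_sum_left)
    finally show ?thesis using a by (intro exI[of _ a']) (auto simp: a'_def)
  qed
qed

text \<open>\<open>quotient_dim\<close> selects some basis by choice, so its value is known only
  once all bases modulo \<open>W\<close> have the same size; the exchange argument is applied in
  both directions.\<close>

lemma (in vector_space) quotient_dim_eqI:
  assumes W: "subspace W" and B: "basis_modulo scale U W B"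
  shows "quotient_dim scale U W = enat (card B)"
proof -
  have le: "card B2 \<le> card B1"
    if B1: "basis_modulo scale U W B1" and B2: "basis_modulo scale U W B2" for B1 B2
  proof (rule ccontr)
    assume "\<not> card B2 \<le> card B1"
    then have lt: "card B1 < card B2" by simp
    have span: "\<exists>c. i - (\<Sum>b\<in>B1. scale (c b) b) \<in> W" if "i \<in> B2" for i
    proof -
      have "i \<in> U" using B2 that unfolding basis_modulo_def by (elim conjE) (rule subsetD)
      then show ?thesis using B1 unfolding basis_modulo_def by (elim conjE) (rule bspec)
    qed
    have "finite B1" "finite B2" using B1 B2 by (simp_all add: basis_modulo_def)
    from dependent_modulo[OF W this lt, of "\<lambda>x. x", OF span]
    obtain a where a: "\<exists>i\<in>B2. a i \<noteq> 0" "(\<Sum>i\<in>B2. scale (a i) i) \<in> W"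
      by blast
    have "(\<Sum>b\<in>B2. scale (a b) b) \<in> W \<longrightarrow> (\<forall>b\<in>B2. a b = 0)"
      using B2 unfolding basis_modulo_def by (elim conjE) (drule spec[of _ a], assumption)
    with a show False by blast
  qed
  define B' where "B' = (SOME B. basis_modulo scale U W B)"
  have "basis_modulo scale U W B'" unfolding B'_def using B by (rule someI)
  then have "card B' = card B" using le B by (meson le_antisym)
  then show ?thesis using B unfolding quotient_dim_def B'_def by auto
qed

section \<open>Polynomials in an operator and eigenvectors modulo a subspace\<close>

locale complex_vector_space = vector_space scale
  for scale :: "complex \<Rightarrow> 'v::ab_group_add \<Rightarrow> 'v"
begin

text \<open>Linearity is demanded on \<open>U\<close> alone: \<open>frechet_derivative\<close> is an
  arbitrary choice where no derivative exists, so differentiation is not linear on all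
  functions.\<close>

definition linear_endo :: "'v set \<Rightarrow> ('v \<Rightarrow> 'v) \<Rightarrow> bool" where
  "linear_endo U N \<longleftrightarrow> N ` U \<subseteq> U \<and>
     (\<forall>u\<in>U. \<forall>v\<in>U. N (u + v) = N u + N v) \<and> (\<forall>u\<in>U. \<forall>c. N (scale c u) = scale c (N u))"

text \<open>Finiteness of \<open>U / W\<close>, expressed by representatives in \<open>U\<close> so
  that no quotient space has to be formed.\<close>

definition finite_codim :: "'v set \<Rightarrow> 'v set \<Rightarrow> bool" where
  "finite_codim U W \<longleftrightarrow> (\<exists>B. finite B \<and> B \<subseteq> U \<and> (\<forall>u\<in>U. \<exists>c. u - (\<Sum>b\<in>B. scale (c b) b) \<in> W))"

definition poly_op :: "('v \<Rightarrow> 'v) \<Rightarrow> complex poly \<Rightarrow> 'v \<Rightarrow> 'v" where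
  "poly_op N p u = (\<Sum>i\<le>degree p. scale (coeff p i) ((N ^^ i) u))"

lemma poly_op_eq:
  assumes "degree p \<le> n"
  shows "poly_op N p u = (\<Sum>i\<le>n. scale (coeff p i) ((N ^^ i) u))"
  unfolding poly_op_def using assms
  by (intro sum.mono_neutral_left) (auto simp: coeff_eq_0)

context
  fixes U :: "'v set" and N :: "'v \<Rightarrow> 'v"
  assumes U: "subspace U" and N: "linear_endo U N"
begin

lemma endo_funpow: "u \<in> U \<Longrightarrow> (N ^^ i) u \<in> U"
  using N by (induction i) (auto simp: linear_endo_def)

lemma endo_zero: "N 0 = 0"
proof -
  have "N (scale 0 0) = scale 0 (N 0)"
    using N subspace_0[OF U] unfolding linear_endo_def by blast
  then show ?thesis by simp
qed

lemma endo_sum: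
  "finite I \<Longrightarrow> (\<And>i. i \<in> I \<Longrightarrow> f i \<in> U) \<Longrightarrow> N (\<Sum>i\<in>I. f i) = (\<Sum>i\<in>I. N (f i))"
proof (induction I rule: finite_induct)
  case (insert i I)
  then have "N (f i + sum f I) = N (f i) + N (sum f I)"
    using N subspace_sum[OF U, of I f] unfolding linear_endo_def by blast
  with insert show ?case by simp
qed (simp add: endo_zero)

lemma poly_op_in: "u \<in> U \<Longrightarrow> poly_op N p u \<in> U"
  unfolding poly_op_def by (auto intro!: subspace_sum[OF U] subspace_scale[OF U] endo_funpow)

lemma endo_poly_op:
  assumes u: "u \<in> U"
  shows "N (poly_op N p u) = (\<Sum>i\<le>degree p. scale (coeff p i) ((N ^^ Suc i) u))"
proof -
  have "N (poly_op N p u) = (\<Sum>i\<le>degree p. N (scale (coeff p i) ((N ^^ i) u)))"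
    unfolding poly_op_def
    by (intro endo_sum) (auto intro!: subspace_scale[OF U] endo_funpow u)
  also have "\<dots> = (\<Sum>i\<le>degree p. scale (coeff p i) ((N ^^ Suc i) u))"
    using N endo_funpow[OF u] by (intro sum.cong) (auto simp: linear_endo_def)
  finally show ?thesis .
qed

lemma poly_op_pCons:
  assumes u: "u \<in> U"
  shows "poly_op N (pCons a p) u = scale a u + N (poly_op N p u)"
proof -
  have "poly_op N (pCons a p) u = (\<Sum>i\<le>Suc (degree p). scale (coeff (pCons a p) i) ((N ^^ i) u))"
    by (intro poly_op_eq) (simp add: degree_pCons_eq_if)
  also have "\<dots> = scale a u + (\<Sum>i\<le>degree p. scale (coeff p i) ((N ^^ Suc i) u))"
    by (subst sum.atMost_Suc_shift) simp
  finally show ?thesis using endo_poly_op[OF u] by simp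
qed

lemma poly_op_add: "poly_op N (p + q) u = poly_op N p u + poly_op N q u"
proof -
  let ?n = "max (degree p) (degree q)"
  have "degree (p + q) \<le> ?n" by (rule degree_add_le_max)
  then show ?thesis
    by (simp add: poly_op_eq[of _ ?n] scale_left_distrib sum.distrib)
qed

lemma poly_op_smult: "poly_op N (smult c p) u = scale c (poly_op N p u)"
  using degree_smult_le[of c p]
  by (simp add: poly_op_eq[of _ "degree p"] scale_sum_right)

lemma poly_op_mult: "u \<in> U \<Longrightarrow> poly_op N (p * q) u = poly_op N p (poly_op N q u)"
proof (induction p)
  case 0
  then show ?case by (simp add: poly_op_def)
next
  case (pCons a p)
  have "poly_op N (pCons a p * q) u = scale a (poly_op N q u) + poly_op N (pCons 0 (p * q)) u"
    by (simp add: poly_op_add poly_op_smult)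
  also have "\<dots> = scale a (poly_op N q u) + N (poly_op N p (poly_op N q u))"
    using pCons by (simp add: poly_op_pCons)
  finally show ?case using pCons by (simp add: poly_op_pCons poly_op_in)
qed

lemma poly_op_const: "u \<in> U \<Longrightarrow> poly_op N [:c:] u = scale c u"
  by (simp add: poly_op_def)

lemma poly_op_linear: "u \<in> U \<Longrightarrow> poly_op N [:- c, 1:] u = N u - scale c u"
  by (simp add: poly_op_def)

lemma poly_op_subspace:
  assumes W: "subspace W" "N ` W \<subseteq> W" and "u \<in> W"
  shows "poly_op N p u \<in> W"
proof -
  have "(N ^^ i) u \<in> W" for i using assms by (induction i) auto
  then show ?thesis unfolding poly_op_def
    by (auto intro!: subspace_sum[OF W(1)] subspace_scale[OF W(1)])
qed

text \<open>With \<open>card B\<close> generators modulo \<open>W\<close>, the first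
  \<open>card B + 1\<close> iterates of \<open>N\<close> on \<open>u\<close> are dependent modulo
  \<open>W\<close>; the coefficients of the relation form the polynomial.\<close>

lemma annihilating_poly:
  assumes W: "subspace W" and fin: "finite_codim U W" and u: "u \<in> U"
  obtains p where "p \<noteq> 0" "poly_op N p u \<in> W"
proof -
  from fin obtain B where B: "finite B" "\<forall>u\<in>U. \<exists>c. u - (\<Sum>b\<in>B. scale (c b) b) \<in> W"
    unfolding finite_codim_def by blast
  let ?n = "card B"
  obtain a where a: "\<exists>i\<in>{..?n}. a i \<noteq> 0" "(\<Sum>i\<le>?n. scale (a i) ((N ^^ i) u)) \<in> W"
    using dependent_modulo[OF W B(1), of "{..?n}" "\<lambda>i. (N ^^ i) u"] B(2) endo_funpow[OF u]
    by auto
  define p where "p = (\<Sum>i\<le>?n. monom (a i) i)"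
  have coeff: "coeff p i = (if i \<le> ?n then a i else 0)" for i
    unfolding p_def by (auto simp: coeff_sum sum.delta' if_distrib cong: if_cong)
  have "degree p \<le> ?n" by (rule degree_le) (simp add: coeff)
  then have "poly_op N p u = (\<Sum>i\<le>?n. scale (a i) ((N ^^ i) u))"
    by (simp add: poly_op_eq[of p ?n] coeff)
  moreover have "p \<noteq> 0" using a(1) coeff by (metis atMost_iff coeff_0)
  ultimately show ?thesis using that a by simp
qed

text \<open>Linear factors are split off \<open>p\<close> until one of them carries a vector from
  outside \<open>W\<close> into \<open>W\<close>; that vector is the eigenvector, and invariance
  keeps it in \<open>S\<close>.\<close>

lemma eigenvector_of_poly:
  assumes W: "subspace W" and S: "S \<subseteq> U" "N ` S \<subseteq> S" "subspace S"
  shows "p \<noteq> 0 \<Longrightarrow> u \<in> S \<Longrightarrow> u \<notin> W \<Longrightarrow> poly_op N p u \<in> W \<Longrightarrow>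
    \<exists>\<psi>\<in>S. \<psi> \<notin> W \<and> (\<exists>\<mu>. N \<psi> - scale \<mu> \<psi> \<in> W)"
proof (induction "degree p" arbitrary: p)
  case 0
  then obtain c where c: "p = [:c:]" using degree_eq_zeroE by metis
  \<comment> \<open>A nonzero constant would put \<open>u\<close> itself into \<open>W\<close>, so
    the splitting stops before degree 0.\<close>
  then have "scale c u \<in> W" "c \<noteq> 0" using 0 S by (auto simp: poly_op_const)
  then have "scale (inverse c) (scale c u) \<in> W" using W by (blast intro: subspace_scale)
  with \<open>c \<noteq> 0\<close> 0 show ?case by simp
next
  case (Suc n)
  then obtain \<mu> where "poly p \<mu> = 0"
    using fundamental_theorem_of_algebra[of p] by (auto simp: constant_degree)
  then obtain q where q: "p = [:- \<mu>, 1:] * q" by (auto simp: poly_eq_0_iff_dvd)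
  then have "q \<noteq> 0" using Suc by auto
  then have "degree q = n" using Suc(2) q degree_mult_eq[of "[:- \<mu>, 1:]" q] by simp
  have uU: "u \<in> U" using Suc S by auto
  show ?case
  proof (cases "poly_op N q u \<in> W")
    case True
    then show ?thesis using Suc.hyps(1)[of q] \<open>degree q = n\<close> \<open>q \<noteq> 0\<close> Suc by blast
  next
    case False
    have "poly_op N p u = N (poly_op N q u) - scale \<mu> (poly_op N q u)"
      using uU unfolding q by (subst poly_op_mult) (auto simp: poly_op_linear poly_op_in)
    moreover have "poly_op N q u \<in> S" using poly_op_subspace[of S u q] Suc S by blast
    ultimately show ?thesis using False Suc by metis
  qed
qed

text \<open>\<open>S\<close> prescribes where the eigenvector is to be found: later it is the image
  of a derivative, or a common eigenspace of operators already treated.\<close>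

lemma eigenvector_modulo:
  assumes W: "subspace W" and fin: "finite_codim U W"
    and S: "S \<subseteq> U" "N ` S \<subseteq> S" "subspace S" and "\<not> S \<subseteq> W"
  obtains \<psi> \<mu> where "\<psi> \<in> S" "\<psi> \<notin> W" "N \<psi> - scale \<mu> \<psi> \<in> W"
proof -
  obtain u where u: "u \<in> S" "u \<notin> W" using assms by blast
  then obtain p where "p \<noteq> 0" "poly_op N p u \<in> W"
    using annihilating_poly[OF W fin, of u] S by blast
  then show ?thesis using eigenvector_of_poly[OF W S _ u] that by blast
qed

text \<open>Over the complex numbers \<open>p\<close> splits, and its linear factors are inverted
  one after the other until a nonzero constant is left.\<close>

lemma poly_op_surj:
  assumes surj: "\<And>\<mu> f. f \<in> U \<Longrightarrow> \<exists>g\<in>U. N g - scale \<mu> g = f"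
  shows "p \<noteq> 0 \<Longrightarrow> f \<in> U \<Longrightarrow> \<exists>g\<in>U. poly_op N p g = f"
proof (induction "degree p" arbitrary: p f)
  case 0
  then obtain c where c: "p = [:c:]" "c \<noteq> 0" using degree_eq_zeroE by (metis pCons_0_0)
  then have "poly_op N p (scale (inverse c) f) = f"
    using 0 by (simp add: poly_op_const subspace_scale[OF U])
  then show ?case using 0 subspace_scale[OF U] by blast
next
  case (Suc n)
  then obtain \<mu> where "poly p \<mu> = 0"
    using fundamental_theorem_of_algebra[of p] by (auto simp: constant_degree)
  then obtain q where q: "p = [:- \<mu>, 1:] * q" by (auto simp: poly_eq_0_iff_dvd)
  then have "q \<noteq> 0" using Suc by auto
  then have "degree q = n" using Suc(2) q degree_mult_eq[of "[:- \<mu>, 1:]" q] by simp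
  obtain h where h: "h \<in> U" "N h - scale \<mu> h = f" using surj Suc by blast
  then obtain g where g: "g \<in> U" "poly_op N q g = h"
    using Suc.hyps(1)[of q h] \<open>degree q = n\<close> \<open>q \<noteq> 0\<close> by auto
  have "poly_op N p g = f"
    using g h unfolding q by (subst poly_op_mult) (auto simp: poly_op_linear)
  then show ?case using g by blast
qed

lemma poly_op_sum:
  "finite I \<Longrightarrow> (\<And>i. i \<in> I \<Longrightarrow> f i \<in> U) \<Longrightarrow>
    poly_op N p (\<Sum>i\<in>I. scale (c i) (f i)) = (\<Sum>i\<in>I. scale (c i) (poly_op N p (f i)))"
proof (induction p)
  case 0
  then show ?case by (simp add: poly_op_def)
next
  case (pCons a p)
  have mem: "(\<Sum>i\<in>I. scale (c i) (f i)) \<in> U"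
    using pCons by (auto intro!: subspace_sum[OF U] subspace_scale[OF U])
  have "N (\<Sum>i\<in>I. scale (c i) (poly_op N p (f i))) = (\<Sum>i\<in>I. N (scale (c i) (poly_op N p (f i))))"
    using pCons by (intro endo_sum) (auto intro!: subspace_scale[OF U] poly_op_in)
  also have "\<dots> = (\<Sum>i\<in>I. scale (c i) (N (poly_op N p (f i))))"
    using N pCons by (intro sum.cong) (auto simp: linear_endo_def poly_op_in)
  finally have "N (poly_op N p (\<Sum>i\<in>I. scale (c i) (f i)))
      = (\<Sum>i\<in>I. scale (c i) (N (poly_op N p (f i))))"
    using pCons by simp
  then show ?case using pCons mem
    by (simp add: poly_op_pCons scale_right_distrib sum.distrib scale_sum_right mult.commute)
qed

lemma poly_op_diff:
  "u \<in> U \<Longrightarrow> v \<in> U \<Longrightarrow> poly_op N p (u - v) = poly_op N p u - poly_op N p v"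
  using poly_op_sum[of "{True, False}" "\<lambda>b. if b then u else v" p "\<lambda>b. if b then 1 else - 1"]
  by simp

text \<open>The product of annihilating polynomials of finitely many generators serves all of
  \<open>U\<close>, because polynomials in \<open>N\<close> commute and preserve
  \<open>W\<close>.\<close>

lemma uniform_annihilating_poly:
  assumes W: "subspace W" "N ` W \<subseteq> W" "W \<subseteq> U" and fin: "finite_codim U W"
  obtains p where "p \<noteq> 0" "\<And>u. u \<in> U \<Longrightarrow> poly_op N p u \<in> W"
proof -
  from fin obtain B where B: "finite B" "B \<subseteq> U"
      "\<forall>u\<in>U. \<exists>c. u - (\<Sum>b\<in>B. scale (c b) b) \<in> W"
    unfolding finite_codim_def by blast
  have "\<exists>p. p \<noteq> 0 \<and> (\<forall>b\<in>B. poly_op N p b \<in> W)"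
    using B(1,2)
  proof (induction B rule: finite_induct)
    case empty
    show ?case by (intro exI[of _ 1]) auto
  next
    case (insert b B)
    then obtain p where p: "p \<noteq> 0" "\<forall>b\<in>B. poly_op N p b \<in> W" by auto
    have "b \<in> U" using insert by simp
    from annihilating_poly[OF W(1) fin this]
    obtain q where q: "q \<noteq> 0" "poly_op N q b \<in> W" .
    have "poly_op N (p * q) x \<in> W" if "x \<in> insert b B" for x
    proof (cases "x = b")
      case True
      have "poly_op N (p * q) b = poly_op N p (poly_op N q b)"
        using insert by (intro poly_op_mult) auto
      then show ?thesis using True poly_op_subspace[OF W(1,2) q(2)] by simp
    next
      case False
      then have "x \<in> U" "poly_op N p x \<in> W" using that insert p by auto
      then have "poly_op N (q * p) x \<in> W"
        using poly_op_subspace[OF W(1,2)] by (simp only: poly_op_mult)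
      then show ?thesis by (simp only: mult.commute)
    qed
    then show ?case using p q by (intro exI[of _ "p * q"] conjI ballI) simp_all
  qed
  then obtain p where p: "p \<noteq> 0" "\<forall>b\<in>B. poly_op N p b \<in> W" by blast
  have "poly_op N p u \<in> W" if u: "u \<in> U" for u
  proof -
    obtain c where c: "u - (\<Sum>b\<in>B. scale (c b) b) \<in> W" using B u by blast
    have "(\<Sum>b\<in>B. scale (c b) b) \<in> U"
      using B by (auto intro!: subspace_sum[OF U] subspace_scale[OF U])
    then have "poly_op N p (u - (\<Sum>b\<in>B. scale (c b) b))
        = poly_op N p u - (\<Sum>b\<in>B. scale (c b) (poly_op N p b))"
      using u B by (simp add: poly_op_diff poly_op_sum subset_iff)
    moreover have "poly_op N p (u - (\<Sum>b\<in>B. scale (c b) b)) \<in> W"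
      using poly_op_subspace[OF W(1,2) c] .
    moreover have "(\<Sum>b\<in>B. scale (c b) (poly_op N p b)) \<in> W"
      using p by (auto intro!: subspace_sum[OF W(1)] subspace_scale[OF W(1)])
    ultimately show ?thesis using subspace_add[OF W(1)] by (metis diff_add_cancel)
  qed
  then show ?thesis using p that by blast
qed

text \<open>
  The annihilating polynomial of a finite-dimensional quotient is a product of factors
  \<open>N - \<mu>\<close>, so surjectivity of all of them leaves only the zero quotient.
\<close>

lemma finite_codim_surj_imp_subset:
  assumes W: "subspace W" "N ` W \<subseteq> W" "W \<subseteq> U" and fin: "finite_codim U W"
    and surj: "\<And>\<mu> f. f \<in> U \<Longrightarrow> \<exists>g\<in>U. N g - scale \<mu> g = f"
  shows "U \<subseteq> W"
proof
  fix f assume f: "f \<in> U"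
  obtain p where p: "p \<noteq> 0" "\<And>u. u \<in> U \<Longrightarrow> poly_op N p u \<in> W"
    using uniform_annihilating_poly[OF W fin] by blast
  obtain g where "g \<in> U" "poly_op N p g = f" using poly_op_surj[OF surj p(1) f] by blast
  then show "f \<in> W" using p by blast
qed

end

end

section \<open>Smooth functions and integrals along segments\<close>

text \<open>The direction comes first so that \<open>dird v\<close> is an operator on functions,
  which can be iterated and commuted with others.\<close>

definition dird :: "'a::real_normed_vector \<Rightarrow> ('a \<Rightarrow> 'b::real_normed_vector) \<Rightarrow> 'a \<Rightarrow> 'b" where
  "dird v f = (\<lambda>x. frechet_derivative f (at x) v)"

lemma times_cont_diff_Suc:
  "times_cont_diff (Suc k) f \<longleftrightarrow> (\<forall>x. f differentiable (at x)) \<and> (\<forall>v. times_cont_diff k (dird v f))"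
  by (simp add: dird_def)

declare times_cont_diff.simps(2) [simp del]

lemma dird_eqI: "(\<And>x. (f has_derivative D x) (at x)) \<Longrightarrow> dird v f = (\<lambda>x. D x v)"
  unfolding dird_def by (metis frechet_derivative_at)

lemma has_derivative_dird:
  "f differentiable (at x) \<Longrightarrow> (f has_derivative (\<lambda>v. dird v f x)) (at x)"
  unfolding dird_def by (simp add: frechet_derivative_works[symmetric])

lemma times_cont_diff_continuous: "times_cont_diff k f \<Longrightarrow> continuous_on UNIV f"
  by (cases k)
    (simp_all add: times_cont_diff_Suc continuous_on_eq_continuous_at differentiable_imp_continuous_within)

lemma times_cont_diff_SucD: "times_cont_diff (Suc k) f \<Longrightarrow> times_cont_diff k f"
  by (induction k arbitrary: f)
    (simp_all add: times_cont_diff_Suc continuous_on_eq_continuous_at differentiable_imp_continuous_within)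

lemma times_cont_diff_SucI:
  assumes "\<And>x. (f has_derivative D x) (at x)" and "\<And>v. times_cont_diff k (\<lambda>x. D x v)"
  shows "times_cont_diff (Suc k) f"
  using assms dird_eqI[of f D] by (auto simp: times_cont_diff_Suc differentiable_def)

lemma smooth_differentiable: "smooth f \<Longrightarrow> f differentiable (at x)"
  unfolding smooth_def using times_cont_diff_Suc by blast

lemma smooth_dird: "smooth f \<Longrightarrow> smooth (dird v f)"
  unfolding smooth_def using times_cont_diff_Suc by blast

lemma smooth_continuous: "smooth f \<Longrightarrow> continuous_on UNIV f"
  unfolding smooth_def using times_cont_diff_continuous by blast

lemma smooth_has_derivative:
  "smooth f \<Longrightarrow> (f has_derivative (\<lambda>v. dird v f x)) (at x)"
  by (simp add: has_derivative_dird smooth_differentiable)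

lemma smoothI:
  assumes "\<And>x. (f has_derivative D x) (at x)" and "\<And>v. smooth (\<lambda>x. D x v)"
  shows "smooth f"
  unfolding smooth_def
proof
  fix k
  have "times_cont_diff (Suc k) f"
    using assms by (intro times_cont_diff_SucI) (auto simp: smooth_def)
  then show "times_cont_diff k f" by (rule times_cont_diff_SucD)
qed

lemma times_cont_diff_add:
  "times_cont_diff k f \<Longrightarrow> times_cont_diff k g \<Longrightarrow> times_cont_diff k (\<lambda>x. f x + g x)"
proof (induction k arbitrary: f g)
  case (Suc k)
  then show ?case
    by (intro times_cont_diff_SucI[where D = "\<lambda>x v. dird v f x + dird v g x"])
      (auto simp: times_cont_diff_Suc intro!: has_derivative_add has_derivative_dird)
qed (auto intro: continuous_on_add)

lemma times_cont_diff_bounded_linear: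
  assumes h: "bounded_linear h"
  shows "times_cont_diff k f \<Longrightarrow> times_cont_diff k (\<lambda>x. h (f x))"
proof (induction k arbitrary: f)
  case (Suc k)
  then show ?case
    by (intro times_cont_diff_SucI[where D = "\<lambda>x v. h (dird v f x)"])
      (auto simp: times_cont_diff_Suc intro!: bounded_linear.has_derivative[OF h] has_derivative_dird)
qed (auto intro: bounded_linear.continuous_on[OF h])

lemma times_cont_diff_mult:
  fixes f g :: "'a::real_normed_vector \<Rightarrow> complex"
  shows "times_cont_diff k f \<Longrightarrow> times_cont_diff k g \<Longrightarrow> times_cont_diff k (\<lambda>x. f x * g x)"
proof (induction k arbitrary: f g)
  case (Suc k)
  show ?case
  proof (rule times_cont_diff_SucI[where D = "\<lambda>x v. f x * dird v g x + dird v f x * g x"])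
    show "((\<lambda>x. f x * g x) has_derivative (\<lambda>v. f x * dird v g x + dird v f x * g x)) (at x)" for x
      using Suc.prems by (intro has_derivative_mult has_derivative_dird) (auto simp: times_cont_diff_Suc)
    show "times_cont_diff k (\<lambda>x. f x * dird v g x + dird v f x * g x)" for v
      using Suc by (intro times_cont_diff_add Suc.IH) (auto simp: times_cont_diff_Suc intro: times_cont_diff_SucD)
  qed
qed (auto intro: continuous_on_mult)

lemma times_cont_diff_const: "times_cont_diff k (\<lambda>x. c)"
proof (induction k arbitrary: c)
  case (Suc k)
  then show ?case
    by (intro times_cont_diff_SucI[where D = "\<lambda>x v. 0"]) (auto intro: has_derivative_const)
qed auto

lemma smooth_add: "smooth f \<Longrightarrow> smooth g \<Longrightarrow> smooth (\<lambda>x. f x + g x)"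
  by (simp add: smooth_def times_cont_diff_add)

lemma smooth_bounded_linear: "bounded_linear h \<Longrightarrow> smooth f \<Longrightarrow> smooth (\<lambda>x. h (f x))"
  by (simp add: smooth_def times_cont_diff_bounded_linear)

lemma smooth_mult:
  fixes f g :: "'a::real_normed_vector \<Rightarrow> complex"
  shows "smooth f \<Longrightarrow> smooth g \<Longrightarrow> smooth (\<lambda>x. f x * g x)"
  by (simp add: smooth_def times_cont_diff_mult)

lemma smooth_const [simp]: "smooth (\<lambda>x. c)"
  by (simp add: smooth_def times_cont_diff_const)

lemma smooth_linear: "bounded_linear h \<Longrightarrow> smooth h"
  by (rule smoothI[where D = "\<lambda>x. h"]) (auto intro: bounded_linear_imp_has_derivative)

lemma smooth_cmult: "smooth f \<Longrightarrow> smooth (\<lambda>x. (c::complex) * f x)"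
  by (intro smooth_mult) auto

lemma smooth_diff: "smooth f \<Longrightarrow> smooth g \<Longrightarrow> smooth (\<lambda>x. f x - (g x :: complex))"
  using smooth_add[of f "\<lambda>x. -1 * g x"] smooth_cmult[of g "-1"] by simp

lemma smooth_cnj: "smooth f \<Longrightarrow> smooth (\<lambda>x. cnj (f x))"
  by (rule smooth_bounded_linear[OF bounded_linear_cnj])

text \<open>Differentiation reproduces the exponential up to the constant \<open>h v\<close>, so the
  induction on the order stays with a single function.\<close>

lemma smooth_exp_linear:
  fixes h :: "'a::real_normed_vector \<Rightarrow> complex"
  assumes h: "bounded_linear h"
  shows "smooth (\<lambda>x. exp (h x))"
  unfolding smooth_def
proof
  fix k
  have der: "((\<lambda>x. exp (h x)) has_derivative (\<lambda>v. h v * exp (h x))) (at x)" for x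
    using has_derivative_compose[OF bounded_linear_imp_has_derivative[OF h] DERIV_exp[unfolded has_field_derivative_def]] by (simp add: mult.commute)
  show "times_cont_diff k (\<lambda>x. exp (h x))"
  proof (induction k)
    case 0
    then show ?case by (auto intro!: continuous_on_exp linear_continuous_on[OF h])
  next
    case (Suc k)
    then have "times_cont_diff k (\<lambda>x. h v * exp (h x))" for v
      using times_cont_diff_mult[OF times_cont_diff_const] by blast
    then show ?case by (rule times_cont_diff_SucI[OF der])
  qed
qed

lemma dird_add: "smooth f \<Longrightarrow> smooth g \<Longrightarrow> dird v (\<lambda>x. f x + g x) = (\<lambda>x. dird v f x + dird v g x)"
  by (rule dird_eqI[OF has_derivative_add[OF smooth_has_derivative smooth_has_derivative]])

lemma dird_bounded_linear:
  "bounded_linear h \<Longrightarrow> smooth f \<Longrightarrow> dird v (\<lambda>x. h (f x)) = (\<lambda>x. h (dird v f x))"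
  by (rule dird_eqI[OF bounded_linear.has_derivative[OF _ smooth_has_derivative]])

lemma dird_cmult:
  "smooth f \<Longrightarrow> dird v (\<lambda>x. (c::complex) * f x) = (\<lambda>x. c * dird v f x)"
  by (rule dird_bounded_linear[OF bounded_linear_mult_right])

lemma dird_mult:
  fixes f g :: "'a::real_normed_vector \<Rightarrow> complex"
  shows "smooth f \<Longrightarrow> smooth g \<Longrightarrow> dird v (\<lambda>x. f x * g x) = (\<lambda>x. f x * dird v g x + dird v f x * g x)"
  by (rule dird_eqI[OF has_derivative_mult[OF smooth_has_derivative smooth_has_derivative]])

lemma dird_diff:
  "smooth f \<Longrightarrow> smooth g \<Longrightarrow> dird v (\<lambda>x. f x - (g x::complex)) = (\<lambda>x. dird v f x - dird v g x)"
  by (rule dird_eqI[OF has_derivative_diff[OF smooth_has_derivative smooth_has_derivative]])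

lemma dird_const [simp]: "dird v (\<lambda>x. c) = (\<lambda>x. 0)"
  by (rule dird_eqI) (rule has_derivative_const)

lemma dird_linear: "bounded_linear h \<Longrightarrow> dird v h = (\<lambda>x. h v)"
  by (rule dird_eqI) (rule bounded_linear_imp_has_derivative)

lemma dird_exp_linear:
  fixes h :: "'a::real_normed_vector \<Rightarrow> complex"
  assumes h: "bounded_linear h"
  shows "dird v (\<lambda>x. exp (h x)) = (\<lambda>x. h v * exp (h x))"
  using has_derivative_compose[OF bounded_linear_imp_has_derivative[OF h] DERIV_exp[unfolded has_field_derivative_def]]
  by (intro dird_eqI) (simp add: mult.commute)

lemma linear_dird: "smooth f \<Longrightarrow> linear (\<lambda>v. dird v f x)"
  using smooth_has_derivative has_derivative_linear by blast

lemma dird_add_vec: "smooth f \<Longrightarrow> dird (v + w) f x = dird v f x + dird w f x"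
  using linear_add[OF linear_dird] by blast

lemma dird_scale_vec: "smooth f \<Longrightarrow> dird (r *\<^sub>R v) f x = r *\<^sub>R dird v f x"
  using linear_scale[OF linear_dird] by blast

section \<open>Weighted integrals along segments\<close>

lemma dird_line:
  assumes "smooth f"
  shows "((\<lambda>s. f (x + s *\<^sub>R v)) has_vector_derivative dird v f (x + s *\<^sub>R v)) (at s within S)"
proof -
  have "((\<lambda>s. x + s *\<^sub>R v) has_derivative (\<lambda>t. t *\<^sub>R v)) (at s within S)"
    by (auto intro!: derivative_eq_intros)
  from has_derivative_compose[OF this smooth_has_derivative[OF assms]]
  show ?thesis
    using assms by (simp add: has_vector_derivative_def dird_scale_vec)
qed

text \<open>The displacement depends affinely on the base point: \<open>L = 0\<close> gives
  integrals along a fixed vector, \<open>L x = - h x *\<^sub>R e\<close> those running back to the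
  hyperplane \<open>h = 0\<close>. The weight \<open>c\<close> makes room for integrating
  factors.\<close>

definition affine_integral ::
  "(real \<Rightarrow> complex) \<Rightarrow> ('a::euclidean_space \<Rightarrow> 'a) \<Rightarrow> 'a \<Rightarrow> ('a \<Rightarrow> complex) \<Rightarrow> 'a \<Rightarrow> complex" where
  "affine_integral c L v g x = integral {0..1} (\<lambda>r. c r * g (x + r *\<^sub>R (L x + v)))"

lemma continuous_on_affine_integrand:
  fixes c :: "real \<Rightarrow> complex" and g :: "'a::real_normed_vector \<Rightarrow> complex"
  assumes c: "continuous_on {0..1} c" and L: "bounded_linear L" and g: "continuous_on UNIV g"
  shows "continuous_on (S \<times> {0..1}) (\<lambda>(x, r). c r * g (x + r *\<^sub>R (L x + v)))"
  unfolding split_beta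
  by (intro continuous_intros continuous_on_compose2[OF c] continuous_on_compose2[OF g]
      bounded_linear.continuous_on[OF L]) auto

lemma integrable_affine:
  fixes c :: "real \<Rightarrow> complex" and g :: "'a::real_normed_vector \<Rightarrow> complex"
  assumes c: "continuous_on {0..1} c" and g: "continuous_on UNIV g"
  shows "(\<lambda>r. c r * g (x + r *\<^sub>R w)) integrable_on {0..1::real}"
  by (intro integrable_continuous_interval continuous_intros c continuous_on_compose2[OF g]) auto

text \<open>Differentiation under the integral sign: the point
  \<open>x + r *\<^sub>R (L x + v)\<close> moves by \<open>w + r *\<^sub>R L w\<close>, and the
  second summand multiplies the weight by \<open>r\<close>.\<close>

lemma affine_integral_has_derivative:
  fixes g :: "'a::euclidean_space \<Rightarrow> complex"
  assumes c: "continuous_on {0..1} c" and L: "bounded_linear L"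
    and g: "times_cont_diff (Suc 0) g"
  shows "(affine_integral c L v g has_derivative
    (\<lambda>w. affine_integral c L v (dird w g) x
       + affine_integral (\<lambda>r. c r * of_real r) L v (dird (L w) g) x)) (at x)"
proof -
  define M where "M r x = x + r *\<^sub>R (L x + v)" for r x
  have gd: "(g has_derivative (\<lambda>w. dird w g y)) (at y)" for y
    using g by (auto simp: times_cont_diff_Suc intro: has_derivative_dird)
  have gc: "continuous_on UNIV (dird w g)" for w
    using g by (simp add: times_cont_diff_Suc)
  have g0: "continuous_on UNIV g" using times_cont_diff_continuous[OF g] .
  have lin: "dird (w + r *\<^sub>R L w) g y = dird w g y + of_real r * dird (L w) g y" for w r y
    by (simp add: linear_add[OF has_derivative_linear[OF gd]]
        linear_scale[OF has_derivative_linear[OF gd]] scaleR_conv_of_real)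
  \<comment> \<open>The Leibniz rule asks for a derivative that is jointly continuous as a bounded
    linear map; this continuity is then checked on basis vectors.\<close>
  define F where "F x r = Blinfun (\<lambda>w. c r * dird (w + r *\<^sub>R L w) g (M r x))" for x r
  have der: "((\<lambda>x. c r * g (M r x)) has_derivative
      (\<lambda>w. c r * dird (w + r *\<^sub>R L w) g (M r x))) (at x)" for x r
  proof -
    have "(M r has_derivative (\<lambda>w. w + r *\<^sub>R L w)) (at x)"
      unfolding M_def
      by (auto intro!: derivative_eq_intros bounded_linear.has_derivative[OF L])
    from has_derivative_compose[OF this gd]
    show ?thesis by (auto intro!: derivative_eq_intros)
  qed
  have Fapp: "blinfun_apply (F x r) w = c r * dird (w + r *\<^sub>R L w) g (M r x)" for x r w
    unfolding F_def using has_derivative_bounded_linear[OF der]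
    by (simp add: bounded_linear_Blinfun_apply)
  then have Fapp_eq: "blinfun_apply (F x r) = (\<lambda>w. c r * dird (w + r *\<^sub>R L w) g (M r x))" for x r
    by (intro ext)
  have Fapp': "blinfun_apply (F x r) w
      = c r * dird w g (M r x) + c r * of_real r * dird (L w) g (M r x)" for x r w
    by (simp add: Fapp lin distrib_left mult.assoc)
  have c': "continuous_on {0..1} (\<lambda>r. c r * of_real r)"
    by (intro continuous_intros c)
  have contF: "continuous_on (UNIV \<times> cbox 0 1) (\<lambda>(x, r). F x r)"
  proof (rule continuous_on_blinfun_componentwise)
    fix i :: 'a assume "i \<in> Basis"
    show "continuous_on (UNIV \<times> cbox 0 1) (\<lambda>p. blinfun_apply (case p of (x, r) \<Rightarrow> F x r) i)"
      using continuous_on_add[OF continuous_on_affine_integrand[OF c L gc[of i], of UNIV v]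
          continuous_on_affine_integrand[OF c' L gc[of "L i"], of UNIV v]]
      by (simp add: split_beta Fapp' M_def)
  qed
  have "((\<lambda>x. integral (cbox 0 1) (\<lambda>r. c r * g (M r x))) has_derivative
      blinfun_apply (integral (cbox 0 1) (F x))) (at x within UNIV)"
  proof (rule leibniz_rule[OF _ _ contF])
    show "((\<lambda>x. c r * g (M r x)) has_derivative blinfun_apply (F y r)) (at y within UNIV)" for y r
      using der[of r y] by (simp add: Fapp_eq)
    show "(\<lambda>r. c r * g (M r y)) integrable_on cbox 0 1" for y
      using integrable_affine[OF c g0] by (simp add: M_def)
  qed auto
  moreover have "blinfun_apply (integral (cbox 0 1) (F x)) w = affine_integral c L v (dird w g) x
       + affine_integral (\<lambda>r. c r * of_real r) L v (dird (L w) g) x" for w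
  proof -
    have "continuous_on {0..1} (F x)"
      using continuous_on_compose2[OF contF, of "{0..1}" "\<lambda>r. (x, r)"] continuous_on_Pair
      by (simp add: continuous_on_Pair image_subset_iff)
    then have "F x integrable_on cbox 0 1"
      using integrable_continuous_interval by fastforce
    then have "blinfun_apply (integral (cbox 0 1) (F x)) w
        = integral (cbox 0 1) (\<lambda>r. blinfun_apply (F x r) w)"
      by (simp add: blinfun_apply_integral)
    also have "\<dots> = integral {0..1} (\<lambda>r. c r * dird w g (M r x)
        + c r * of_real r * dird (L w) g (M r x))"
      by (simp add: Fapp')
    also have "\<dots> = affine_integral c L v (dird w g) x
       + affine_integral (\<lambda>r. c r * of_real r) L v (dird (L w) g) x"
      unfolding affine_integral_def M_def
      by (rule integral_add[OF integrable_affine[OF c gc] integrable_affine[OF c' gc]])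
    finally show ?thesis .
  qed
  then have "blinfun_apply (integral (cbox 0 1) (F x)) = (\<lambda>w. affine_integral c L v (dird w g) x
       + affine_integral (\<lambda>r. c r * of_real r) L v (dird (L w) g) x)"
    by (intro ext)
  ultimately show ?thesis
    unfolding affine_integral_def[of c L v g, abs_def] by (simp add: M_def)
qed

text \<open>One order of differentiability is given away, which costs nothing for smooth functions.
  The weight varies in the induction because each derivative has a term with an additional factor
  \<open>r\<close>.\<close>

lemma times_cont_diff_affine_integral:
  fixes g :: "'a::euclidean_space \<Rightarrow> complex"
  assumes L: "bounded_linear L"
  shows "continuous_on {0..1} c \<Longrightarrow> times_cont_diff (Suc k) g \<Longrightarrow>
    times_cont_diff k (affine_integral c L v g)"
proof (induction k arbitrary: c g)
  case 0
  then show ?case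
    using affine_integral_has_derivative[OF _ L, of c g v]
    by (auto intro!: continuous_at_imp_continuous_on has_derivative_continuous)
next
  case (Suc k)
  have c': "continuous_on {0..1} (\<lambda>r. c r * of_real r)"
    by (intro continuous_intros Suc)
  have g: "times_cont_diff (Suc k) (dird w g)" for w
    using Suc.prems(2) times_cont_diff_Suc by blast
  then have 1: "times_cont_diff (Suc 0) g"
    using Suc.prems(2) times_cont_diff_continuous[OF g]
    unfolding times_cont_diff_Suc[of 0] times_cont_diff_Suc[of "Suc k"] times_cont_diff.simps(1)
    by blast
  show ?case
    by (rule times_cont_diff_SucI[OF affine_integral_has_derivative[OF Suc.prems(1) L 1]])
      (rule times_cont_diff_add[OF Suc.IH[OF Suc.prems(1) g] Suc.IH[OF c' g]])
qed

lemma smooth_affine_integral: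
  assumes "bounded_linear L" "continuous_on {0..1} c" "smooth g"
  shows "smooth (affine_integral c L v g)"
  using assms by (simp add: smooth_def times_cont_diff_affine_integral)

lemma dird_affine_integral:
  assumes L: "bounded_linear L" and c: "continuous_on {0..1} c" and g: "smooth g"
  shows "dird w (affine_integral c L v g) =
    (\<lambda>x. affine_integral c L v (dird w g) x
       + affine_integral (\<lambda>r. c r * of_real r) L v (dird (L w) g) x)"
proof -
  have "times_cont_diff (Suc 0) g" using g unfolding smooth_def by blast
  from dird_eqI[OF affine_integral_has_derivative[OF c L this]] show ?thesis .
qed

text \<open>The derivative in \<open>r\<close> of \<open>c r * g (x + r *\<^sub>R w)\<close>,
  integrated from 0 to 1. The weights inserted later are 1, \<open>1 - r\<close> and the exponential
  of \<open>- \<mu> * r\<close>.\<close>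

lemma affine_FTC:
  fixes g :: "'a::euclidean_space \<Rightarrow> complex"
  assumes g: "smooth g"
    and c: "\<And>r. (c has_vector_derivative c' r) (at r within {0..1})" and c': "continuous_on {0..1} c'"
  shows "integral {0..1} (\<lambda>r. c r * dird w g (x + r *\<^sub>R w))
       + integral {0..1} (\<lambda>r. c' r * g (x + r *\<^sub>R w)) = c 1 * g (x + w) - c 0 * g x"
proof -
  have cc: "continuous_on {0..1} c"
    using c by (auto intro!: has_vector_derivative_continuous simp: continuous_on_eq_continuous_within)
  have "((\<lambda>r. c r * g (x + r *\<^sub>R w)) has_vector_derivative
      (c r * dird w g (x + r *\<^sub>R w) + c' r * g (x + r *\<^sub>R w))) (at r within {0..1})" for r
    by (rule has_vector_derivative_mult[OF c dird_line[OF g]])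
  then have I: "((\<lambda>r. c r * dird w g (x + r *\<^sub>R w) + c' r * g (x + r *\<^sub>R w)) has_integral
      (c 1 * g (x + 1 *\<^sub>R w) - c 0 * g (x + 0 *\<^sub>R w))) {0..1}"
    by (intro fundamental_theorem_of_calculus) auto
  have "integral {0..1} (\<lambda>r. c r * dird w g (x + r *\<^sub>R w) + c' r * g (x + r *\<^sub>R w))
      = integral {0..1} (\<lambda>r. c r * dird w g (x + r *\<^sub>R w))
       + integral {0..1} (\<lambda>r. c' r * g (x + r *\<^sub>R w))"
    by (intro integral_add integrable_affine cc c' smooth_continuous smooth_dird g)
  with integral_unique[OF I] show ?thesis by simp
qed

abbreviation seg_integral ::
  "(real \<Rightarrow> complex) \<Rightarrow> 'a::euclidean_space \<Rightarrow> ('a \<Rightarrow> complex) \<Rightarrow> 'a \<Rightarrow> complex" where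
  "seg_integral c \<equiv> affine_integral c (\<lambda>_. 0)"

lemma smooth_seg_integral:
  "continuous_on {0..1} c \<Longrightarrow> smooth g \<Longrightarrow> smooth (seg_integral c v g)"
  by (rule smooth_affine_integral[OF bounded_linear_zero])

lemma dird_zero: "smooth g \<Longrightarrow> dird 0 g = (\<lambda>x. 0)"
  using linear_0[OF linear_dird] by blast

lemma dird_seg_integral:
  assumes "continuous_on {0..1} c" "smooth g"
  shows "dird w (seg_integral c v g) = seg_integral c v (dird w g)"
  using dird_affine_integral[OF bounded_linear_zero assms, of w v] assms
  by (simp add: dird_zero) (simp add: affine_integral_def[abs_def])

lemma seg_integral_FTC:
  assumes "smooth g"
    and "\<And>r. (c has_vector_derivative c' r) (at r within {0..1})" and "continuous_on {0..1} c'"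
  shows "seg_integral c v (dird v g) x + seg_integral c' v g x = c 1 * g (x + v) - c 0 * g x"
  unfolding affine_integral_def using affine_FTC[OF assms, of v x] by simp

lemma affine_integral_add:
  assumes "continuous_on {0..1} c" "smooth g" "smooth h"
  shows "affine_integral c L v (\<lambda>x. g x + h x) x = affine_integral c L v g x + affine_integral c L v h x"
  unfolding affine_integral_def distrib_left
  by (intro integral_add integrable_affine assms smooth_continuous)

lemma affine_integral_cmult:
  "affine_integral c L v (\<lambda>x. a * g x) x = a * affine_integral c L v g x"
  by (simp add: affine_integral_def mult.left_commute[of _ a])

lemma affine_integral_cmult_left:
  "affine_integral (\<lambda>r. a * c r) L v g x = a * affine_integral c L v g x"
  by (simp add: affine_integral_def mult.assoc)

lemma affine_integral_add_left:
  assumes "continuous_on {0..1} c" "continuous_on {0..1} c'" "smooth g"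
  shows "affine_integral (\<lambda>r. c r + c' r) L v g x = affine_integral c L v g x + affine_integral c' L v g x"
  unfolding affine_integral_def distrib_right
  by (intro integral_add integrable_affine assms smooth_continuous)

lemma affine_integral_diff:
  assumes "continuous_on {0..1} c" "smooth g" "smooth h"
  shows "affine_integral c L v (\<lambda>x. g x - h x) x = affine_integral c L v g x - affine_integral c L v h x"
  unfolding affine_integral_def right_diff_distrib
  by (intro integral_diff integrable_affine assms smooth_continuous)

lemma affine_integral_const_one: "affine_integral (\<lambda>_. 1) L v (\<lambda>_. a) x = a"
  by (simp add: affine_integral_def)

lemma dird_shift:
  assumes f: "smooth f"
  shows "dird w (\<lambda>y. f (y + v)) = (\<lambda>y. dird w f (y + v))"
proof (rule dird_eqI)
  fix y
  have "((\<lambda>y. y + v) has_derivative (\<lambda>w. w)) (at y)"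
    by (auto intro!: derivative_eq_intros)
  from has_derivative_compose[OF this smooth_has_derivative[OF f]]
  show "((\<lambda>y. f (y + v)) has_derivative (\<lambda>w. dird w f (y + v))) (at y)" .
qed

text \<open>Writing \<open>f (y + t *\<^sub>R v)\<close> as \<open>f y\<close> plus an integral and
  differentiating along \<open>w\<close> under the integral sign gives an exact formula for the
  difference quotient of \<open>dird w f\<close> along \<open>v\<close>; its limit follows from
  continuity.\<close>

lemma dird_commute:
  fixes f :: "'a::euclidean_space \<Rightarrow> complex"
  assumes f: "smooth f"
  shows "dird v (dird w f) = dird w (dird v f)"
proof
  fix x
  define h where "h = dird w (dird v f)"
  \<comment> \<open>The mean of the mixed derivative over the segment from \<open>x\<close> to
    \<open>x + t *\<^sub>R v\<close>; it is the difference quotient itself when \<open>t\<close> is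
    not 0.\<close>
  define p where "p t = integral (cbox 0 1) (\<lambda>r. h (x + r *\<^sub>R (t *\<^sub>R v)))" for t :: real
  have hs: "smooth h" unfolding h_def by (intro smooth_dird f)
  have eq: "dird w f (x + t *\<^sub>R v) = dird w f x + t *\<^sub>R p t" for t
  proof -
    let ?v = "t *\<^sub>R v"
    have ddt: "dird ?v f = (\<lambda>x. of_real t * dird v f x)"
      using f by (auto simp: dird_scale_vec scaleR_conv_of_real)
    have "f (y + ?v) = f y + seg_integral (\<lambda>_. 1) ?v (dird ?v f) y" for y
      using seg_integral_FTC[OF f, of "\<lambda>_. 1" "\<lambda>_. 0" ?v y]
      by (simp add: affine_integral_def algebra_simps)
    then have "(\<lambda>y. f (y + ?v)) = (\<lambda>y. f y + seg_integral (\<lambda>_. 1) ?v (dird ?v f) y)" by blast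
    moreover have "dird w (\<lambda>y. f (y + ?v)) = (\<lambda>y. dird w f (y + ?v))"
      using f by (rule dird_shift)
    moreover have "dird w (\<lambda>y. f y + seg_integral (\<lambda>_. 1) ?v (dird ?v f) y)
        = (\<lambda>y. dird w f y + seg_integral (\<lambda>_. 1) ?v (dird w (dird ?v f)) y)"
      using f by (simp add: dird_add smooth_seg_integral smooth_dird dird_seg_integral)
    moreover have "dird w (dird ?v f) = (\<lambda>x. of_real t * h x)"
      unfolding ddt h_def by (intro dird_cmult smooth_dird f)
    ultimately have "dird w f (x + ?v) = dird w f x + seg_integral (\<lambda>_. 1) ?v (\<lambda>x. of_real t * h x) x"
      by metis
    then show ?thesis
      by (simp add: affine_integral_cmult scaleR_conv_of_real) (simp add: affine_integral_def p_def)
  qed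
  have "continuous_on UNIV p"
    unfolding p_def
    by (rule integral_continuous_on_param)
      (auto simp: split_beta intro!: continuous_intros continuous_on_compose2[OF smooth_continuous[OF hs]])
  then have "(p \<longlongrightarrow> p 0) (at 0)" by (auto simp: continuous_on_eq_continuous_at isCont_def)
  then have p0: "((\<lambda>t. norm (p t - p 0)) \<longlongrightarrow> 0) (at 0)"
    using LIM_zero tendsto_norm_zero by blast
  have "((\<lambda>t. dird w f (x + t *\<^sub>R v)) has_vector_derivative p 0) (at 0)"
    unfolding has_vector_derivative_def has_derivative_iff_norm
  proof (intro conjI bounded_linear_scaleR_left)
    have "norm (dird w f (x + t *\<^sub>R v) - dird w f (x + 0 *\<^sub>R v) - (t - 0) *\<^sub>R p 0) / norm (t - 0)
        = norm (p t - p 0)" if "t \<noteq> 0" for t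
    proof -
      have "dird w f (x + t *\<^sub>R v) - dird w f (x + 0 *\<^sub>R v) - (t - 0) *\<^sub>R p 0 = t *\<^sub>R (p t - p 0)"
        by (simp add: eq scaleR_diff_right)
      then show ?thesis using that by simp
    qed
    then show "((\<lambda>t. norm (dird w f (x + t *\<^sub>R v) - dird w f (x + 0 *\<^sub>R v) - (t - 0) *\<^sub>R p 0)
        / norm (t - 0)) \<longlongrightarrow> 0) (at 0)"
      using p0 by (subst tendsto_cong[of _ "\<lambda>t. norm (p t - p 0)"]) (auto simp: eventually_at_filter)
  qed
  moreover have "((\<lambda>t. dird w f (x + t *\<^sub>R v)) has_vector_derivative dird v (dird w f) x) (at 0)"
    using dird_line[OF smooth_dird[OF f], of w x v 0 UNIV] by simp
  ultimately have "dird v (dird w f) x = p 0" by (metis vector_derivative_unique_at)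
  then show "dird v (dird w f) x = dird w (dird v f) x" by (simp add: p_def h_def)
qed

lemma has_vector_derivative_one_minus:
  "((\<lambda>r. 1 - complex_of_real r) has_vector_derivative - 1) (at r within S)"
  unfolding has_vector_derivative_def
  by (auto intro!: derivative_eq_intros simp: scaleR_conv_of_real)

text \<open>When \<open>h e = 1\<close>, this is the integral of \<open>g\<close> along the line in
  direction \<open>e\<close> from the hyperplane \<open>h = 0\<close> to \<open>x\<close>, rescaled
  to a fixed interval so that no variable limit of integration occurs.\<close>

definition primitive :: "('a::euclidean_space \<Rightarrow> real) \<Rightarrow> 'a \<Rightarrow> ('a \<Rightarrow> complex) \<Rightarrow> 'a \<Rightarrow> complex" where
  "primitive h e g x = of_real (h x) * affine_integral (\<lambda>_. 1) (\<lambda>x. - h x *\<^sub>R e) 0 g x"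

context
  fixes h :: "'a::euclidean_space \<Rightarrow> real" and e :: 'a
  assumes h: "bounded_linear h" and e: "h e = 1"
begin

lemma bounded_linear_retraction: "bounded_linear (\<lambda>x. - h x *\<^sub>R e)"
  using bounded_linear_minus[OF bounded_linear_scaleR_const[OF h, of e]] by simp

lemma bounded_linear_coord: "bounded_linear (\<lambda>x. complex_of_real (h x))"
  by (rule bounded_linear_compose[OF Real_Vector_Spaces.bounded_linear_of_real h])

lemma smooth_primitive: "smooth g \<Longrightarrow> smooth (primitive h e g)"
  unfolding primitive_def[abs_def]
  by (rule smooth_mult[OF smooth_linear[OF bounded_linear_coord]
        smooth_affine_integral[OF bounded_linear_retraction continuous_on_const]])

text \<open>The part of \<open>w\<close> parallel to the hyperplane passes under the integral; the
  part along \<open>e\<close> gives back \<open>g\<close> by the fundamental theorem.\<close>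

lemma dird_primitive:
  assumes g: "smooth g"
  shows "dird w (primitive h e g) = (\<lambda>x. of_real (h w) * g x + primitive h e (dird (w - h w *\<^sub>R e) g) x)"
proof
  fix x
  let ?L = "\<lambda>x. - h x *\<^sub>R e"
  let ?I = "\<lambda>c. affine_integral c ?L 0"
  let ?k = "dird (w - h w *\<^sub>R e) g"
  have split: "dird w g = (\<lambda>y. ?k y + of_real (h w) * dird e g y)"
    using dird_add_vec[OF g, of "w - h w *\<^sub>R e" "h w *\<^sub>R e"] dird_scale_vec[OF g]
    by (auto simp: scaleR_conv_of_real)
  have neg: "dird (?L w) g = (\<lambda>y. - of_real (h w) * dird e g y)"
    using dird_scale_vec[OF g, of "- h w" e] by (auto simp: scaleR_conv_of_real)
  have hs: "smooth ?k" "smooth (dird e g)" by (intro smooth_dird g)+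
  have "dird w (primitive h e g) x = of_real (h x) * dird w (?I (\<lambda>_. 1) g) x + of_real (h w) * ?I (\<lambda>_. 1) g x"
    unfolding primitive_def[abs_def]
    using dird_linear[OF bounded_linear_coord, of w]
    by (simp only: dird_mult[OF smooth_linear[OF bounded_linear_coord]
        smooth_affine_integral[OF bounded_linear_retraction continuous_on_const g]])
  also have "dird w (?I (\<lambda>_. 1) g) x = ?I (\<lambda>_. 1) ?k x + of_real (h w) * ?I (\<lambda>_. 1) (dird e g) x
      - of_real (h w) * ?I of_real (dird e g) x"
    using hs unfolding dird_affine_integral[OF bounded_linear_retraction continuous_on_const g]
    unfolding neg split
    by (simp add: affine_integral_add smooth_cmult affine_integral_cmult del: of_real_minus mult_minus_left)
       (simp add: affine_integral_cmult[where a = "- _", simplified] )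
  also have "?I (\<lambda>_. 1) (dird e g) x = ?I (\<lambda>r. 1 - of_real r) (dird e g) x + ?I of_real (dird e g) x"
    using affine_integral_add_left[of "\<lambda>r. 1 - of_real r" of_real "dird e g" ?L 0 x] hs
    by (simp add: continuous_intros)
  finally have 1: "dird w (primitive h e g) x = primitive h e ?k x
      + of_real (h w) * (of_real (h x) * ?I (\<lambda>r. 1 - of_real r) (dird e g) x + ?I (\<lambda>_. 1) g x)"
    by (simp add: primitive_def[abs_def] algebra_simps)
  have negx: "dird (?L x) g = (\<lambda>y. - of_real (h x) * dird e g y)"
    using dird_scale_vec[OF g, of "- h x" e] by (auto simp: scaleR_conv_of_real)
  \<comment> \<open>The weight \<open>1 - r\<close> vanishes at the end on the hyperplane, so the
    boundary term is the value at \<open>x\<close>.\<close>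
  have "?I (\<lambda>r. 1 - of_real r) (dird (?L x) g) x + ?I (\<lambda>_. - 1) g x = - g x"
    using affine_FTC[OF g has_vector_derivative_one_minus continuous_on_const, of "?L x" x]
    by (simp add: affine_integral_def)
  then have "of_real (h x) * ?I (\<lambda>r. 1 - of_real r) (dird e g) x + ?I (\<lambda>_. 1) g x = g x"
    unfolding negx using affine_integral_cmult_left[of "-1" "\<lambda>_. 1" ?L 0 g x]
    by (simp add: affine_integral_cmult[of _ _ _ "- of_real (h x)", simplified])
      (simp add: algebra_simps add_eq_0_iff)
  then show "dird w (primitive h e g) x
      = of_real (h w) * g x + primitive h e (dird (w - h w *\<^sub>R e) g) x"
    by (simp add: 1)
qed

end

section \<open>Wirtinger derivatives of periodic functions\<close>

text \<open>The common shape of \<open>wirtinger\<close>, \<open>wirtinger_bar\<close> and real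
  directional derivatives, so that commutation and compatibility with averages are proved once for
  all of them.\<close>

definition cdir :: "complex \<Rightarrow> 'a::euclidean_space \<Rightarrow> complex \<Rightarrow> 'a \<Rightarrow> ('a \<Rightarrow> complex) \<Rightarrow> 'a \<Rightarrow> complex" where
  "cdir a u b v f = (\<lambda>x. a * dird u f x + b * dird v f x)"

lemma wirtinger_cdir: "wirtinger k = cdir (1/2) (axis k 1) (- \<i>/2) (axis k \<i>)"
  by (auto simp: fun_eq_iff wirtinger_def cdir_def dird_def field_simps)

lemma wirtinger_bar_cdir: "wirtinger_bar k = cdir (1/2) (axis k 1) (\<i>/2) (axis k \<i>)"
  by (auto simp: fun_eq_iff wirtinger_bar_def cdir_def dird_def field_simps)

lemma smooth_cdir: "smooth f \<Longrightarrow> smooth (cdir a u b v f)"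
  unfolding cdir_def by (intro smooth_add smooth_cmult smooth_dird)

lemma cdir_add:
  "smooth f \<Longrightarrow> smooth g \<Longrightarrow> cdir a u b v (\<lambda>x. f x + g x) = (\<lambda>x. cdir a u b v f x + cdir a u b v g x)"
  by (simp add: cdir_def dird_add algebra_simps)

lemma cdir_diff:
  "smooth f \<Longrightarrow> smooth g \<Longrightarrow> cdir a u b v (\<lambda>x. f x - g x) = (\<lambda>x. cdir a u b v f x - cdir a u b v g x)"
  by (simp add: cdir_def dird_diff algebra_simps)

lemma cdir_cmult: "smooth f \<Longrightarrow> cdir a u b v (\<lambda>x. c * f x) = (\<lambda>x. c * cdir a u b v f x)"
  by (simp add: cdir_def dird_cmult algebra_simps)

lemma cdir_const: "cdir a u b v (\<lambda>x. c) = (\<lambda>x. 0)"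
  by (simp add: cdir_def)

lemma dird_cdir:
  assumes f: "smooth f"
  shows "dird w (cdir a u b v f) = cdir a u b v (dird w f)"
proof -
  have "dird w (cdir a u b v f) = (\<lambda>x. a * dird w (dird u f) x + b * dird w (dird v f) x)"
    using f by (simp add: cdir_def dird_add dird_cmult smooth_cmult smooth_dird)
  then show ?thesis by (simp add: cdir_def dird_commute[OF f, of w])
qed

lemma cdir_commute:
  assumes f: "smooth f"
  shows "cdir a u b v (cdir a' u' b' v' f) = cdir a' u' b' v' (cdir a u b v f)"
proof -
  have "cdir a u b v (cdir a' u' b' v' f)
      = (\<lambda>x. a * cdir a' u' b' v' (dird u f) x + b * cdir a' u' b' v' (dird v f) x)"
    unfolding cdir_def[of a u b v] dird_cdir[OF f] ..
  also have "\<dots> = cdir a' u' b' v' (\<lambda>x. a * dird u f x + b * dird v f x)"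
    using f by (simp only: cdir_add cdir_cmult smooth_cmult smooth_dird)
  finally show ?thesis unfolding cdir_def[of a u b v f] .
qed

lemma cdir_seg_integral:
  assumes c: "continuous_on {0..1} c" and f: "smooth f"
  shows "cdir a u b v (seg_integral c w f) = seg_integral c w (cdir a u b v f)"
proof
  fix x
  have "seg_integral c w (cdir a u b v f) x
      = a * seg_integral c w (dird u f) x + b * seg_integral c w (dird v f) x"
    using c f unfolding cdir_def
    by (simp only: affine_integral_add affine_integral_cmult smooth_cmult smooth_dird)
  then show "cdir a u b v (seg_integral c w f) x = seg_integral c w (cdir a u b v f) x"
    using c f by (simp only: cdir_def[of a u b v "seg_integral c w f"] dird_seg_integral)
qed

lemmas wirtinger_eqs = wirtinger_cdir wirtinger_bar_cdir

text \<open>The splitting of df into del f and delbar f, evaluated at \<open>w\<close>. It links the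
  real derivatives, which periods and \<open>h\<close> control, with the complex ones.\<close>

lemma dird_eq_wirtinger:
  assumes f: "smooth f"
  shows "dird w f x = (\<Sum>k\<in>UNIV. w $ k * wirtinger k f x + cnj (w $ k) * wirtinger_bar k f x)"
proof -
  have "w = (\<Sum>k\<in>UNIV. Re (w $ k) *\<^sub>R axis k 1 + Im (w $ k) *\<^sub>R axis k \<i>)"
    by (auto simp: vec_eq_iff axis_def if_distrib sum.If_cases complex_eq_iff
        cong: if_cong intro!: sum.cong)
  then have "dird w f x = dird (\<Sum>k\<in>UNIV. Re (w $ k) *\<^sub>R axis k 1 + Im (w $ k) *\<^sub>R axis k \<i>) f x"
    by simp
  also have "\<dots> = (\<Sum>k\<in>UNIV. dird (Re (w $ k) *\<^sub>R axis k 1 + Im (w $ k) *\<^sub>R axis k \<i>) f x)"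
    by (rule linear_sum[OF linear_dird[OF f]])
  also have "\<dots> = (\<Sum>k\<in>UNIV. w $ k * wirtinger k f x + cnj (w $ k) * wirtinger_bar k f x)"
  proof (rule sum.cong)
    fix k
    let ?a = "dird (axis k 1) f x" and ?b = "dird (axis k \<i>) f x"
    have "w $ k * wirtinger k f x + cnj (w $ k) * wirtinger_bar k f x
        = ((w $ k + cnj (w $ k)) * ?a - \<i> * (w $ k - cnj (w $ k)) * ?b) / 2"
      unfolding wirtinger_eqs cdir_def by (simp add: algebra_simps add_divide_distrib diff_divide_distrib)
    also have "\<dots> = Re (w $ k) * ?a + Im (w $ k) * ?b"
      by (simp add: complex_add_cnj complex_diff_cnj algebra_simps)
    finally show "dird (Re (w $ k) *\<^sub>R axis k 1 + Im (w $ k) *\<^sub>R axis k \<i>) f x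
        = w $ k * wirtinger k f x + cnj (w $ k) * wirtinger_bar k f x"
      using f by (simp only: dird_add_vec dird_scale_vec) (simp add: scaleR_conv_of_real)
  qed simp
  finally show ?thesis .
qed

lemma cdir_cnj:
  "smooth f \<Longrightarrow> cdir a u b v (\<lambda>x. cnj (f x)) = (\<lambda>x. cnj (cdir (cnj a) u (cnj b) v f x))"
  by (simp add: cdir_def dird_bounded_linear[OF bounded_linear_cnj])

lemma wirtinger_cnj: "smooth f \<Longrightarrow> wirtinger k (\<lambda>x. cnj (f x)) = (\<lambda>x. cnj (wirtinger_bar k f x))"
  by (simp add: wirtinger_eqs cdir_cnj)

lemma wirtinger_bar_cnj: "smooth f \<Longrightarrow> wirtinger_bar k (\<lambda>x. cnj (f x)) = (\<lambda>x. cnj (wirtinger k f x))"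
  by (simp add: wirtinger_eqs cdir_cnj)

section \<open>Periodic smooth functions\<close>

definition periodic_smooth :: "(complex ^ 'n::finite) set \<Rightarrow> (complex ^ 'n \<Rightarrow> complex) set" where
  "periodic_smooth \<Lambda> = {f. smooth f \<and> periodic_wrt \<Lambda> f}"

lemma periodic_smoothD: "f \<in> periodic_smooth \<Lambda> \<Longrightarrow> smooth f"
  by (simp add: periodic_smooth_def)

lemma periodic_smooth_shift: "f \<in> periodic_smooth \<Lambda> \<Longrightarrow> v \<in> \<Lambda> \<Longrightarrow> f (x + v) = f x"
  by (simp add: periodic_smooth_def periodic_wrt_def)

lemma periodic_smooth_add:
  "f \<in> periodic_smooth \<Lambda> \<Longrightarrow> g \<in> periodic_smooth \<Lambda> \<Longrightarrow> (\<lambda>x. f x + g x) \<in> periodic_smooth \<Lambda>"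
  by (simp add: periodic_smooth_def periodic_wrt_def smooth_add)

lemma periodic_smooth_diff:
  "f \<in> periodic_smooth \<Lambda> \<Longrightarrow> g \<in> periodic_smooth \<Lambda> \<Longrightarrow> (\<lambda>x. f x - g x) \<in> periodic_smooth \<Lambda>"
  by (simp add: periodic_smooth_def periodic_wrt_def smooth_diff)

lemma periodic_smooth_mult:
  "f \<in> periodic_smooth \<Lambda> \<Longrightarrow> g \<in> periodic_smooth \<Lambda> \<Longrightarrow> (\<lambda>x. f x * g x) \<in> periodic_smooth \<Lambda>"
  by (simp add: periodic_smooth_def periodic_wrt_def smooth_mult)

lemma periodic_smooth_cnj: "f \<in> periodic_smooth \<Lambda> \<Longrightarrow> (\<lambda>x. cnj (f x)) \<in> periodic_smooth \<Lambda>"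
  by (simp add: periodic_smooth_def periodic_wrt_def smooth_cnj)

lemma periodic_smooth_const: "(\<lambda>x. c) \<in> periodic_smooth \<Lambda>"
  by (simp add: periodic_smooth_def periodic_wrt_def)

lemma periodic_smooth_cmult: "f \<in> periodic_smooth \<Lambda> \<Longrightarrow> (\<lambda>x. c * f x) \<in> periodic_smooth \<Lambda>"
  by (intro periodic_smooth_mult periodic_smooth_const)

lemma periodic_smooth_dird: "f \<in> periodic_smooth \<Lambda> \<Longrightarrow> dird w f \<in> periodic_smooth \<Lambda>"
proof -
  assume f: "f \<in> periodic_smooth \<Lambda>"
  have "dird w f (z + l) = dird w f z" if "l \<in> \<Lambda>" for z l
  proof -
    have "(\<lambda>y. f (y + l)) = f" using periodic_smooth_shift[OF f that] by blast
    then show ?thesis using dird_shift[OF periodic_smoothD[OF f], of w l] by metis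
  qed
  then show ?thesis
    using periodic_smoothD[OF f] by (simp add: periodic_smooth_def periodic_wrt_def smooth_dird)
qed

lemma periodic_smooth_cdir: "f \<in> periodic_smooth \<Lambda> \<Longrightarrow> cdir a u b v f \<in> periodic_smooth \<Lambda>"
  unfolding cdir_def by (intro periodic_smooth_add periodic_smooth_cmult periodic_smooth_dird)

lemma periodic_smooth_wirtinger:
  "f \<in> periodic_smooth \<Lambda> \<Longrightarrow> wirtinger k f \<in> periodic_smooth \<Lambda>"
  "f \<in> periodic_smooth \<Lambda> \<Longrightarrow> wirtinger_bar k f \<in> periodic_smooth \<Lambda>"
  unfolding wirtinger_eqs by (simp_all add: periodic_smooth_cdir)

lemma periodic_smooth_seg_integral:
  "continuous_on {0..1} c \<Longrightarrow> f \<in> periodic_smooth \<Lambda> \<Longrightarrow> seg_integral c v f \<in> periodic_smooth \<Lambda>"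
proof -
  assume c: "continuous_on {0..1} c" and f: "f \<in> periodic_smooth \<Lambda>"
  have "f (z + l + w) = f (z + w)" if "l \<in> \<Lambda>" for z l w
    using periodic_smooth_shift[OF f that, of "z + w"] by (simp add: ac_simps)
  then show ?thesis
    using c f by (simp add: periodic_smooth_def smooth_seg_integral periodic_wrt_def affine_integral_def)
qed

section \<open>Closed and exact forms of type (0,1)\<close>

definition fun_scale :: "complex \<Rightarrow> ('a \<Rightarrow> complex) \<Rightarrow> 'a \<Rightarrow> complex" where
  "fun_scale c f = (\<lambda>x. c * f x)"

definition tuple_scale :: "complex \<Rightarrow> ('n \<Rightarrow> 'a \<Rightarrow> complex) \<Rightarrow> 'n \<Rightarrow> 'a \<Rightarrow> complex" where
  "tuple_scale c \<phi> = (\<lambda>k x. c * \<phi> k x)"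

interpretation fs: complex_vector_space "fun_scale :: complex \<Rightarrow> ('a \<Rightarrow> complex) \<Rightarrow> _"
  by standard (auto simp: fun_scale_def fun_eq_iff algebra_simps)

interpretation ps: complex_vector_space "tuple_scale :: complex \<Rightarrow> ('n \<Rightarrow> 'a \<Rightarrow> complex) \<Rightarrow> _"
  by standard (auto simp: tuple_scale_def fun_eq_iff algebra_simps)

text \<open>The tuple \<open>\<phi>\<close> stands for the (0,1)-form whose coefficient at the k-th
  conjugate differential is \<open>\<phi> k\<close>; working with tuples avoids signs and index
  sets.\<close>

definition dbar_closed :: "(complex ^ 'n::finite) set \<Rightarrow> ('n \<Rightarrow> complex ^ 'n \<Rightarrow> complex) set" where
  "dbar_closed \<Lambda> = {\<phi>. (\<forall>k. \<phi> k \<in> periodic_smooth \<Lambda>) \<and> (\<forall>j k. wirtinger_bar j (\<phi> k) = wirtinger_bar k (\<phi> j))}"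

definition dbar_exact :: "(complex ^ 'n::finite) set \<Rightarrow> ('n \<Rightarrow> complex ^ 'n \<Rightarrow> complex) set" where
  "dbar_exact \<Lambda> = {\<phi>. \<exists>f\<in>periodic_smooth \<Lambda>. \<phi> = (\<lambda>k. wirtinger_bar k f)}"

text \<open>In two variables, up to signs and renaming of the \<open>a k\<close>, these are the
  coefficients of delbar-exact (0,2)-forms. The symmetric sum spares the choice of an order of the
  indices.\<close>

definition dbar_range :: "(complex ^ 'n::finite) set \<Rightarrow> (complex ^ 'n \<Rightarrow> complex) set" where
  "dbar_range \<Lambda> = {g. \<exists>a. (\<forall>k. a k \<in> periodic_smooth \<Lambda>) \<and> g = (\<lambda>x. \<Sum>k\<in>UNIV. wirtinger_bar k (a k) x)}"

lemma dbar_closedD: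
  assumes "\<phi> \<in> dbar_closed \<Lambda>"
  shows "\<phi> k \<in> periodic_smooth \<Lambda>" "smooth (\<phi> k)" "wirtinger_bar j (\<phi> k) = wirtinger_bar k (\<phi> j)"
  using assms periodic_smoothD by (auto simp: dbar_closed_def)

lemma dbar_exactI:
  "f \<in> periodic_smooth \<Lambda> \<Longrightarrow> (\<And>k. \<phi> k = wirtinger_bar k f) \<Longrightarrow> \<phi> \<in> dbar_exact \<Lambda>"
  unfolding dbar_exact_def by blast

lemma dbar_exactE:
  assumes "\<phi> \<in> dbar_exact \<Lambda>"
  obtains f where "f \<in> periodic_smooth \<Lambda>" "\<And>k. \<phi> k = wirtinger_bar k f"
  using assms unfolding dbar_exact_def by blast

lemma dbar_exact_subset: "dbar_exact \<Lambda> \<subseteq> dbar_closed \<Lambda>"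
proof
  fix \<phi> assume "\<phi> \<in> dbar_exact \<Lambda>"
  then obtain f where f: "f \<in> periodic_smooth \<Lambda>" and eq: "\<And>k. \<phi> k = wirtinger_bar k f"
    by (rule dbar_exactE) blast
  have "wirtinger_bar j (wirtinger_bar k f) = wirtinger_bar k (wirtinger_bar j f)" for j k
    unfolding wirtinger_eqs by (rule cdir_commute[OF periodic_smoothD[OF f]])
  then show "\<phi> \<in> dbar_closed \<Lambda>"
    using f by (simp add: dbar_closed_def eq periodic_smooth_wirtinger)
qed

lemma wirtinger_bar_add:
  "smooth f \<Longrightarrow> smooth g \<Longrightarrow> wirtinger_bar k (\<lambda>x. f x + g x) = (\<lambda>x. wirtinger_bar k f x + wirtinger_bar k g x)"
  unfolding wirtinger_eqs by (rule cdir_add)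

lemma wirtinger_bar_diff:
  "smooth f \<Longrightarrow> smooth g \<Longrightarrow> wirtinger_bar k (\<lambda>x. f x - g x) = (\<lambda>x. wirtinger_bar k f x - wirtinger_bar k g x)"
  unfolding wirtinger_eqs by (rule cdir_diff)

lemma wirtinger_bar_cmult:
  "smooth f \<Longrightarrow> wirtinger_bar k (\<lambda>x. c * f x) = (\<lambda>x. c * wirtinger_bar k f x)"
  unfolding wirtinger_eqs by (rule cdir_cmult)

lemma wirtinger_bar_const: "wirtinger_bar k (\<lambda>x. c) = (\<lambda>x. 0)"
  unfolding wirtinger_eqs by (rule cdir_const)

lemma dird_wirtinger_bar:
  "smooth f \<Longrightarrow> dird w (wirtinger_bar k f) = wirtinger_bar k (dird w f)"
  unfolding wirtinger_eqs by (rule dird_cdir)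

lemma wirtinger_bar_seg_integral:
  "continuous_on {0..1} c \<Longrightarrow> smooth f \<Longrightarrow>
    wirtinger_bar k (seg_integral c v f) = seg_integral c v (wirtinger_bar k f)"
  unfolding wirtinger_eqs by (rule cdir_seg_integral)

lemma tuple_scale_apply [simp]: "tuple_scale c \<phi> k = (\<lambda>x. c * \<phi> k x)"
  by (simp add: tuple_scale_def)

lemma subspace_dbar_closed: "ps.subspace (dbar_closed \<Lambda>)"
proof (rule ps.subspaceI)
  show "0 \<in> dbar_closed \<Lambda>"
    by (simp add: dbar_closed_def zero_fun_def periodic_smooth_const wirtinger_bar_const)
next
  fix \<phi> \<psi> assume h: "\<phi> \<in> dbar_closed \<Lambda>" "\<psi> \<in> dbar_closed \<Lambda>"
  show "\<phi> + \<psi> \<in> dbar_closed \<Lambda>"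
    unfolding dbar_closed_def mem_Collect_eq plus_fun_def
    using dbar_closedD[OF h(1)] dbar_closedD[OF h(2)]
    by (intro conjI allI) (simp_all add: periodic_smooth_add wirtinger_bar_add)
next
  fix \<phi> c assume h: "\<phi> \<in> dbar_closed \<Lambda>"
  show "tuple_scale c \<phi> \<in> dbar_closed \<Lambda>"
    unfolding dbar_closed_def mem_Collect_eq tuple_scale_apply
    using dbar_closedD[OF h]
    by (intro conjI allI) (simp_all add: periodic_smooth_cmult wirtinger_bar_cmult)
qed

lemma subspace_dbar_exact: "ps.subspace (dbar_exact \<Lambda>)"
proof (rule ps.subspaceI)
  show "0 \<in> dbar_exact \<Lambda>"
    by (rule dbar_exactI[OF periodic_smooth_const[of 0]]) (simp add: zero_fun_def wirtinger_bar_const)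
next
  fix \<phi> \<psi> assume "\<phi> \<in> dbar_exact \<Lambda>" "\<psi> \<in> dbar_exact \<Lambda>"
  then obtain f g where fg: "f \<in> periodic_smooth \<Lambda>" "g \<in> periodic_smooth \<Lambda>"
    and eq: "\<And>k. \<phi> k = wirtinger_bar k f" "\<And>k. \<psi> k = wirtinger_bar k g"
    by (metis dbar_exactE)
  show "\<phi> + \<psi> \<in> dbar_exact \<Lambda>"
    using fg by (intro dbar_exactI[OF periodic_smooth_add[OF fg]])
      (simp add: plus_fun_def eq wirtinger_bar_add periodic_smoothD)
next
  fix \<phi> c assume "\<phi> \<in> dbar_exact \<Lambda>"
  then obtain f where f: "f \<in> periodic_smooth \<Lambda>" and eq: "\<And>k. \<phi> k = wirtinger_bar k f"
    by (metis dbar_exactE)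
  show "tuple_scale c \<phi> \<in> dbar_exact \<Lambda>"
    using f by (intro dbar_exactI[OF periodic_smooth_cmult[OF f, of c]])
      (simp add: eq wirtinger_bar_cmult periodic_smoothD)
qed

lemma subspace_periodic_smooth: "fs.subspace (periodic_smooth \<Lambda>)"
  by (rule fs.subspaceI)
    (simp_all add: zero_fun_def plus_fun_def fun_scale_def periodic_smooth_const
      periodic_smooth_add periodic_smooth_cmult)

lemma subspace_dbar_range: "fs.subspace (dbar_range \<Lambda>)"
proof (rule fs.subspaceI)
  show "0 \<in> dbar_range \<Lambda>"
    unfolding dbar_range_def
    by (intro CollectI exI[of _ "\<lambda>k x. 0"])
      (simp add: zero_fun_def periodic_smooth_const wirtinger_bar_const)
next
  fix f g assume "f \<in> dbar_range \<Lambda>" "g \<in> dbar_range \<Lambda>"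
  then obtain a b where a: "\<forall>k. a k \<in> periodic_smooth \<Lambda>" "f = (\<lambda>x. \<Sum>k\<in>UNIV. wirtinger_bar k (a k) x)"
    and b: "\<forall>k. b k \<in> periodic_smooth \<Lambda>" "g = (\<lambda>x. \<Sum>k\<in>UNIV. wirtinger_bar k (b k) x)"
    unfolding dbar_range_def by blast
  have "smooth (a k)" "smooth (b k)" for k using a b periodic_smoothD by blast+
  then show "f + g \<in> dbar_range \<Lambda>"
    unfolding dbar_range_def using a b
    by (intro CollectI exI[of _ "\<lambda>k x. a k x + b k x"])
      (simp add: plus_fun_def periodic_smooth_add wirtinger_bar_add periodic_smoothD sum.distrib)
next
  fix f c assume "f \<in> dbar_range \<Lambda>"
  then obtain a where a: "\<forall>k. a k \<in> periodic_smooth \<Lambda>" "f = (\<lambda>x. \<Sum>k\<in>UNIV. wirtinger_bar k (a k) x)"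
    unfolding dbar_range_def by blast
  have "smooth (a k)" for k using a periodic_smoothD by blast
  then show "fun_scale c f \<in> dbar_range \<Lambda>"
    unfolding dbar_range_def using a
    by (intro CollectI exI[of _ "\<lambda>k x. c * a k x"])
      (simp add: fun_scale_def periodic_smooth_cmult wirtinger_bar_cmult periodic_smoothD sum_distrib_left)
qed

text \<open>Cartan's formula: \<open>\<partial>/\<partial>cnj z\<^sub>k\<close> maps a closed form to \<open>dbar\<close> of its \<open>k\<close>-th coefficient.\<close>

lemma wirtinger_bar_closed_exact:
  assumes "\<phi> \<in> dbar_closed \<Lambda>"
  shows "(\<lambda>j. wirtinger_bar k (\<phi> j)) \<in> dbar_exact \<Lambda>"
  by (rule dbar_exactI[OF dbar_closedD(1)[OF assms]]) (rule dbar_closedD(3)[OF assms])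

lemma cdir_closed:
  assumes "\<phi> \<in> dbar_closed \<Lambda>"
  shows "(\<lambda>j. cdir a u b v (\<phi> j)) \<in> dbar_closed \<Lambda>"
proof -
  have "wirtinger_bar i (cdir a u b v (\<phi> j)) = wirtinger_bar j (cdir a u b v (\<phi> i))" for i j
  proof -
    have c: "wirtinger_bar i (cdir a u b v (\<phi> j)) = cdir a u b v (wirtinger_bar i (\<phi> j))" for i j
      unfolding wirtinger_eqs by (rule cdir_commute[OF dbar_closedD(2)[OF assms]])
    show ?thesis unfolding c dbar_closedD(3)[OF assms, of i j] ..
  qed
  then show ?thesis
    using dbar_closedD(1)[OF assms] by (simp add: dbar_closed_def periodic_smooth_cdir)
qed

lemma cdir_exact:
  assumes "\<phi> \<in> dbar_exact \<Lambda>"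
  shows "(\<lambda>j. cdir a u b v (\<phi> j)) \<in> dbar_exact \<Lambda>"
proof -
  obtain f where f: "f \<in> periodic_smooth \<Lambda>" and eq: "\<And>k. \<phi> k = wirtinger_bar k f"
    using assms by (rule dbar_exactE) blast
  show ?thesis
    by (rule dbar_exactI[OF periodic_smooth_cdir[OF f]])
      (simp add: eq wirtinger_bar_cdir cdir_commute[OF periodic_smoothD[OF f], symmetric])
qed

lemma linear_endo_cdir: "ps.linear_endo (dbar_closed \<Lambda>) (\<lambda>\<phi> j. cdir a u b v (\<phi> j))"
  unfolding ps.linear_endo_def
proof (intro conjI ballI allI)
  show "(\<lambda>\<phi> j. cdir a u b v (\<phi> j)) ` dbar_closed \<Lambda> \<subseteq> dbar_closed \<Lambda>"
    using cdir_closed by blast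
  show "(\<lambda>j. cdir a u b v ((\<phi> + \<psi>) j)) = (\<lambda>j. cdir a u b v (\<phi> j)) + (\<lambda>j. cdir a u b v (\<psi> j))"
    if "\<phi> \<in> dbar_closed \<Lambda>" "\<psi> \<in> dbar_closed \<Lambda>" for \<phi> \<psi>
    using that by (simp add: plus_fun_def cdir_add dbar_closedD)
  show "(\<lambda>j. cdir a u b v (tuple_scale c \<phi> j)) = tuple_scale c (\<lambda>j. cdir a u b v (\<phi> j))"
    if "\<phi> \<in> dbar_closed \<Lambda>" for \<phi> c
    using that by (simp add: tuple_scale_def cdir_cmult dbar_closedD)
qed

section \<open>Homotopies along lattice vectors\<close>

lemma dird_eq_cdir: "dird v f = cdir 1 v 0 0 f"
  by (simp add: cdir_def)

text \<open>The exponential is the integrating factor that turns the derivative along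
  \<open>v\<close> minus \<open>\<mu>\<close> into a total derivative along the segment.\<close>

lemma integral_exp_FTC:
  assumes "smooth f"
  shows "seg_integral (\<lambda>r. exp (- \<mu> * of_real r)) v (dird v f) x
    - \<mu> * seg_integral (\<lambda>r. exp (- \<mu> * of_real r)) v f x = exp (- \<mu>) * f (x + v) - f x"
proof -
  have d: "((\<lambda>r. exp (- \<mu> * of_real r)) has_vector_derivative - \<mu> * exp (- \<mu> * of_real r)) (at r within {0..1})" for r
  proof -
    have "((\<lambda>z. exp (- \<mu> * z)) has_field_derivative - \<mu> * exp (- \<mu> * of_real r)) (at (of_real r))"
      by (auto intro!: derivative_eq_intros)
    then show ?thesis by (rule has_vector_derivative_real_field)
  qed
  have "continuous_on {0..1} (\<lambda>r. - \<mu> * exp (- \<mu> * of_real r))"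
    by (intro continuous_intros)
  from seg_integral_FTC[OF assms d this, of v x] show ?thesis
    by (simp add: affine_integral_cmult_left[of "- \<mu>", simplified])
qed

text \<open>Integrating the potential \<open>f\<close> of the eigenvalue equation with the
  integrating factor leaves only boundary terms, which by periodicity are multiples of
  \<open>\<phi>\<close>. A non-exact eigenform therefore forces
  \<open>exp (- \<mu>) = 1\<close>.\<close>

lemma eigenform_exact:
  assumes \<phi>: "\<phi> \<in> dbar_closed \<Lambda>" and v: "v \<in> \<Lambda>"
    and ev: "(\<lambda>j. dird v (\<phi> j)) - tuple_scale \<mu> \<phi> \<in> dbar_exact \<Lambda>"
  shows "tuple_scale (exp (- \<mu>) - 1) \<phi> \<in> dbar_exact \<Lambda>"
proof -
  obtain f where f: "f \<in> periodic_smooth \<Lambda>"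
    and eq: "\<And>k. ((\<lambda>j. dird v (\<phi> j)) - tuple_scale \<mu> \<phi>) k = wirtinger_bar k f"
    using ev by (rule dbar_exactE) blast
  let ?c = "\<lambda>r. exp (- \<mu> * complex_of_real r)"
  have c: "continuous_on {0..1} ?c" by (intro continuous_intros)
  show ?thesis
  proof (rule dbar_exactI[OF periodic_smooth_seg_integral[OF c f, of v]])
    fix k
    note s = dbar_closedD(2)[OF \<phi>, of k]
    have wb: "wirtinger_bar k f = (\<lambda>x. dird v (\<phi> k) x - \<mu> * \<phi> k x)"
      unfolding eq[symmetric] by (simp add: fun_diff_def)
    have "wirtinger_bar k (seg_integral ?c v f) = seg_integral ?c v (wirtinger_bar k f)"
      by (rule wirtinger_bar_seg_integral[OF c periodic_smoothD[OF f]])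
    also have "\<dots> = (\<lambda>x. exp (- \<mu>) * \<phi> k (x + v) - \<phi> k x)"
    proof
      fix x
      show "seg_integral ?c v (wirtinger_bar k f) x = exp (- \<mu>) * \<phi> k (x + v) - \<phi> k x"
        unfolding wb integral_exp_FTC[OF s, symmetric]
          affine_integral_diff[OF c smooth_dird[OF s] smooth_cmult[OF s]] affine_integral_cmult ..
    qed
    also have "\<dots> = tuple_scale (exp (- \<mu>) - 1) \<phi> k"
      using periodic_smooth_shift[OF dbar_closedD(1)[OF \<phi>] v] by (simp add: left_diff_distrib)
    finally show "tuple_scale (exp (- \<mu>) - 1) \<phi> k = wirtinger_bar k (seg_integral ?c v f)" ..
  qed
qed

text \<open>If \<open>f\<close> is a potential of the derivative along \<open>v\<close>, its
  integral with weight \<open>1 - r\<close> is a potential of the average minus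
  \<open>\<phi>\<close>: a homotopy between averaging along \<open>v\<close> and the
  identity.\<close>

lemma average_modulo_exact:
  assumes \<phi>: "\<phi> \<in> dbar_closed \<Lambda>" and ex: "(\<lambda>j. dird v (\<phi> j)) \<in> dbar_exact \<Lambda>"
  shows "(\<lambda>j. seg_integral (\<lambda>_. 1) v (\<phi> j)) - \<phi> \<in> dbar_exact \<Lambda>"
proof -
  obtain f where f: "f \<in> periodic_smooth \<Lambda>" and eq: "\<And>k. dird v (\<phi> k) = wirtinger_bar k f"
    using ex by (rule dbar_exactE) blast
  let ?c = "\<lambda>r. 1 - complex_of_real r"
  have c: "continuous_on {0..1} ?c" by (intro continuous_intros)
  show ?thesis
  proof (rule dbar_exactI[OF periodic_smooth_seg_integral[OF c f, of v]])
    fix k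
    note s = dbar_closedD(2)[OF \<phi>, of k]
    have "wirtinger_bar k (seg_integral ?c v f) = seg_integral ?c v (dird v (\<phi> k))"
      unfolding eq by (rule wirtinger_bar_seg_integral[OF c periodic_smoothD[OF f]])
    also have "\<dots> = (\<lambda>x. seg_integral (\<lambda>_. 1) v (\<phi> k) x - \<phi> k x)"
    proof
      fix x
      have "seg_integral ?c v (dird v (\<phi> k)) x + - 1 * seg_integral (\<lambda>_. 1) v (\<phi> k) x = - \<phi> k x"
        using seg_integral_FTC[OF s has_vector_derivative_one_minus continuous_on_const, of v x]
        unfolding affine_integral_cmult_left[symmetric] by simp
      then show "seg_integral ?c v (dird v (\<phi> k)) x = seg_integral (\<lambda>_. 1) v (\<phi> k) x - \<phi> k x"
        by (simp add: algebra_simps add_eq_0_iff2)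
    qed
    finally show "((\<lambda>j. seg_integral (\<lambda>_. 1) v (\<phi> j)) - \<phi>) k = wirtinger_bar k (seg_integral ?c v f)"
      by (simp add: fun_diff_def)
  qed
qed

lemma average_dird:
  assumes "smooth f" and "\<And>x. f (x + v) = f x"
  shows "seg_integral (\<lambda>_. 1) v (dird v f) x = 0"
  using seg_integral_FTC[OF assms(1), of "\<lambda>_. 1" "\<lambda>_. 0" v x] assms(2)
  by (simp add: affine_integral_def)

text \<open>A derivative along a period has mean zero, and it is cohomologous to its mean once its
  own derivative is exact. Hence the eigenvalue 0 of a lattice derivative on cohomology has no
  nilpotent part.\<close>

lemma dird_dird_exact:
  assumes \<phi>: "\<phi> \<in> dbar_closed \<Lambda>" and v: "v \<in> \<Lambda>"
    and ex: "(\<lambda>j. dird v (dird v (\<phi> j))) \<in> dbar_exact \<Lambda>"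
  shows "(\<lambda>j. dird v (\<phi> j)) \<in> dbar_exact \<Lambda>"
proof -
  have cl: "(\<lambda>j. dird v (\<phi> j)) \<in> dbar_closed \<Lambda>"
    unfolding dird_eq_cdir by (rule cdir_closed[OF \<phi>])
  have "seg_integral (\<lambda>_. 1) v (dird v (\<phi> j)) = (\<lambda>x. 0)" for j
    using average_dird[OF dbar_closedD(2)[OF \<phi>] periodic_smooth_shift[OF dbar_closedD(1)[OF \<phi>] v]]
    by blast
  then have "(\<lambda>j. seg_integral (\<lambda>_. 1) v (dird v (\<phi> j))) - (\<lambda>j. dird v (\<phi> j))
      = - (\<lambda>j. dird v (\<phi> j))"
    by (simp add: fun_eq_iff)
  with average_modulo_exact[OF cl ex] have "- (\<lambda>j. dird v (\<phi> j)) \<in> dbar_exact \<Lambda>"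
    by simp
  from ps.subspace_neg[OF subspace_dbar_exact this] show ?thesis by simp
qed

section \<open>The real coordinate transverse to the lattice\<close>

lemma entire_exp_linear:
  fixes m :: "'n::finite \<Rightarrow> complex"
  shows "entire (\<lambda>z. exp (\<Sum>k\<in>UNIV. z $ k * m k))"
  unfolding entire_def
proof
  fix z :: "complex ^ 'n"
  let ?L = "\<lambda>v :: complex ^ 'n. \<Sum>k\<in>UNIV. v $ k * m k"
  have "bounded_linear ?L"
    by (intro bounded_linear_sum bounded_linear_compose[OF bounded_linear_mult_left] bounded_linear_vec_nth)
  then have "((\<lambda>z. exp (?L z)) has_derivative (\<lambda>v. exp (?L z) * ?L v)) (at z)"
    by (rule has_derivative_compose[OF bounded_linear_imp_has_derivative DERIV_exp[unfolded has_field_derivative_def]])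
  then show "\<exists>D. ((\<lambda>z. exp (?L z)) has_derivative D) (at z) \<and> (\<forall>c v. D (c *s v) = c * D v)"
    by (intro exI[of _ "\<lambda>v. exp (?L z) * ?L v"]) (simp add: sum_distrib_left mult.assoc mult.left_commute)
qed

text \<open>\<open>h_lattice\<close> and \<open>kernel_h\<close> together say that the real span of
  \<open>\<Lambda>\<close> is exactly the hyperplane \<open>h = 0\<close>; \<open>e\<close> is a
  transverse vector, normalised by \<open>h\<close>.\<close>

locale toroidal_coordinate =
  fixes \<Lambda> :: "(complex ^ 'n::finite) set" and h :: "complex ^ 'n \<Rightarrow> real" and e :: "complex ^ 'n"
  assumes bounded_linear_h: "bounded_linear h" and h_e: "h e = 1"
    and h_lattice: "v \<in> \<Lambda> \<Longrightarrow> h v = 0"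
    and kernel_h: "h w = 0 \<Longrightarrow> w \<in> span \<Lambda>"
    and entire_constant: "entire f \<Longrightarrow> periodic_wrt \<Lambda> f \<Longrightarrow> f constant_on UNIV"
begin

text \<open>The coefficients of del h; their conjugates are those of delbar h. Every relation
  between constant forms is expressed through them.\<close>

definition \<theta> :: "'n \<Rightarrow> complex" where
  "\<theta> k = (h (axis k 1) - \<i> * h (axis k \<i>)) / 2"

lemma coordinate_periodic_smooth: "(\<lambda>x. complex_of_real (h x)) \<in> periodic_smooth \<Lambda>"
  using smooth_linear[OF bounded_linear_coord[OF bounded_linear_h h_e]] h_lattice
  by (simp add: periodic_smooth_def periodic_wrt_def linear_add[OF bounded_linear.linear[OF bounded_linear_h]])

lemma periodic_smooth_primitive:
  assumes f: "f \<in> periodic_smooth \<Lambda>"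
  shows "primitive h e f \<in> periodic_smooth \<Lambda>"
proof -
  have "primitive h e f (z + l) = primitive h e f z" if l: "l \<in> \<Lambda>" for z l
  proof -
    have hz: "h (z + l) = h z"
      using h_lattice[OF l] by (simp add: linear_add[OF bounded_linear.linear[OF bounded_linear_h]])
    have "f (z + l + w) = f (z + w)" for w
      using periodic_smooth_shift[OF f l, of "z + w"] by (simp add: ac_simps)
    then show ?thesis unfolding primitive_def affine_integral_def hz by presburger
  qed
  then show ?thesis
    using smooth_primitive[OF bounded_linear_h h_e periodic_smoothD[OF f]]
    by (simp add: periodic_smooth_def periodic_wrt_def)
qed

lemma dird_e_primitive:
  assumes "smooth f"
  shows "dird e (primitive h e f) = f"
  using dird_primitive[OF bounded_linear_h h_e assms, of e] assms
  by (simp add: h_e dird_zero primitive_def affine_integral_def)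

text \<open>The exponential of \<open>\<mu>\<close> times \<open>h\<close> is a periodic integrating
  factor, because \<open>h\<close> vanishes on \<open>\<Lambda>\<close>; it reduces the equation to
  \<open>\<mu> = 0\<close>, which \<open>primitive\<close> solves.\<close>

lemma dird_e_surjective:
  assumes f: "f \<in> periodic_smooth \<Lambda>"
  shows "\<exists>g\<in>periodic_smooth \<Lambda>. dird e g - fun_scale \<mu> g = f"
proof -
  define E where "E m x = exp (m * of_real (h x))" for m :: complex and x
  have bl: "bounded_linear (\<lambda>x. m * complex_of_real (h x))" for m
    by (rule bounded_linear_compose[OF bounded_linear_mult_right bounded_linear_coord[OF bounded_linear_h h_e]])
  have E: "E m \<in> periodic_smooth \<Lambda>" for m
    using smooth_exp_linear[OF bl] h_lattice unfolding E_def
    by (simp add: periodic_smooth_def periodic_wrt_def linear_add[OF bounded_linear.linear[OF bounded_linear_h]])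
  have dE: "dird e (E m) = (\<lambda>x. m * E m x)" for m
    unfolding E_def using dird_exp_linear[OF bl, of e] by (simp add: h_e)
  have inv: "E \<mu> x * E (- \<mu>) x = 1" for x
    by (simp add: E_def flip: exp_add)
  define u where "u = primitive h e (\<lambda>x. E (- \<mu>) x * f x)"
  have Ef: "(\<lambda>x. E (- \<mu>) x * f x) \<in> periodic_smooth \<Lambda>"
    by (rule periodic_smooth_mult[OF E f])
  have u: "u \<in> periodic_smooth \<Lambda>" unfolding u_def by (rule periodic_smooth_primitive[OF Ef])
  have du: "dird e u = (\<lambda>x. E (- \<mu>) x * f x)"
    unfolding u_def by (rule dird_e_primitive[OF periodic_smoothD[OF Ef]])
  let ?g = "\<lambda>x. E \<mu> x * u x"
  have "dird e ?g = (\<lambda>x. E \<mu> x * (E (- \<mu>) x * f x) + \<mu> * E \<mu> x * u x)"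
    unfolding dird_mult[OF periodic_smoothD[OF E] periodic_smoothD[OF u]] du dE ..
  also have "\<dots> = (\<lambda>x. f x + \<mu> * E \<mu> x * u x)"
    by (simp add: inv flip: mult.assoc)
  finally have "dird e ?g - fun_scale \<mu> ?g = f"
    by (simp add: fun_eq_iff fun_scale_def)
  with periodic_smooth_mult[OF E u] show ?thesis by blast
qed

lemma linear_endo_dird: "fs.linear_endo (periodic_smooth \<Lambda>) (dird w)"
  unfolding fs.linear_endo_def
  by (auto simp: periodic_smooth_dird plus_fun_def fun_scale_def dird_add dird_cmult periodic_smoothD)

text \<open>This is the vanishing of H^{0,2}. The operator \<open>dird e\<close> commutes with each
  \<open>wirtinger_bar k\<close> and so preserves \<open>dbar_range\<close>; surjectivity of all its
  shifts excludes a nonzero finite-dimensional quotient.\<close>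

lemma periodic_smooth_subset_dbar_range:
  assumes fin: "fs.finite_codim (periodic_smooth \<Lambda>) (dbar_range \<Lambda>)"
  shows "periodic_smooth \<Lambda> \<subseteq> dbar_range \<Lambda>"
proof (rule fs.finite_codim_surj_imp_subset[OF subspace_periodic_smooth linear_endo_dird
    subspace_dbar_range _ _ fin dird_e_surjective])
  show "dird e ` dbar_range \<Lambda> \<subseteq> dbar_range \<Lambda>"
  proof (rule image_subsetI)
    fix g assume "g \<in> dbar_range \<Lambda>"
    then obtain a where a: "\<forall>k. a k \<in> periodic_smooth \<Lambda>" "g = (\<lambda>x. \<Sum>k\<in>UNIV. wirtinger_bar k (a k) x)"
      unfolding dbar_range_def by blast
    have s: "smooth (a k)" for k using a periodic_smoothD by blast
    have "smooth (wirtinger_bar k (a k))" for k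
      unfolding wirtinger_eqs by (rule smooth_cdir[OF s])
    then have "dird e g = (\<lambda>x. \<Sum>k\<in>UNIV. dird e (wirtinger_bar k (a k)) x)"
      unfolding a(2) by (intro dird_eqI has_derivative_sum smooth_has_derivative)
    moreover have "dird e (a k) \<in> periodic_smooth \<Lambda>" for k
      using a by (simp add: periodic_smooth_dird)
    ultimately show "dird e g \<in> dbar_range \<Lambda>"
      unfolding dbar_range_def using s
      by (intro CollectI exI[of _ "\<lambda>k. dird e (a k)"]) (simp add: dird_wirtinger_bar)
  qed
  show "dbar_range \<Lambda> \<subseteq> periodic_smooth \<Lambda>"
  proof
    fix g assume "g \<in> dbar_range \<Lambda>"
    then obtain a where a: "\<forall>k. a k \<in> periodic_smooth \<Lambda>" "g = (\<lambda>x. \<Sum>k\<in>UNIV. wirtinger_bar k (a k) x)"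
      unfolding dbar_range_def by blast
    have "(\<lambda>x. \<Sum>k\<in>K. wirtinger_bar k (a k) x) \<in> periodic_smooth \<Lambda>" if "finite K" for K
      using that
    proof (induction K rule: finite_induct)
      case (insert k K)
      moreover have "wirtinger_bar k (a k) \<in> periodic_smooth \<Lambda>"
        using a by (simp add: periodic_smooth_wirtinger)
      ultimately show ?case by (simp add: periodic_smooth_add)
    qed (simp add: periodic_smooth_const)
    then show "g \<in> periodic_smooth \<Lambda>" unfolding a(2) by simp
  qed
qed

text \<open>By Cartan's formula each \<open>wirtinger_bar k\<close> is zero on cohomology, so only
  the \<open>wirtinger k\<close> survive in the expansion of \<open>dird w\<close>. This makes the
  eigenvalue complex-linear in \<open>w\<close>.\<close>

lemma dird_combination:
  assumes \<psi>: "\<psi> \<in> dbar_closed \<Lambda>"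
    and m: "\<And>k. (\<lambda>j. wirtinger k (\<psi> j)) - tuple_scale (m k) \<psi> \<in> dbar_exact \<Lambda>"
  shows "(\<lambda>j. dird w (\<psi> j)) - tuple_scale (\<Sum>k\<in>UNIV. w $ k * m k) \<psi> \<in> dbar_exact \<Lambda>"
proof -
  have "(\<Sum>k\<in>UNIV. tuple_scale (w $ k) ((\<lambda>j. wirtinger k (\<psi> j)) - tuple_scale (m k) \<psi>)
      + tuple_scale (cnj (w $ k)) (\<lambda>j. wirtinger_bar k (\<psi> j))) \<in> dbar_exact \<Lambda>"
    by (intro ps.subspace_sum[OF subspace_dbar_exact] ps.subspace_add[OF subspace_dbar_exact]
        ps.subspace_scale[OF subspace_dbar_exact] m wirtinger_bar_closed_exact[OF \<psi>])
  also have "(\<Sum>k\<in>UNIV. tuple_scale (w $ k) ((\<lambda>j. wirtinger k (\<psi> j)) - tuple_scale (m k) \<psi>)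
      + tuple_scale (cnj (w $ k)) (\<lambda>j. wirtinger_bar k (\<psi> j)))
      = (\<lambda>j. dird w (\<psi> j)) - tuple_scale (\<Sum>k\<in>UNIV. w $ k * m k) \<psi>"
  proof (intro ext)
    fix j :: 'n and x
    have app: "(\<Sum>k\<in>K. F k) j x = (\<Sum>k\<in>K. F k j x)" for K and F :: "'n \<Rightarrow> 'n \<Rightarrow> complex ^ 'n \<Rightarrow> complex"
      by (induction K rule: infinite_finite_induct) auto
    show "(\<Sum>k\<in>UNIV. tuple_scale (w $ k) ((\<lambda>j. wirtinger k (\<psi> j)) - tuple_scale (m k) \<psi>)
      + tuple_scale (cnj (w $ k)) (\<lambda>j. wirtinger_bar k (\<psi> j))) j x
      = ((\<lambda>j. dird w (\<psi> j)) - tuple_scale (\<Sum>k\<in>UNIV. w $ k * m k) \<psi>) j x"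
      unfolding app fun_diff_def plus_fun_def tuple_scale_def
        dird_eq_wirtinger[OF dbar_closedD(2)[OF \<psi>]] sum_distrib_right sum_subtractf[symmetric]
      by (intro sum.cong) (simp_all add: algebra_simps)
  qed
  finally show ?thesis .
qed

text \<open>
  An eigenvector of the derivative along a lattice vector on the finite-dimensional \<open>H\<^bsup>0,1\<^esup>\<close>,
  with eigenvalue \<open>\<mu> \<noteq> 0\<close>, can be chosen as a common eigenvector of all \<open>\<partial>/\<partial>z\<^sub>k\<close>, with
  eigenvalues \<open>m k\<close>. As lattice translations are trivial on \<open>H\<^bsup>0,1\<^esup>\<close>, the entire function
  \<open>exp (\<Sum>k. z\<^sub>k m k)\<close> is then periodic and not constant.
\<close>

lemma dird_lattice_exact:
  assumes fin: "ps.finite_codim (dbar_closed \<Lambda>) (dbar_exact \<Lambda>)"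
    and v: "v \<in> \<Lambda>" and \<phi>: "\<phi> \<in> dbar_closed \<Lambda>"
  shows "(\<lambda>j. dird v (\<phi> j)) \<in> dbar_exact \<Lambda>"
proof (rule ccontr)
  let ?U = "dbar_closed \<Lambda>" and ?W = "dbar_exact \<Lambda>"
  define D where "D = (\<lambda>(\<phi> :: 'n \<Rightarrow> complex ^ 'n \<Rightarrow> complex) j. dird v (\<phi> j))"
  define P where "P k = (\<lambda>(\<phi> :: 'n \<Rightarrow> complex ^ 'n \<Rightarrow> complex) j. wirtinger k (\<phi> j))" for k
  note U = subspace_dbar_closed[of \<Lambda>] and W = subspace_dbar_exact[of \<Lambda>]
  have D: "ps.linear_endo ?U D" unfolding D_def dird_eq_cdir by (rule linear_endo_cdir)
  have P: "ps.linear_endo ?U (P k)" for k unfolding P_def wirtinger_cdir by (rule linear_endo_cdir)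
  have Dadd: "D (\<phi> + \<psi>) = D \<phi> + D \<psi>" if "\<phi> \<in> ?U" "\<psi> \<in> ?U" for \<phi> \<psi>
    using D that unfolding ps.linear_endo_def by blast
  have Dscale: "D (tuple_scale c \<phi>) = tuple_scale c (D \<phi>)" if "\<phi> \<in> ?U" for \<phi> c
    using D that unfolding ps.linear_endo_def by blast
  have Padd: "P k (\<phi> + \<psi>) = P k \<phi> + P k \<psi>" if "\<phi> \<in> ?U" "\<psi> \<in> ?U" for \<phi> \<psi> k
    using P that unfolding ps.linear_endo_def by blast
  have Pscale: "P k (tuple_scale c \<phi>) = tuple_scale c (P k \<phi>)" if "\<phi> \<in> ?U" for \<phi> c k
    using P that unfolding ps.linear_endo_def by blast
  have DU: "D \<phi> \<in> ?U" if "\<phi> \<in> ?U" for \<phi>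
    unfolding P_def D_def dird_eq_cdir by (rule cdir_closed[OF that])
  have PU: "P k \<phi> \<in> ?U" if "\<phi> \<in> ?U" for \<phi> k
    unfolding P_def D_def wirtinger_cdir by (rule cdir_closed[OF that])
  have PW: "P k \<phi> \<in> ?W" if "\<phi> \<in> ?W" for \<phi> k
    unfolding P_def D_def wirtinger_cdir by (rule cdir_exact[OF that])
  have PD: "P k (D \<phi>) = D (P k \<phi>)" if "\<phi> \<in> ?U" for \<phi> k
    unfolding P_def D_def wirtinger_cdir dird_eq_cdir
    by (rule ext) (rule cdir_commute[OF dbar_closedD(2)[OF that]])
  have PP: "P k (P i \<phi>) = P i (P k \<phi>)" if "\<phi> \<in> ?U" for \<phi> k i
    unfolding P_def D_def wirtinger_cdir
    by (rule ext) (rule cdir_commute[OF dbar_closedD(2)[OF that]])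
  have zeroW: "0 \<in> ?W" by (rule ps.subspace_0[OF W])

  assume "(\<lambda>j. dird v (\<phi> j)) \<notin> dbar_exact \<Lambda>"
  then have nex: "D \<phi> \<notin> ?W" by (simp add: D_def)
  \<comment> \<open>The eigenvector is sought in the image of \<open>D\<close>, where the eigenvalue
    0 is impossible by \<open>dird_dird_exact\<close>.\<close>
  let ?S0 = "D ` ?U"
  have S0: "ps.subspace ?S0"
  proof (rule ps.subspaceI)
    have "0 = D 0" by (simp add: D_def zero_fun_def)
    then show "0 \<in> ?S0" using ps.subspace_0[OF U] by (rule image_eqI)
    show "a + b \<in> ?S0" if "a \<in> ?S0" "b \<in> ?S0" for a b
    proof -
      obtain x y where xy: "x \<in> ?U" "y \<in> ?U" "a = D x" "b = D y" using \<open>a \<in> ?S0\<close> \<open>b \<in> ?S0\<close> by blast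
      show ?thesis unfolding xy(3,4) Dadd[OF xy(1,2), symmetric]
        by (rule imageI[OF ps.subspace_add[OF U xy(1,2)]])
    qed
    show "tuple_scale c a \<in> ?S0" if "a \<in> ?S0" for c a
    proof -
      obtain x where x: "x \<in> ?U" "a = D x" using \<open>a \<in> ?S0\<close> by blast
      show ?thesis unfolding x(2) Dscale[OF x(1), symmetric]
        by (rule imageI[OF ps.subspace_scale[OF U x(1)]])
    qed
  qed
  have S0': "?S0 \<subseteq> ?U" "D ` ?S0 \<subseteq> ?S0" using DU by blast+
  have "\<not> ?S0 \<subseteq> ?W" using nex \<phi> by blast
  from ps.eigenvector_modulo[OF U D W fin S0' S0 this]
  obtain \<psi>1 \<mu> where \<psi>1: "\<psi>1 \<in> ?S0" "\<psi>1 \<notin> ?W" "D \<psi>1 - tuple_scale \<mu> \<psi>1 \<in> ?W" .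
  have "\<mu> \<noteq> 0"
  proof
    assume "\<mu> = 0"
    obtain \<phi>1 where "\<phi>1 \<in> ?U" "\<psi>1 = D \<phi>1" using \<psi>1(1) by blast
    moreover have "D \<psi>1 \<in> ?W" using \<psi>1(3) \<open>\<mu> = 0\<close> by simp
    ultimately show False using dird_dird_exact[OF _ v] \<psi>1(2) unfolding D_def by blast
  qed

  \<comment> \<open>Coordinates are added one at a time: the operators commute and preserve
    exactness, so the common eigenspace \<open>S\<close> reached so far is invariant under the next
    \<open>P i\<close>.\<close>
  have "\<exists>\<psi>\<in>?U. \<exists>m. \<psi> \<notin> ?W \<and> D \<psi> - tuple_scale \<mu> \<psi> \<in> ?W \<and> (\<forall>k\<in>K. P k \<psi> - tuple_scale (m k) \<psi> \<in> ?W)"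
    if "finite K" for K
    using that
  proof (induction K rule: finite_induct)
    case empty
    then show ?case using \<psi>1 DU by blast
  next
    case (insert i K)
    then obtain \<psi> m where \<psi>: "\<psi> \<in> ?U" "\<psi> \<notin> ?W" "D \<psi> - tuple_scale \<mu> \<psi> \<in> ?W"
      "\<forall>k\<in>K. P k \<psi> - tuple_scale (m k) \<psi> \<in> ?W" by blast
    define S where "S = {\<psi>\<in>?U. D \<psi> - tuple_scale \<mu> \<psi> \<in> ?W \<and> (\<forall>k\<in>K. P k \<psi> - tuple_scale (m k) \<psi> \<in> ?W)}"
    have S: "ps.subspace S"
    proof (rule ps.subspaceI)
      have "D 0 = 0" by (simp add: D_def zero_fun_def)
      moreover have "P k 0 = 0" for k by (simp add: P_def zero_fun_def wirtinger_cdir cdir_const)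
      ultimately show "0 \<in> S" unfolding S_def using ps.subspace_0[OF U] zeroW by simp
      fix a assume a: "a \<in> S"
      show "tuple_scale c a \<in> S" for c
      proof -
        have aU: "a \<in> ?U" using a by (simp add: S_def)
        have "D (tuple_scale c a) - tuple_scale \<mu> (tuple_scale c a) = tuple_scale c (D a - tuple_scale \<mu> a)"
          unfolding Dscale[OF aU] by (simp add: fun_eq_iff tuple_scale_def algebra_simps)
        moreover have "P k (tuple_scale c a) - tuple_scale (m k) (tuple_scale c a) = tuple_scale c (P k a - tuple_scale (m k) a)" for k
          unfolding Pscale[OF aU] by (simp add: fun_eq_iff tuple_scale_def algebra_simps)
        ultimately show ?thesis
          using a ps.subspace_scale[OF U] ps.subspace_scale[OF W] unfolding S_def by simp
      qed
      fix b assume b: "b \<in> S"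
      show "a + b \<in> S"
      proof -
        have aU: "a \<in> ?U" "b \<in> ?U" using a b by (simp_all add: S_def)
        have "D (a + b) - tuple_scale \<mu> (a + b) = (D a - tuple_scale \<mu> a) + (D b - tuple_scale \<mu> b)"
          unfolding Dadd[OF aU] by (simp add: fun_eq_iff tuple_scale_def algebra_simps)
        moreover have "P k (a + b) - tuple_scale (m k) (a + b) = (P k a - tuple_scale (m k) a) + (P k b - tuple_scale (m k) b)" for k
          unfolding Padd[OF aU] by (simp add: fun_eq_iff tuple_scale_def algebra_simps)
        ultimately show ?thesis
          using a b ps.subspace_add[OF U] ps.subspace_add[OF W] unfolding S_def by simp
      qed
    qed
    have SU: "S \<subseteq> ?U" by (auto simp: S_def)
    have PS: "P i ` S \<subseteq> S"
    proof (rule image_subsetI)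
      fix a assume a: "a \<in> S"
      then have aU: "a \<in> ?U" by (simp add: S_def)
      have sub: "P i (x - tuple_scale c a) = P i x - tuple_scale c (P i a)" if "x \<in> ?U" for x c
      proof -
        have "P i (x + tuple_scale (- c) a) = P i x + tuple_scale (- c) (P i a)"
          using Padd[OF that ps.subspace_scale[OF U aU]] Pscale[OF aU] by metis
        then show ?thesis by simp
      qed
      have "D (P i a) - tuple_scale \<mu> (P i a) = P i (D a - tuple_scale \<mu> a)"
        unfolding sub[OF DU[OF aU]] PD[OF aU] ..
      moreover have "P k (P i a) - tuple_scale (m k) (P i a) = P i (P k a - tuple_scale (m k) a)" for k
        unfolding sub[OF PU[OF aU]] PP[OF aU, of k i] ..
      ultimately show "P i a \<in> S"
        using a PU[OF aU] PW[of _ i] unfolding S_def by auto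
    qed
    have "\<not> S \<subseteq> ?W" using \<psi> unfolding S_def by blast
    from ps.eigenvector_modulo[OF U P W fin SU PS S this]
    obtain \<psi>' \<nu> where \<psi>': "\<psi>' \<in> S" "\<psi>' \<notin> ?W" "P i \<psi>' - tuple_scale \<nu> \<psi>' \<in> ?W" .
    have "\<forall>k\<in>insert i K. P k \<psi>' - tuple_scale ((m(i := \<nu>)) k) \<psi>' \<in> ?W"
      using \<psi>' insert.hyps unfolding S_def by auto
    with \<psi>' show ?case unfolding S_def by blast
  qed
  from this[of UNIV] obtain \<psi> m where \<psi>: "\<psi> \<in> ?U" "\<psi> \<notin> ?W" "D \<psi> - tuple_scale \<mu> \<psi> \<in> ?W"
      and m: "\<And>k. P k \<psi> - tuple_scale (m k) \<psi> \<in> ?W" by auto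
  let ?L = "\<lambda>w :: complex ^ 'n. \<Sum>k\<in>UNIV. w $ k * m k"
  have unscale: "c = 0" if "tuple_scale c \<psi> \<in> ?W" for c
  proof (rule ccontr)
    assume "c \<noteq> 0"
    then have "tuple_scale (inverse c) (tuple_scale c \<psi>) = \<psi>" by (simp only: ps.scale_scale) simp
    then show False using ps.subspace_scale[OF W that, of "inverse c"] \<psi>(2) by simp
  qed
  \<comment> \<open>The eigenvalue of \<open>D\<close> at \<open>\<psi>\<close> is
    \<open>\<mu>\<close> by construction and \<open>?L v\<close> by complex linearity. Their
    equality shows that the linear form \<open>?L\<close> is not zero.\<close>
  have "tuple_scale (?L v - \<mu>) \<psi> = (D \<psi> - tuple_scale \<mu> \<psi>) - (D \<psi> - tuple_scale (?L v) \<psi>)"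
    by (simp add: fun_eq_iff tuple_scale_def algebra_simps)
  moreover have "D \<psi> - tuple_scale (?L v) \<psi> \<in> ?W"
    using dird_combination[OF \<psi>(1) m[unfolded P_def], of v] by (simp only: D_def)
  ultimately have "tuple_scale (?L v - \<mu>) \<psi> \<in> ?W"
    using ps.subspace_diff[OF W \<psi>(3)] by (simp only:)
  from unscale[OF this] have "?L v = \<mu>" by simp
  have "exp (- ?L w) = 1" if "w \<in> \<Lambda>" for w
    using unscale[OF eigenform_exact[OF \<psi>(1) that dird_combination[OF \<psi>(1) m[unfolded P_def]]]] by simp
  then have "exp (?L w) = 1" if "w \<in> \<Lambda>" for w
    using that by (metis exp_minus_inverse mult_1_right)
  then have "periodic_wrt \<Lambda> (\<lambda>z. exp (?L z))"
    by (simp add: periodic_wrt_def distrib_right sum.distrib exp_add)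
  from entire_constant[OF entire_exp_linear this]
  obtain c where c: "\<And>z. exp (?L z) = c" unfolding constant_on_def by blast
  \<comment> \<open>The point is chosen so that the exponent there is 1; a constant exponential
    would give exp 1 = 1.\<close>
  have "exp (?L 0) = exp (?L (inverse \<mu> *s v))" unfolding c ..
  moreover have "?L (inverse \<mu> *s v) = 1"
    using \<open>?L v = \<mu>\<close> \<open>\<mu> \<noteq> 0\<close> by (simp add: mult.assoc flip: sum_distrib_left)
  ultimately have "exp 1 = (1 :: complex)" by simp
  then show False
    by (metis exp_eq_one_iff exp_of_real of_real_1 of_real_eq_1_iff one_neq_zero)
qed

end

section \<open>Averaging to functions of the transverse coordinate\<close>

lemma smooth_dird_zero_constant:
  assumes "smooth f" "\<And>w. dird w f = (\<lambda>x. 0)"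
  shows "\<exists>c. f = (\<lambda>x. c)"
proof -
  have "(f has_derivative (\<lambda>h. 0)) (at x within UNIV)" for x
    using smooth_has_derivative[OF assms(1), of x] assms(2) by simp
  then obtain c where "\<And>x. f x = c"
    using has_derivative_zero_constant[OF convex_UNIV, of f] by blast
  then show ?thesis by blast
qed

context toroidal_coordinate
begin

lemma linear_h: "linear h"
  by (rule bounded_linear.linear[OF bounded_linear_h])

text \<open>Such a function depends on \<open>h\<close> alone. The condition is put infinitesimally
  because this is what averaging along periods yields.\<close>

definition kernel_invariant :: "(complex ^ 'n \<Rightarrow> complex) \<Rightarrow> bool" where
  "kernel_invariant f \<longleftrightarrow> (\<forall>w. h w = 0 \<longrightarrow> dird w f = (\<lambda>x. 0))"

lemma kernel_invariantD: "kernel_invariant f \<Longrightarrow> h w = 0 \<Longrightarrow> dird w f = (\<lambda>x. 0)"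
  by (simp add: kernel_invariant_def)

lemma dird_eq_e:
  assumes f: "smooth f" and ker: "kernel_invariant f"
  shows "dird w f x = of_real (h w) * dird e f x"
proof -
  have "h (w - h w *\<^sub>R e) = 0"
    by (simp add: linear_diff[OF linear_h] linear_scale[OF linear_h] h_e)
  from kernel_invariantD[OF ker this] have "dird (w - h w *\<^sub>R e) f x = 0" by simp
  moreover have "dird w f x = dird (w - h w *\<^sub>R e) f x + dird (h w *\<^sub>R e) f x"
    using dird_add_vec[OF f, of "w - h w *\<^sub>R e" "h w *\<^sub>R e" x] by simp
  ultimately show ?thesis using dird_scale_vec[OF f] by (simp add: scaleR_conv_of_real)
qed

lemma wirtinger_eq_e:
  assumes f: "smooth f" and ker: "kernel_invariant f"
  shows "wirtinger k f = (\<lambda>x. \<theta> k * dird e f x)"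
    and "wirtinger_bar k f = (\<lambda>x. cnj (\<theta> k) * dird e f x)"
proof -
  note d = dird_eq_e[OF f ker]
  have "wirtinger k f x = \<theta> k * dird e f x" for x
    unfolding wirtinger_cdir cdir_def \<theta>_def d[of "axis k 1"] d[of "axis k \<i>"]
    by (simp add: algebra_simps diff_divide_distrib)
  then show "wirtinger k f = (\<lambda>x. \<theta> k * dird e f x)" by blast
  have "wirtinger_bar k f x = cnj (\<theta> k) * dird e f x" for x
    unfolding wirtinger_bar_cdir cdir_def \<theta>_def d[of "axis k 1"] d[of "axis k \<i>"]
    by (simp add: algebra_simps add_divide_distrib)
  then show "wirtinger_bar k f = (\<lambda>x. cnj (\<theta> k) * dird e f x)" by blast
qed

text \<open>Otherwise all derivatives of \<open>h\<close> would vanish, contrary to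
  \<open>h e = 1\<close>. The index found here serves later as pivot for normalising
  constants.\<close>

lemma theta_nonzero: "\<exists>k. \<theta> k \<noteq> 0"
proof (rule ccontr)
  assume "\<not> ?thesis"
  then have "h (axis k 1) = 0 \<and> h (axis k \<i>) = 0" for k
    by (auto simp: \<theta>_def complex_eq_iff)
  then have "wirtinger k (\<lambda>x. complex_of_real (h x)) y = 0 \<and> wirtinger_bar k (\<lambda>x. complex_of_real (h x)) y = 0" for k y
    unfolding wirtinger_eqs cdir_def dird_linear[OF bounded_linear_coord[OF bounded_linear_h h_e]] by simp
  then have "dird e (\<lambda>x. complex_of_real (h x)) 0 = 0"
    using dird_eq_wirtinger[OF smooth_linear[OF bounded_linear_coord[OF bounded_linear_h h_e]], of e 0] by simp
  then show False
    unfolding dird_linear[OF bounded_linear_coord[OF bounded_linear_h h_e]] by (simp add: h_e)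
qed

lemma kernel_invariantI:
  assumes f: "smooth f" and B: "\<Lambda> \<subseteq> span B" and z: "\<And>v. v \<in> B \<Longrightarrow> dird v f = (\<lambda>x. 0)"
  shows "kernel_invariant f"
  unfolding kernel_invariant_def
proof (intro allI impI ext)
  fix x w assume w: "h w = 0"
  have "w \<in> span B" using kernel_h[OF w] span_mono[OF B] by (auto simp: span_span)
  then show "dird w f x = 0"
    by (rule linear_eq_0_on_span[OF linear_dird[OF f], rotated]) (simp add: z)
qed

text \<open>A real basis of the span taken from \<open>\<Lambda>\<close>, not necessarily a basis of
  the group: invariance is tested by derivatives, which are real-linear in the direction.\<close>

lemma lattice_basis: obtains B where "finite B" "B \<subseteq> \<Lambda>" "\<Lambda> \<subseteq> span B"
  using maximal_independent_subset[of \<Lambda>] independent_imp_finite by metis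

lemma average_vanishing:
  assumes "f \<in> periodic_smooth \<Lambda>" "v \<in> \<Lambda>"
  shows "dird v (seg_integral (\<lambda>_. 1) v f) = (\<lambda>x. 0)"
proof -
  note f = periodic_smoothD[OF assms(1)]
  have "seg_integral (\<lambda>_. 1) v (dird v f) x = 0" for x
    by (rule average_dird[OF f periodic_smooth_shift[OF assms]])
  then show ?thesis unfolding dird_seg_integral[OF continuous_on_const f] by blast
qed

text \<open>Averages along the basis vectors are taken successively. Each changes the form by an
  exact one and commutes with derivatives, so the invariance already reached is kept.\<close>

lemma average_closed:
  assumes fin: "ps.finite_codim (dbar_closed \<Lambda>) (dbar_exact \<Lambda>)" and \<phi>: "\<phi> \<in> dbar_closed \<Lambda>"
    and B: "finite B" "B \<subseteq> \<Lambda>"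
  shows "\<exists>\<psi>\<in>dbar_closed \<Lambda>. \<phi> - \<psi> \<in> dbar_exact \<Lambda> \<and> (\<forall>v\<in>B. \<forall>k. dird v (\<psi> k) = (\<lambda>x. 0))"
  using B
proof (induction B rule: finite_induct)
  case empty
  have "\<phi> - \<phi> \<in> dbar_exact \<Lambda>" unfolding diff_self by (rule ps.subspace_0[OF subspace_dbar_exact])
  with \<phi> show ?case by blast
next
  case (insert v B)
  then have "B \<subseteq> \<Lambda>" by simp
  from insert.IH[OF this] obtain \<psi> where \<psi>: "\<psi> \<in> dbar_closed \<Lambda>" "\<phi> - \<psi> \<in> dbar_exact \<Lambda>"
    "\<forall>v\<in>B. \<forall>k. dird v (\<psi> k) = (\<lambda>x. 0)" by blast
  have v: "v \<in> \<Lambda>" using insert by simp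
  let ?\<psi> = "\<lambda>j. seg_integral (\<lambda>_. 1) v (\<psi> j)"
  note ex = average_modulo_exact[OF \<psi>(1) dird_lattice_exact[OF fin v \<psi>(1)]]
  show ?case
  proof (intro bexI[of _ ?\<psi>] conjI ballI allI)
    have "?\<psi> - \<psi> \<in> dbar_closed \<Lambda>" using ex dbar_exact_subset by (rule subsetD[rotated])
    from ps.subspace_add[OF subspace_dbar_closed this \<psi>(1)]
    show "?\<psi> \<in> dbar_closed \<Lambda>" unfolding diff_add_cancel .
    have eq: "(\<phi> - \<psi>) - (?\<psi> - \<psi>) = \<phi> - ?\<psi>" by simp
    show "\<phi> - ?\<psi> \<in> dbar_exact \<Lambda>"
      using ps.subspace_diff[OF subspace_dbar_exact \<psi>(2) ex] unfolding eq .
    fix w k assume w: "w \<in> insert v B"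
    show "dird w (?\<psi> k) = (\<lambda>x. 0)"
    proof (cases "w = v")
      case True
      then show ?thesis using average_vanishing[OF dbar_closedD(1)[OF \<psi>(1)] v] by simp
    next
      case False
      then have "dird w (\<psi> k) = (\<lambda>x. 0)" using \<psi>(3) w by simp
      then show ?thesis
        unfolding dird_seg_integral[OF continuous_on_const dbar_closedD(2)[OF \<psi>(1)]]
        by (simp add: affine_integral_def fun_eq_iff)
    qed
  qed
qed

text \<open>For a function \<open>g\<close> of \<open>h\<close> alone,
  \<open>primitive h e g\<close> is again such a function and has derivative \<open>g\<close> along
  \<open>e\<close>; its delbar is thus \<open>g\<close> times delbar h.\<close>

lemma wirtinger_bar_primitive:
  assumes g: "smooth g" and ker: "kernel_invariant g"
  shows "wirtinger_bar k (primitive h e g) = (\<lambda>x. cnj (\<theta> k) * g x)"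
proof -
  have d: "dird w (primitive h e g) = (\<lambda>x. of_real (h w) * g x)" for w
  proof -
    have "h (w - h w *\<^sub>R e) = 0"
      by (simp add: linear_diff[OF linear_h] linear_scale[OF linear_h] h_e)
    from kernel_invariantD[OF ker this] show ?thesis
      unfolding dird_primitive[OF bounded_linear_h h_e g] by (simp add: primitive_def affine_integral_def)
  qed
  then have "dird e (primitive h e g) = g" "kernel_invariant (primitive h e g)"
    by (simp_all add: h_e kernel_invariant_def)
  then show ?thesis
    using wirtinger_eq_e(2)[OF smooth_primitive[OF bounded_linear_h h_e g]] by simp
qed

text \<open>After averaging, the coefficients are functions of \<open>h\<close>, and closedness
  makes their derivatives proportional to \<open>cnj (\<theta> k)\<close>. Up to constants the form
  is a function of \<open>h\<close> times delbar h, which \<open>primitive\<close>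
  integrates.\<close>

lemma dbar_closed_decomposition:
  assumes fin: "ps.finite_codim (dbar_closed \<Lambda>) (dbar_exact \<Lambda>)" and \<phi>: "\<phi> \<in> dbar_closed \<Lambda>"
  obtains c f where "f \<in> periodic_smooth \<Lambda>" "\<And>k. \<phi> k = (\<lambda>x. c k + wirtinger_bar k f x)"
proof -
  obtain B where B: "finite B" "B \<subseteq> \<Lambda>" "\<Lambda> \<subseteq> span B" by (rule lattice_basis)
  from average_closed[OF fin \<phi> B(1,2)] obtain \<psi> where \<psi>: "\<psi> \<in> dbar_closed \<Lambda>"
      and ex: "\<phi> - \<psi> \<in> dbar_exact \<Lambda>" and z: "\<forall>v\<in>B. \<forall>k. dird v (\<psi> k) = (\<lambda>x. 0)"
    by blast
  note s = dbar_closedD(2)[OF \<psi>]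
  have ker: "kernel_invariant (\<psi> k)" for k
    by (rule kernel_invariantI[OF s B(3)]) (simp add: z)
  obtain j where j: "\<theta> j \<noteq> 0" using theta_nonzero by blast
  \<comment> \<open>Division by the pivot entry makes \<open>g\<close> times delbar h agree with
    \<open>\<psi>\<close> in component \<open>j\<close>; closedness controls the others up to
    constants.\<close>
  define g where "g = (\<lambda>x. inverse (cnj (\<theta> j)) * \<psi> j x)"
  have gA: "g \<in> periodic_smooth \<Lambda>" unfolding g_def by (rule periodic_smooth_cmult[OF dbar_closedD(1)[OF \<psi>]])
  have dg: "dird w g = (\<lambda>x. inverse (cnj (\<theta> j)) * dird w (\<psi> j) x)" for w
    unfolding g_def by (rule dird_cmult[OF s])
  have kerg: "kernel_invariant g"
    using ker[of j] unfolding kernel_invariant_def dg by simp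
  note wG = wirtinger_bar_primitive[OF periodic_smoothD[OF gA] kerg]
  have "\<exists>c. (\<lambda>x. \<psi> k x - cnj (\<theta> k) * g x) = (\<lambda>x. c)" for k
  proof (rule smooth_dird_zero_constant)
    note sg = smooth_cmult[OF periodic_smoothD[OF gA], of "cnj (\<theta> k)"]
    show "smooth (\<lambda>x. \<psi> k x - cnj (\<theta> k) * g x)" by (rule smooth_diff[OF s sg])
    fix w
    have "cnj (\<theta> j) * dird e (\<psi> k) x = cnj (\<theta> k) * dird e (\<psi> j) x" for x
      using dbar_closedD(3)[OF \<psi>, of j k] unfolding wirtinger_eq_e(2)[OF s ker] by metis
    then have "dird e (\<psi> k) x = cnj (\<theta> k) * (inverse (cnj (\<theta> j)) * dird e (\<psi> j) x)" for x
      using j by (simp add: field_simps)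
    then show "dird w (\<lambda>x. \<psi> k x - cnj (\<theta> k) * g x) = (\<lambda>x. 0)"
      unfolding dird_diff[OF s sg] dird_cmult[OF periodic_smoothD[OF gA]] dg
        dird_eq_e[OF s ker, of w] by (simp add: mult.left_commute)
  qed
  then obtain c where c: "\<And>k. (\<lambda>x. \<psi> k x - cnj (\<theta> k) * g x) = (\<lambda>x. c k)" by metis
  obtain f where f: "f \<in> periodic_smooth \<Lambda>" "\<And>k. (\<phi> - \<psi>) k = wirtinger_bar k f"
    using ex by (rule dbar_exactE) blast
  have GA: "primitive h e g \<in> periodic_smooth \<Lambda>" by (rule periodic_smooth_primitive[OF gA])
  show thesis
  proof (rule that)
    show "(\<lambda>x. f x + primitive h e g x) \<in> periodic_smooth \<Lambda>"
      by (rule periodic_smooth_add[OF f(1) GA])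
    fix k
    have "\<phi> k x = c k + (wirtinger_bar k f x + cnj (\<theta> k) * g x)" for x
      using fun_cong[OF f(2)[of k], of x] fun_cong[OF c[of k], of x] by (simp add: algebra_simps)
    then show "\<phi> k = (\<lambda>x. c k + wirtinger_bar k (\<lambda>x. f x + primitive h e g x) x)"
      unfolding wirtinger_bar_add[OF periodic_smoothD[OF f(1)] periodic_smoothD[OF GA]] wG by blast
  qed
qed

text \<open>The Cauchy-Riemann equations leave only the holomorphic terms of the derivative, which
  is then complex-linear, so toroidality applies.\<close>

lemma holomorphic_constant:
  assumes f: "f \<in> periodic_smooth \<Lambda>" and hol: "\<And>k. wirtinger_bar k f = (\<lambda>x. 0)"
  shows "\<exists>c. f = (\<lambda>x. c)"
proof -
  note s = periodic_smoothD[OF f]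
  have "entire f"
    unfolding entire_def
  proof
    fix z
    have "dird (c *s v) f z = c * dird v f z" for c v
      unfolding dird_eq_wirtinger[OF s] hol by (simp add: sum_distrib_left mult.assoc)
    then show "\<exists>D. (f has_derivative D) (at z) \<and> (\<forall>c v. D (c *s v) = c * D v)"
      using smooth_has_derivative[OF s, of z] by blast
  qed
  then have "f constant_on UNIV" using f by (intro entire_constant) (auto simp: periodic_smooth_def)
  then show ?thesis unfolding constant_on_def by auto
qed

text \<open>The function \<open>g\<close> is the average of \<open>f\<close> over the maximal compact subgroup.\<close>

lemma average_function:
  assumes f: "f \<in> periodic_smooth \<Lambda>"
  shows "\<exists>g\<in>periodic_smooth \<Lambda>. kernel_invariant g \<and>
      (\<forall>a u b v c. cdir a u b v f = (\<lambda>x. c) \<longrightarrow> cdir a u b v g = (\<lambda>x. c)) \<and>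
      (\<forall>a u b v a' u' b' v' c. cdir a u b v (cdir a' u' b' v' f) = (\<lambda>x. c) \<longrightarrow>
        cdir a u b v (cdir a' u' b' v' g) = (\<lambda>x. c))"
proof -
  obtain B where B: "finite B" "B \<subseteq> \<Lambda>" "\<Lambda> \<subseteq> span B" by (rule lattice_basis)
  have "\<exists>g\<in>periodic_smooth \<Lambda>. (\<forall>v\<in>B. dird v g = (\<lambda>x. 0)) \<and>
      (\<forall>a u b v c. cdir a u b v f = (\<lambda>x. c) \<longrightarrow> cdir a u b v g = (\<lambda>x. c)) \<and>
      (\<forall>a u b v a' u' b' v' c. cdir a u b v (cdir a' u' b' v' f) = (\<lambda>x. c) \<longrightarrow>
        cdir a u b v (cdir a' u' b' v' g) = (\<lambda>x. c))"
    using B(1,2)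
  proof (induction B rule: finite_induct)
    case empty
    show ?case using f by auto
  next
    case (insert v B)
    then have "B \<subseteq> \<Lambda>" by simp
    from insert.IH[OF this] show ?case
    proof (elim bexE conjE)
      fix g assume g: "g \<in> periodic_smooth \<Lambda>" "\<forall>v\<in>B. dird v g = (\<lambda>x. 0)"
        "\<forall>a u b v c. cdir a u b v f = (\<lambda>x. c) \<longrightarrow> cdir a u b v g = (\<lambda>x. c)"
        "\<forall>a u b v a' u' b' v' c. cdir a u b v (cdir a' u' b' v' f) = (\<lambda>x. c) \<longrightarrow>
          cdir a u b v (cdir a' u' b' v' g) = (\<lambda>x. c)"
      have v: "v \<in> \<Lambda>" using insert by simp
      note s = periodic_smoothD[OF g(1)]
      let ?g = "seg_integral (\<lambda>_. 1) v g"
      have const: "seg_integral (\<lambda>_. 1) v (\<lambda>x. c) = (\<lambda>x. c)" for c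
        using affine_integral_const_one by (intro ext)
      \<comment> \<open>Averages fix constants and commute with constant-coefficient operators, so
        equations with constant right-hand side survive.\<close>
      note c1 = cdir_seg_integral[OF continuous_on_const]
      show ?case
      proof (intro bexI[of _ ?g] conjI ballI allI impI)
        show "?g \<in> periodic_smooth \<Lambda>" by (rule periodic_smooth_seg_integral[OF continuous_on_const g(1)])
        show "dird w ?g = (\<lambda>x. 0)" if "w \<in> insert v B" for w
        proof (cases "w = v")
          case True
          then show ?thesis using average_vanishing[OF g(1) v] by simp
        next
          case False
          then have "dird w g = (\<lambda>x. 0)" using g(2) that by simp
          then show ?thesis unfolding dird_seg_integral[OF continuous_on_const s] by (simp add: const)
        qed
        show "cdir a u b w ?g = (\<lambda>x. c)" if "cdir a u b w f = (\<lambda>x. c)" for a u b w c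
          unfolding c1[OF s] g(3)[rule_format, OF that] by (rule const)
        show "cdir a u b w (cdir a' u' b' w' ?g) = (\<lambda>x. c)"
          if "cdir a u b w (cdir a' u' b' w' f) = (\<lambda>x. c)" for a u b w a' u' b' w' c
          unfolding c1[OF s] c1[OF smooth_cdir[OF s]] g(4)[rule_format, OF that] by (rule const)
      qed
    qed
  qed
  then show ?thesis
  proof (elim bexE conjE)
    fix g assume g: "g \<in> periodic_smooth \<Lambda>" "\<forall>v\<in>B. dird v g = (\<lambda>x. 0)"
      "\<forall>a u b v c. cdir a u b v f = (\<lambda>x. c) \<longrightarrow> cdir a u b v g = (\<lambda>x. c)"
      "\<forall>a u b v a' u' b' v' c. cdir a u b v (cdir a' u' b' v' f) = (\<lambda>x. c) \<longrightarrow>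
        cdir a u b v (cdir a' u' b' v' g) = (\<lambda>x. c)"
    have "kernel_invariant g"
      by (rule kernel_invariantI[OF periodic_smoothD[OF g(1)] B(3)]) (simp add: g(2))
    with g show ?thesis by (intro bexI[of _ g] conjI)
  qed
qed

text \<open>Averaging a potential keeps its constant delbar and turns it into a function of
  \<open>h\<close>, whose delbar is a multiple of delbar h at every point.\<close>

lemma constant_dbar_exact:
  assumes f: "f \<in> periodic_smooth \<Lambda>" and c: "\<And>k. wirtinger_bar k f = (\<lambda>x. c k)"
  shows "\<exists>a. \<forall>k. c k = a * cnj (\<theta> k)"
proof (rule bexE[OF average_function[OF f]], elim conjE)
  fix g assume g: "g \<in> periodic_smooth \<Lambda>" "kernel_invariant g"
    "\<forall>a u b v c. cdir a u b v f = (\<lambda>x. c) \<longrightarrow> cdir a u b v g = (\<lambda>x. c)"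
  have "wirtinger_bar k g = (\<lambda>x. c k)" for k
    unfolding wirtinger_eqs by (rule g(3)[rule_format]) (rule c[unfolded wirtinger_eqs])
  then have "c k = dird e g 0 * cnj (\<theta> k)" for k
    unfolding wirtinger_eq_e(2)[OF periodic_smoothD[OF g(1)] g(2)] by (metis mult.commute)
  then show ?thesis by blast
qed

text \<open>The mixed derivatives of the averaged potential are its second derivative along
  \<open>e\<close> times \<open>\<theta> j * cnj (\<theta> k)\<close>, so at most one relation
  between constant (1,1)-forms can arise.\<close>

lemma constant_ddbar_exact:
  assumes f: "f \<in> periodic_smooth \<Lambda>" and c: "\<And>j k. wirtinger j (wirtinger_bar k f) = (\<lambda>x. c j k)"
  shows "\<exists>a. \<forall>j k. c j k = a * \<theta> j * cnj (\<theta> k)"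
proof (rule bexE[OF average_function[OF f]], elim conjE)
  fix g assume g: "g \<in> periodic_smooth \<Lambda>" "kernel_invariant g"
    "\<forall>a u b v a' u' b' v' c. cdir a u b v (cdir a' u' b' v' f) = (\<lambda>x. c) \<longrightarrow>
      cdir a u b v (cdir a' u' b' v' g) = (\<lambda>x. c)"
  note s = periodic_smoothD[OF g(1)]
  have 1: "wirtinger j (wirtinger_bar k g) = (\<lambda>x. c j k)" for j k
    unfolding wirtinger_eqs by (rule g(3)[rule_format]) (rule c[unfolded wirtinger_eqs])
  have 2: "wirtinger_bar k g = (\<lambda>x. cnj (\<theta> k) * dird e g x)" for k
    by (rule wirtinger_eq_e(2)[OF s g(2)])
  have ker: "kernel_invariant (dird e g)"
    unfolding kernel_invariant_def dird_commute[OF s, of _ e]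
    using kernel_invariantD[OF g(2)] by simp
  have 3: "wirtinger j (\<lambda>x. cnj (\<theta> k) * dird e g x) = (\<lambda>x. cnj (\<theta> k) * wirtinger j (dird e g) x)" for j k
    unfolding wirtinger_cdir by (rule cdir_cmult[OF smooth_dird[OF s]])
  have "c j k = dird e (dird e g) 0 * \<theta> j * cnj (\<theta> k)" for j k
    using fun_cong[OF 1[of j k], of 0]
    unfolding 2 3 wirtinger_eq_e(1)[OF smooth_dird[OF s] ker] by (simp add: mult.commute mult.left_commute)
  then show ?thesis by blast
qed

lemma wirtinger_coordinate:
  "wirtinger k (\<lambda>x. complex_of_real (h x)) = (\<lambda>x. \<theta> k)"
  "wirtinger_bar k (\<lambda>x. complex_of_real (h x)) = (\<lambda>x. cnj (\<theta> k))"
  using dird_linear[OF bounded_linear_coord[OF bounded_linear_h h_e]]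
  by (auto simp: wirtinger_eqs cdir_def \<theta>_def fun_eq_iff algebra_simps diff_divide_distrib add_divide_distrib)

text \<open>The converse: multiples of the square of \<open>h\<close> realise that relation, and 2
  is the second derivative of the square.\<close>

lemma ddbar_coordinate_square:
  "wirtinger j (wirtinger_bar k (\<lambda>x. a * (complex_of_real (h x) * complex_of_real (h x))))
    = (\<lambda>x. a * 2 * \<theta> j * cnj (\<theta> k))"
proof -
  note hA = coordinate_periodic_smooth
  note sh = periodic_smoothD[OF hA]
  let ?h2 = "\<lambda>x. complex_of_real (h x) * complex_of_real (h x)"
  have s2: "smooth ?h2" by (rule smooth_mult[OF sh sh])
  have "wirtinger_bar k ?h2 = (\<lambda>x. 2 * cnj (\<theta> k) * complex_of_real (h x))"
    using dird_linear[OF bounded_linear_coord[OF bounded_linear_h h_e]]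
    by (simp add: wirtinger_eqs cdir_def dird_mult[OF sh sh] \<theta>_def fun_eq_iff algebra_simps
        diff_divide_distrib add_divide_distrib)
  then have 1: "wirtinger_bar k (\<lambda>x. a * ?h2 x) = (\<lambda>x. (a * 2 * cnj (\<theta> k)) * complex_of_real (h x))"
    unfolding wirtinger_bar_cmult[OF s2] by (simp add: mult.assoc)
  have "wirtinger j (\<lambda>x. (a * 2 * cnj (\<theta> k)) * complex_of_real (h x)) = (\<lambda>x. (a * 2 * cnj (\<theta> k)) * \<theta> j)"
    unfolding wirtinger_cdir cdir_cmult[OF sh] unfolding wirtinger_cdir[symmetric] wirtinger_coordinate ..
  then show ?thesis unfolding 1 by (simp add: mult.commute mult.left_commute)
qed

lemma coordinate_square_periodic_smooth:
  "(\<lambda>x. a * (complex_of_real (h x) * complex_of_real (h x))) \<in> periodic_smooth \<Lambda>"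
  by (intro periodic_smooth_cmult periodic_smooth_mult coordinate_periodic_smooth)

end

section \<open>Existence of the transverse coordinate\<close>

context
  fixes \<Lambda> :: "(complex ^ 'n::finite) set"
  assumes \<Lambda>: "discrete_subgroup \<Lambda>"
begin

lemma lattice_zero: "0 \<in> \<Lambda>" and lattice_diff: "x \<in> \<Lambda> \<Longrightarrow> y \<in> \<Lambda> \<Longrightarrow> x - y \<in> \<Lambda>"
  using \<Lambda> by (auto simp: discrete_subgroup_def)

lemma lattice_uminus: "x \<in> \<Lambda> \<Longrightarrow> - x \<in> \<Lambda>"
  using lattice_diff[OF lattice_zero] by simp

lemma lattice_add: "x \<in> \<Lambda> \<Longrightarrow> y \<in> \<Lambda> \<Longrightarrow> x + y \<in> \<Lambda>"
  using lattice_diff[of x "- y"] lattice_uminus by simp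

lemma lattice_sum: "(\<And>i. i \<in> I \<Longrightarrow> f i \<in> \<Lambda>) \<Longrightarrow> sum f I \<in> \<Lambda>"
  by (induction I rule: infinite_finite_induct) (auto intro: lattice_zero lattice_add)

lemma lattice_nat_scale: "x \<in> \<Lambda> \<Longrightarrow> real n *\<^sub>R x \<in> \<Lambda>"
  by (induction n) (auto simp: lattice_zero lattice_add scaleR_add_left)

lemma lattice_int_scale: "x \<in> \<Lambda> \<Longrightarrow> of_int k *\<^sub>R x \<in> \<Lambda>"
  using lattice_nat_scale[of x "nat k"] lattice_uminus[OF lattice_nat_scale[of x "nat (- k)"]]
  by (cases "0 \<le> k") auto

text \<open>Isolation of 0, transported by differences, is a uniform distance between lattice
  points; a bounded uniformly discrete set is finite.\<close>

lemma finite_bounded_lattice: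
  assumes "bounded S"
  shows "finite (\<Lambda> \<inter> S)"
proof -
  have "discrete \<Lambda>" using \<Lambda> by (simp add: discrete_subgroup_def)
  then have "0 isolated_in \<Lambda>" using lattice_zero by (rule discreteD)
  then obtain d where d: "d > 0" "\<And>y. y \<in> \<Lambda> \<Longrightarrow> dist 0 y < d \<Longrightarrow> y = 0"
    by (rule isolated_inE_dist) blast
  have "x = y" if "x \<in> \<Lambda> \<inter> S" "y \<in> \<Lambda> \<inter> S" "dist x y < d" for x y
    using d(2)[of "x - y"] lattice_diff[of x y] that by (simp add: dist_norm norm_minus_commute)
  then have "uniform_discrete (\<Lambda> \<inter> S)"
    unfolding uniform_discrete_def using d(1) by blast
  moreover have "bounded (\<Lambda> \<inter> S)" using assms by (rule bounded_subset) simp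
  ultimately show ?thesis using uniform_discrete_finite_iff by blast
qed

lemma coset_space_member:
  assumes "c \<in> coset_space \<Lambda>" and "k \<in> c"
  shows "c = {y. y - k \<in> \<Lambda>}"
proof -
  obtain x where c: "c = {y. y - x \<in> \<Lambda>}"
    using assms(1) by (auto simp: coset_space_def quotient_def)
  then have "k - x \<in> \<Lambda>" using assms(2) by simp
  then have "y - x \<in> \<Lambda> \<longleftrightarrow> y - k \<in> \<Lambda>" for y
    using lattice_add[of "y - k" "k - x"] lattice_diff[of "y - x" "k - x"] by auto
  then show ?thesis using c by simp
qed

text \<open>Every coset meets a fixed compact ball: subtracting the integer parts of the coordinates
  in a real basis from \<open>\<Lambda>\<close> leaves a vector of norm at most the sum of the norms
  of the basis.\<close>

lemma full_rank_compact:
  assumes "span \<Lambda> = UNIV"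
  shows "compact_space (quotient_group_topology \<Lambda>)"
proof -
  obtain B where B: "B \<subseteq> \<Lambda>" "independent B" "\<Lambda> \<subseteq> span B"
    using maximal_independent_subset by blast
  have fin: "finite B" by (rule independent_imp_finite[OF B(2)])
  have "span B = UNIV" using assms span_mono[OF B(3)] by (auto simp: span_span)
  let ?K = "cball 0 (\<Sum>b\<in>B. norm b) :: (complex ^ 'n) set"
  have K: "\<exists>k\<in>?K. k - z \<in> \<Lambda>" for z
  proof -
    have "z \<in> range (\<lambda>u. \<Sum>b\<in>B. u b *\<^sub>R b)"
      using \<open>span B = UNIV\<close> unfolding span_finite[OF fin] by simp
    then obtain u where u: "z = (\<Sum>b\<in>B. u b *\<^sub>R b)" by (rule imageE)
    define l where "l = (\<Sum>b\<in>B. of_int \<lfloor>u b\<rfloor> *\<^sub>R b)"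
    have "z - l = (\<Sum>b\<in>B. frac (u b) *\<^sub>R b)"
      by (simp add: u l_def frac_def scaleR_diff_left sum_subtractf)
    also have "norm \<dots> \<le> (\<Sum>b\<in>B. norm b)"
    proof (rule sum_norm_le)
      fix b
      show "norm (frac (u b) *\<^sub>R b) \<le> norm b"
        using mult_right_mono[of "frac (u b)" 1 "norm b"] frac_lt_1[of "u b"] by simp
    qed
    finally have "z - l \<in> ?K" by simp
    moreover have "l \<in> \<Lambda>" unfolding l_def using B(1) by (intro lattice_sum lattice_int_scale) blast
    then have "(z - l) - z \<in> \<Lambda>" using lattice_uminus by simp
    ultimately show ?thesis by blast
  qed
  have top: "topspace (quotient_group_topology \<Lambda>) \<subseteq> coset_space \<Lambda>"
    unfolding topspace_def openin_quotient_group_topology[OF \<Lambda>] by blast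
  have coset: "{y. y - x \<in> \<Lambda>} \<in> coset_space \<Lambda>" for x
    unfolding coset_space_def quotient_def by blast
  have selfmem: "x \<in> {y. y - x \<in> \<Lambda>}" for x using lattice_zero by simp
  have "\<Union> (coset_space \<Lambda>) = UNIV" using coset selfmem by blast
  then have "openin (quotient_group_topology \<Lambda>) (coset_space \<Lambda>)"
    by (simp add: openin_quotient_group_topology[OF \<Lambda>])
  then have sub: "coset_space \<Lambda> \<subseteq> topspace (quotient_group_topology \<Lambda>)" by (rule openin_subset)
  show ?thesis
    unfolding compact_space_alt
  proof (intro allI impI, elim conjE)
    fix \<U> assume opn: "\<forall>U\<in>\<U>. openin (quotient_group_topology \<Lambda>) U"
      and cover: "topspace (quotient_group_topology \<Lambda>) \<subseteq> \<Union>\<U>"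
    have o: "open (\<Union>U)" if "U \<in> \<U>" for U
      using opn that by (simp add: openin_quotient_group_topology[OF \<Lambda>])
    \<comment> \<open>An open set of cosets has an open union in the vector space, so a cover of the
      quotient pulls back to an open cover of the ball.\<close>
    have Kc: "?K \<subseteq> (\<Union>U\<in>\<U>. \<Union>U)"
    proof
      fix x
      have "{y. y - x \<in> \<Lambda>} \<in> \<Union>\<U>" by (rule subsetD[OF cover subsetD[OF sub coset]])
      then obtain U where "U \<in> \<U>" "{y. y - x \<in> \<Lambda>} \<in> U" by (rule UnionE)
      then show "x \<in> (\<Union>U\<in>\<U>. \<Union>U)" using selfmem[of x] by (intro UN_I UnionI)
    qed
    obtain \<F> where F: "\<F> \<subseteq> \<U>" "finite \<F>" "?K \<subseteq> (\<Union>U\<in>\<F>. \<Union>U)"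
      by (rule compactE_image[OF compact_cball _ Kc]) (rule o)
    have "topspace (quotient_group_topology \<Lambda>) \<subseteq> \<Union>\<F>"
    proof
      fix c assume "c \<in> topspace (quotient_group_topology \<Lambda>)"
      then have c: "c \<in> coset_space \<Lambda>" by (rule subsetD[OF top])
      then obtain x where x: "c = {y. y - x \<in> \<Lambda>}"
        by (auto simp: coset_space_def quotient_def)
      obtain k where k: "k \<in> ?K" "k - x \<in> \<Lambda>" using K[of x] by (rule bexE)
      then have kc: "k \<in> c" using x by simp
      obtain U where U: "U \<in> \<F>" "k \<in> \<Union>U" using subsetD[OF F(3) k(1)] by (rule UN_E)
      then obtain d where d: "d \<in> U" "k \<in> d" by (elim UnionE)
      have "openin (quotient_group_topology \<Lambda>) U" using opn subsetD[OF F(1) U(1)] by (rule bspec)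
      then have "U \<subseteq> coset_space \<Lambda>" by (simp add: openin_quotient_group_topology[OF \<Lambda>])
      then have "d \<in> coset_space \<Lambda>" using d(1) by (rule subsetD)
      then have "c = d" using coset_space_member[OF c kc] coset_space_member[of d k] d by simp
      then show "c \<in> \<Union>\<F>" using U(1) d(1) by (intro UnionI) simp_all
    qed
    then show "\<exists>\<F>. finite \<F> \<and> \<F> \<subseteq> \<U> \<and> topspace (quotient_group_topology \<Lambda>) \<subseteq> \<Union>\<F>"
      using F(1,2) by (intro exI[of _ \<F>] conjI)
  qed
qed

text \<open>Pigeonhole on the finitely many lattice points of the fundamental parallelogram.\<close>

lemma rank_two_rational:
  assumes v: "v1 \<in> \<Lambda>" "v2 \<in> \<Lambda>" and ind: "v1 \<notin> span {v2}"
  shows "\<exists>m>0. \<forall>a b. a *\<^sub>R v1 + b *\<^sub>R v2 \<in> \<Lambda> \<longrightarrow> real m * a \<in> \<int>"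
proof -
  define F where "F = \<Lambda> \<inter> cball 0 (norm v1 + norm v2)"
  have "finite F" unfolding F_def by (rule finite_bounded_lattice) simp
  \<comment> \<open>The factorial is divisible by every difference of two indices up to
    \<open>card F\<close>, which provides one denominator for all lattice points.\<close>
  have "real (fact (card F)) * a \<in> \<int>"
    if l: "a *\<^sub>R v1 + b *\<^sub>R v2 \<in> \<Lambda>" for a b
  proof -
    \<comment> \<open>The j-th multiple of the lattice point, reduced modulo \<open>v1\<close> and
      \<open>v2\<close> into their parallelogram; \<open>card F + 1\<close> indices force a
      repetition.\<close>
    define r where "r j = frac (real j * a) *\<^sub>R v1 + frac (real j * b) *\<^sub>R v2" for j :: nat
    have "r j \<in> F" for j
    proof -
      have "r j = real j *\<^sub>R (a *\<^sub>R v1 + b *\<^sub>R v2) - (of_int \<lfloor>real j * a\<rfloor> *\<^sub>R v1 + of_int \<lfloor>real j * b\<rfloor> *\<^sub>R v2)"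
        by (simp add: r_def frac_def algebra_simps)
      then have "r j \<in> \<Lambda>"
        using v l by (simp add: lattice_diff lattice_add lattice_nat_scale lattice_int_scale)
      moreover have "norm (r j) \<le> norm v1 + norm v2"
        unfolding r_def
        using mult_right_mono[of "frac (real j * a)" 1 "norm v1"] frac_lt_1[of "real j * a"]
          mult_right_mono[of "frac (real j * b)" 1 "norm v2"] frac_lt_1[of "real j * b"]
        by (intro norm_triangle_le add_mono) simp_all
      ultimately show ?thesis by (simp add: F_def)
    qed
    then have "card (r ` {0..card F}) \<le> card F"
      using \<open>finite F\<close> by (intro card_mono) auto
    then have "\<not> inj_on r {0..card F}" by (intro pigeonhole) simp
    then obtain i j where ij: "i < j" "j \<le> card F" "r i = r j"
      unfolding inj_on_def by (metis atLeastAtMost_iff linorder_neqE_nat)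
    then have rel: "(frac (real i * a) - frac (real j * a)) *\<^sub>R v1
        = (frac (real j * b) - frac (real i * b)) *\<^sub>R v2"
      by (simp add: r_def algebra_simps)
    have "frac (real i * a) - frac (real j * a) = 0"
    proof (rule ccontr)
      let ?x = "frac (real i * a) - frac (real j * a)"
      assume "?x \<noteq> 0"
      then have "v1 = inverse ?x *\<^sub>R (?x *\<^sub>R v1)" by simp
      also have "\<dots> \<in> span {v2}" unfolding rel by (intro span_scale span_base) simp
      finally show False using ind by simp
    qed
    then have "real j * a - real i * a = of_int (\<lfloor>real j * a\<rfloor> - \<lfloor>real i * a\<rfloor>)"
      by (simp add: frac_def)
    then have 1: "real (j - i) * a \<in> \<int>" using ij by (simp add: of_nat_diff left_diff_distrib)
    have "j - i dvd fact (card F)" using ij by (intro dvd_fact) auto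
    then obtain q where "fact (card F) = q * (j - i)" by (metis dvd_def mult.commute)
    then have "real (fact (card F)) * a = real q * (real (j - i) * a)"
      by (metis of_nat_mult mult.assoc)
    then show ?thesis using 1 by (metis Ints_mult Ints_of_nat)
  qed
  then show ?thesis by (intro exI[of _ "fact (card F)"]) auto
qed

end

section \<open>The rank of a toroidal lattice\<close>

lemma entire_linear:
  fixes m :: "'n::finite \<Rightarrow> complex"
  shows "entire (\<lambda>z. \<Sum>k\<in>UNIV. z $ k * m k)"
  unfolding entire_def
proof
  fix z :: "complex ^ 'n"
  let ?L = "\<lambda>v :: complex ^ 'n. \<Sum>k\<in>UNIV. v $ k * m k"
  have "bounded_linear ?L"
    by (intro bounded_linear_sum bounded_linear_compose[OF bounded_linear_mult_left] bounded_linear_vec_nth)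
  then have "(?L has_derivative ?L) (at z)" by (rule bounded_linear_imp_has_derivative)
  then show "\<exists>D. (?L has_derivative D) (at z) \<and> (\<forall>c v. D (c *s v) = c * D v)"
    by (intro exI[of _ ?L]) (simp add: sum_distrib_left mult.assoc)
qed

text \<open>For real rank at most 2 a nonconstant periodic entire function exists. If
  \<open>\<Lambda>\<close> lies in a complex line, it is a linear form; otherwise two lattice
  vectors form a complex basis, lattice points have rational first coordinates with a common
  denominator, and an exponential of that coordinate is periodic.\<close>

lemma toroidal_rank:
  fixes \<Lambda> :: "(complex ^ 2) set"
  assumes tor: "toroidal \<Lambda>"
  shows "dim \<Lambda> \<ge> 3"
proof (rule ccontr)
  assume "\<not> dim \<Lambda> \<ge> 3"
  then have dim: "dim \<Lambda> \<le> 2" by simp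
  have \<Lambda>: "discrete_subgroup \<Lambda>" using tor by (simp add: toroidal_def)
  have const: "f z = f w" if "entire f" "periodic_wrt \<Lambda> f" for f :: "complex ^ 2 \<Rightarrow> complex" and z w
    using tor that unfolding toroidal_def constant_on_def by (metis UNIV_I)
  have functional: "m = (\<lambda>_. 0)" if "\<And>v. v \<in> \<Lambda> \<Longrightarrow> (\<Sum>k\<in>UNIV. v $ k * m k) = 0" for m :: "2 \<Rightarrow> complex"
  proof
    fix j
    have "periodic_wrt \<Lambda> (\<lambda>z. (\<Sum>k\<in>UNIV. z $ k * m k))"
      using that by (simp add: periodic_wrt_def distrib_right sum.distrib)
    from const[OF entire_linear this, of "axis j 1" 0]
    show "m j = 0" by (simp add: axis_def if_distrib[of "\<lambda>x. x * _"] cong: if_cong)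
  qed
  define det where "det v w = v $ 1 * w $ 2 - v $ 2 * w $ 1" for v w :: "complex ^ 2"
  have "\<exists>v1\<in>\<Lambda>. \<exists>v2\<in>\<Lambda>. det v1 v2 \<noteq> 0"
  proof (rule ccontr)
    assume "\<not> ?thesis"
    then have z: "det v w = 0" if "v \<in> \<Lambda>" "w \<in> \<Lambda>" for v w using that by blast
    have "v = 0" if "v \<in> \<Lambda>" for v
    proof -
      \<comment> \<open>These are the coefficients of the linear form \<open>det v\<close>, which
        vanishes on \<open>\<Lambda>\<close>.\<close>
      have "(\<lambda>k :: 2. if k = 1 then - (v $ 2) else v $ 1) = (\<lambda>_. 0)"
        using z[OF that] by (intro functional) (simp add: UNIV_2 det_def algebra_simps)
      from fun_cong[OF this, of 1] fun_cong[OF this, of 2] show "v = 0"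
        by (simp add: vec_eq_iff forall_2)
    qed
    \<comment> \<open>The lattice would be trivial, and then every linear form is periodic.\<close>
    then have "(\<Sum>k\<in>UNIV. v $ k * 1) = 0" if "v \<in> \<Lambda>" for v using that by fastforce
    then have "(\<lambda>_ :: 2. 1 :: complex) = (\<lambda>_. 0)" by (rule functional)
    then show False by (metis one_neq_zero)
  qed
  then obtain v1 v2 where v: "v1 \<in> \<Lambda>" "v2 \<in> \<Lambda>" "det v1 v2 \<noteq> 0" by blast
  have "v2 \<noteq> 0" "v1 \<noteq> v2" using v(3) by (auto simp: det_def)
  have "v1 \<notin> span {v2}"
  proof
    assume "v1 \<in> span {v2}"
    then obtain k where "v1 = k *\<^sub>R v2" by (auto simp: span_singleton)
    then have "det v1 v2 = 0" by (simp add: det_def)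
    then show False using v by simp
  qed
  then have ind: "independent {v1, v2}"
    using \<open>v2 \<noteq> 0\<close> by (simp add: independent_insert)
  have span: "\<Lambda> \<subseteq> span {v1, v2}"
    using card_ge_dim_independent[of "{v1, v2}" \<Lambda>] v ind dim \<open>v1 \<noteq> v2\<close> by simp
  obtain m where m: "m > 0" "\<And>a b. a *\<^sub>R v1 + b *\<^sub>R v2 \<in> \<Lambda> \<Longrightarrow> real m * a \<in> \<int>"
    using rank_two_rational[OF \<Lambda> v(1,2) \<open>v1 \<notin> span {v2}\<close>] by blast
  \<comment> \<open>By Cramer's rule \<open>det z v2 / det v1 v2\<close> is the first coordinate of
    \<open>z\<close> in the complex basis \<open>v1\<close>, \<open>v2\<close>; the factor
    \<open>m\<close> clears denominators on \<open>\<Lambda>\<close>.\<close>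
  define \<mu> :: "2 \<Rightarrow> complex" where
    "\<mu> k = 2 * of_real pi * \<i> * of_nat m / det v1 v2 * (if k = 1 then v2 $ 2 else - (v2 $ 1))" for k
  have L: "(\<Sum>k\<in>UNIV. z $ k * \<mu> k) = 2 * of_real pi * \<i> * of_nat m * (det z v2 / det v1 v2)" for z
    by (simp add: UNIV_2 \<mu>_def det_def algebra_simps diff_divide_distrib)
  have "exp (\<Sum>k\<in>UNIV. l $ k * \<mu> k) = 1" if "l \<in> \<Lambda>" for l
  proof -
    have "l \<in> span {v1, v2}" using span that by blast
    then obtain a b where ab: "l = a *\<^sub>R v1 + b *\<^sub>R v2"
      by (auto simp: span_insert span_singleton algebra_simps)
    have "det l v2 = of_real a * det v1 v2"
      unfolding det_def ab vector_add_component vector_scaleR_component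
      unfolding scaleR_conv_of_real
      by (simp add: algebra_simps)
    then have "(\<Sum>k\<in>UNIV. l $ k * \<mu> k) = of_real (2 * (real m * a) * pi) * \<i>"
      using v(3) by (simp add: L)
    moreover have "real m * a \<in> \<int>" using m(2)[of a b] that ab by simp
    then obtain q where "real m * a = of_int q" by (rule Ints_cases)
    ultimately show ?thesis by (auto simp: exp_eq_1)
  qed
  then have "periodic_wrt \<Lambda> (\<lambda>z. exp (\<Sum>k\<in>UNIV. z $ k * \<mu> k))"
    by (simp add: periodic_wrt_def distrib_right sum.distrib exp_add)
  \<comment> \<open>At \<open>v1\<close> divided by \<open>2 * m\<close> the exponent is half a
    period of exp, where the value is -1 instead of 1.\<close>
  from const[OF entire_exp_linear this, of 0 "(1 / (2 * m)) *\<^sub>R v1"]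
  have "1 = exp (2 * of_real pi * \<i> * of_nat m * (det ((1 / (2 * m)) *\<^sub>R v1) v2 / det v1 v2))"
    unfolding L by (simp add: det_def)
  moreover have "det ((1 / (2 * m)) *\<^sub>R v1) v2 = of_real (1 / (2 * m)) * det v1 v2"
    unfolding det_def vector_scaleR_component unfolding scaleR_conv_of_real by (simp add: algebra_simps)
  then have "det ((1 / (2 * m)) *\<^sub>R v1) v2 / det v1 v2 = of_real (1 / (2 * m))"
    using v(3) by (metis nonzero_mult_div_cancel_right)
  moreover have "2 * of_real pi * \<i> * of_nat m * of_real (1 / (2 * m)) = \<i> * of_real pi"
    using m(1) by simp
  ultimately have "1 = exp (\<i> * of_real pi)" by (simp only:)
  then show False by (simp add: exp_pi_i')
qed

text \<open>Non-compactness bounds the real rank by 3 from above and toroidality from below, so the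
  span is a hyperplane; \<open>e\<close> is its normal \<open>a\<close> divided by the squared
  length.\<close>

lemma toroidal_coordinate_exists:
  fixes \<Lambda> :: "(complex ^ 2) set"
  assumes tor: "toroidal \<Lambda>" and nc: "\<not> compact_space (quotient_group_topology \<Lambda>)"
  shows "\<exists>h e. toroidal_coordinate \<Lambda> h e"
proof -
  have \<Lambda>: "discrete_subgroup \<Lambda>" using tor by (simp add: toroidal_def)
  have "span \<Lambda> \<noteq> UNIV" using full_rank_compact[OF \<Lambda>] nc by blast
  then have "dim \<Lambda> \<noteq> DIM(complex ^ 2)" using dim_eq_full by blast
  moreover have "dim \<Lambda> \<le> DIM(complex ^ 2)" by (rule dim_subset_UNIV)
  ultimately have "dim \<Lambda> = DIM(complex ^ 2) - 1"
    using toroidal_rank[OF tor] by simp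
  then obtain a where a: "a \<noteq> 0" "span \<Lambda> = {x. a \<bullet> x = 0}"
    using lowdim_eq_hyperplane by blast
  have "toroidal_coordinate \<Lambda> (\<lambda>x. a \<bullet> x) (inverse (a \<bullet> a) *\<^sub>R a)"
  proof (rule toroidal_coordinate.intro)
    show "bounded_linear (\<lambda>x. a \<bullet> x)" by (rule bounded_linear_inner_right)
    show "a \<bullet> (inverse (a \<bullet> a) *\<^sub>R a) = 1" using a by simp
    show "a \<bullet> v = 0" if "v \<in> \<Lambda>" for v using a(2) span_base[OF that] by blast
    show "w \<in> span \<Lambda>" if "a \<bullet> w = 0" for w using a(2) that by blast
    show "f constant_on UNIV" if "entire f" "periodic_wrt \<Lambda> f" for f
      using tor that by (simp add: toroidal_def)
  qed
  then show ?thesis by blast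
qed

section \<open>Differential forms and quotient dimensions\<close>

text \<open>\<open>basis_modulo\<close> speaks of a set, the applications of an indexed family;
  independence makes the family injective, so it may be replaced by its image.\<close>

lemma (in vector_space) quotient_dim_family:
  assumes W: "subspace W" and K: "finite K" and E: "\<And>i. i \<in> K \<Longrightarrow> E i \<in> U"
    and sp: "\<And>u. u \<in> U \<Longrightarrow> \<exists>c. u - (\<Sum>i\<in>K. scale (c i) (E i)) \<in> W"
    and ind: "\<And>c. (\<Sum>i\<in>K. scale (c i) (E i)) \<in> W \<Longrightarrow> \<forall>i\<in>K. c i = 0"
  shows "quotient_dim scale U W = enat (card K)"
proof -
  have inj: "inj_on E K"
  proof (rule inj_onI, rule ccontr)
    fix i j assume ij: "i \<in> K" "j \<in> K" "E i = E j" "i \<noteq> j"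
    define c :: "_ \<Rightarrow> 'a" where "c k = (if k = i then 1 else if k = j then - 1 else 0)" for k
    have "(\<Sum>k\<in>K. scale (c k) (E k)) = (\<Sum>k\<in>{i, j}. scale (c k) (E k))"
      using K ij by (intro sum.mono_neutral_right) (auto simp: c_def)
    also have "\<dots> = 0" using ij by (simp add: c_def)
    finally have "\<forall>k\<in>K. c k = 0" using ind[of c] subspace_0[OF W] by simp
    then show False using ij(1) by (auto simp: c_def)
  qed
  have "basis_modulo scale U W (E ` K)"
    unfolding basis_modulo_def
  proof (intro conjI ballI allI impI)
    show "finite (E ` K)" using K by simp
    show "E ` K \<subseteq> U" using E by blast
    show "\<exists>c. u - (\<Sum>b\<in>E ` K. scale (c b) b) \<in> W" if u: "u \<in> U" for u
    proof -
      obtain c where "u - (\<Sum>i\<in>K. scale (c i) (E i)) \<in> W" using sp[OF u] by blast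
      then show ?thesis
        by (intro exI[of _ "\<lambda>b. c (inv_into K E b)"]) (simp add: sum.reindex[OF inj] inj cong: sum.cong)
    qed
    fix c b assume s: "(\<Sum>b\<in>E ` K. scale (c b) b) \<in> W" and b: "b \<in> E ` K"
    have "(\<Sum>i\<in>K. scale (c (E i)) (E i)) \<in> W" using s by (simp add: sum.reindex[OF inj])
    from ind[OF this] b show "c b = 0" by auto
  qed
  from quotient_dim_eqI[OF W this] show ?thesis using card_image[OF inj] by simp
qed

text \<open>In the numeral type \<open>2\<close> the numeral 2 denotes 0, so index 2 precedes index
  1. The holomorphic top frame element is therefore dz_2 wedge dz_1, which fixes the signs in all
  component formulas.\<close>

lemma two_less: "(2::2) < 1" "\<not> (1::2) < 2"
proof -
  have "(2::2) = 0" by simp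
  then show "(2::2) < 1" "\<not> (1::2) < 2"
    unfolding less_bit0_def by (simp_all only: bit0.Rep_0 bit0.Rep_1)
qed

lemma two_sets: "UNIV - {1} = {2::2}" "UNIV - {2} = {1::2}"
  "{1::2} \<noteq> UNIV" "{2::2} \<noteq> UNIV"
  unfolding UNIV_2 by auto

lemma wedge_sign_singleton: "wedge_sign k {i} = (if i < k then - 1 else 1)"
proof -
  have "{j \<in> {i}. j < k} = (if i < k then {i} else {})" by auto
  then show ?thesis by (simp add: wedge_sign_def)
qed

lemma wedge_sign_two: "wedge_sign k {} = 1" "wedge_sign 1 {2::2} = - 1" "wedge_sign 2 {1::2} = 1"
  by (simp_all only: wedge_sign_singleton two_less if_True if_False) (simp add: wedge_sign_def)

lemma del_two:
  fixes \<omega> :: "2 form"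
  shows "del \<omega> {} J = (\<lambda>x. 0)"
    "del \<omega> {k} J = wirtinger k (\<omega> {} J)"
    "del \<omega> UNIV J = (\<lambda>x. wirtinger 2 (\<omega> {1} J) x - wirtinger 1 (\<omega> {2} J) x)"
  unfolding del_def by (simp_all add: wedge_sign_two two_sets(1,2) sum_2)

lemma delbar_two:
  fixes \<omega> :: "2 form"
  shows "delbar \<omega> I {} = (\<lambda>x. 0)"
    "delbar \<omega> I {k} = (\<lambda>x. (- 1) ^ card I * wirtinger_bar k (\<omega> I {}) x)"
    "delbar \<omega> I UNIV = (\<lambda>x. (- 1) ^ card I * (wirtinger_bar 2 (\<omega> I {1}) x - wirtinger_bar 1 (\<omega> I {2}) x))"
  unfolding delbar_def by (simp_all add: wedge_sign_two two_sets(1,2) sum_2)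

text \<open>Components outside the bidegree are 0, hence periodic and smooth as well, so the first
  claim holds for all index sets without a case distinction.\<close>

lemma smooth_formsD:
  assumes "\<omega> \<in> smooth_forms \<Lambda> r s"
  shows "\<omega> I J \<in> periodic_smooth \<Lambda>" "card I \<noteq> r \<Longrightarrow> \<omega> I J = (\<lambda>x. 0)" "card J \<noteq> s \<Longrightarrow> \<omega> I J = (\<lambda>x. 0)"
  using assms periodic_smooth_const[of 0 \<Lambda>]
  by (auto simp: smooth_forms_def periodic_smooth_def zero_fun_def split: if_splits)
     (metis smooth_const, metis)

lemma smooth_formsI:
  assumes "\<And>I J. card I = r \<Longrightarrow> card J = s \<Longrightarrow> \<omega> I J \<in> periodic_smooth \<Lambda>"
    and "\<And>I J. card I \<noteq> r \<or> card J \<noteq> s \<Longrightarrow> \<omega> I J = (\<lambda>x. 0)"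
  shows "\<omega> \<in> smooth_forms \<Lambda> r s"
  using assms by (simp add: smooth_forms_def periodic_smooth_def zero_fun_def)

lemma smooth_forms_eqI:
  assumes "\<omega> \<in> smooth_forms \<Lambda> r s" "\<eta> \<in> smooth_forms \<Lambda> r s"
    and "\<And>I J. card I = r \<Longrightarrow> card J = s \<Longrightarrow> \<omega> I J = \<eta> I J"
  shows "\<omega> = \<eta>"
proof (intro ext)
  fix I J x
  show "\<omega> I J x = \<eta> I J x"
    using assms(3)[of I J] smooth_formsD(2,3)[OF assms(1)] smooth_formsD(2,3)[OF assms(2)]
    by (cases "card I = r"; cases "card J = s") simp_all
qed

lemma wirtinger_zero: "wirtinger k (\<lambda>x. 0) = (\<lambda>x. 0)" "wirtinger_bar k (\<lambda>x. 0) = (\<lambda>x. 0)"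
  unfolding wirtinger_eqs by (rule cdir_const)+

lemma del_smooth_forms:
  assumes \<omega>: "\<omega> \<in> smooth_forms \<Lambda> r s"
  shows "del \<omega> \<in> smooth_forms \<Lambda> (Suc r) s"
proof (rule smooth_formsI)
  fix I J :: "'a set"
  have "(\<lambda>z. \<Sum>k\<in>S. wedge_sign k (I - {k}) * wirtinger k (\<omega> (I - {k}) J) z) \<in> periodic_smooth \<Lambda>" if "finite S" for S
    using that
    by (induction S rule: finite_induct)
      (auto simp: periodic_smooth_const intro!: periodic_smooth_add periodic_smooth_cmult
        periodic_smooth_wirtinger smooth_formsD(1)[OF \<omega>])
  then show "del \<omega> I J \<in> periodic_smooth \<Lambda>" unfolding del_def by simp
next
  fix I J :: "'a set" assume "card I \<noteq> Suc r \<or> card J \<noteq> s"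
  moreover have "card I = Suc (card (I - {k}))" if "k \<in> I" for k using that by (intro card.remove) simp_all
  ultimately have "\<omega> (I - {k}) J = (\<lambda>x. 0)" if "k \<in> I" for k
    using smooth_formsD(2)[OF \<omega>, of "I - {k}" J] smooth_formsD(3)[OF \<omega>, of J "I - {k}"] that by (cases "card J = s") (auto simp del: card_Diff_insert)
  then show "del \<omega> I J = (\<lambda>x. 0)" unfolding del_def by (simp add: wirtinger_zero)
qed

lemma delbar_smooth_forms:
  assumes \<omega>: "\<omega> \<in> smooth_forms \<Lambda> r s"
  shows "delbar \<omega> \<in> smooth_forms \<Lambda> r (Suc s)"
proof (rule smooth_formsI)
  fix I J :: "'a set"
  have "(\<lambda>z. \<Sum>k\<in>S. wedge_sign k (J - {k}) * wirtinger_bar k (\<omega> I (J - {k})) z) \<in> periodic_smooth \<Lambda>" if "finite S" for S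
    using that
    by (induction S rule: finite_induct)
      (auto simp: periodic_smooth_const intro!: periodic_smooth_add periodic_smooth_cmult
        periodic_smooth_wirtinger smooth_formsD(1)[OF \<omega>])
  then show "delbar \<omega> I J \<in> periodic_smooth \<Lambda>" unfolding delbar_def by (intro periodic_smooth_cmult) simp
next
  fix I J :: "'a set" assume "card I \<noteq> r \<or> card J \<noteq> Suc s"
  moreover have "card J = Suc (card (J - {k}))" if "k \<in> J" for k using that by (intro card.remove) simp_all
  ultimately have "\<omega> I (J - {k}) = (\<lambda>x. 0)" if "k \<in> J" for k
    using smooth_formsD(2)[OF \<omega>, of I "J - {k}"] smooth_formsD(3)[OF \<omega>, of "J - {k}" I] that by (cases "card I = r") (auto simp del: card_Diff_insert)
  then show "delbar \<omega> I J = (\<lambda>x. 0)" unfolding delbar_def by (simp add: wirtinger_zero)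
qed

interpretation form: vector_space "form_scale :: complex \<Rightarrow> 'n::finite form \<Rightarrow> 'n form"
  by (rule vector_space_form_scale)

lemma subspace_smooth_forms: "form.subspace (smooth_forms \<Lambda> r s)"
proof (rule form.subspaceI)
  show "0 \<in> smooth_forms \<Lambda> r s"
    by (rule smooth_formsI) (simp_all add: zero_fun_def periodic_smooth_const)
next
  fix \<omega> \<eta> assume h: "\<omega> \<in> smooth_forms \<Lambda> r s" "\<eta> \<in> smooth_forms \<Lambda> r s"
  show "\<omega> + \<eta> \<in> smooth_forms \<Lambda> r s"
    using smooth_formsD[OF h(1)] smooth_formsD[OF h(2)]
    by (intro smooth_formsI) (auto simp: plus_fun_def periodic_smooth_add)
next
  fix \<omega> c assume h: "\<omega> \<in> smooth_forms \<Lambda> r s"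
  show "form_scale c \<omega> \<in> smooth_forms \<Lambda> r s"
    using smooth_formsD[OF h]
    by (intro smooth_formsI) (auto simp: form_scale_def periodic_smooth_cmult)
qed

lemma del_add:
  assumes "\<omega> \<in> smooth_forms \<Lambda> r s" "\<eta> \<in> smooth_forms \<Lambda> r s"
  shows "del (\<omega> + \<eta>) = del \<omega> + del \<eta>"
  using periodic_smoothD[OF smooth_formsD(1)[OF assms(1)]] periodic_smoothD[OF smooth_formsD(1)[OF assms(2)]]
  by (simp add: del_def plus_fun_def wirtinger_cdir cdir_add distrib_left sum.distrib)

lemma del_scale:
  assumes "\<omega> \<in> smooth_forms \<Lambda> r s"
  shows "del (form_scale c \<omega>) = form_scale c (del \<omega>)"
  using periodic_smoothD[OF smooth_formsD(1)[OF assms(1)]]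
  by (simp add: del_def form_scale_def wirtinger_cdir cdir_cmult sum_distrib_left mult.left_commute)

lemma delbar_add:
  assumes "\<omega> \<in> smooth_forms \<Lambda> r s" "\<eta> \<in> smooth_forms \<Lambda> r s"
  shows "delbar (\<omega> + \<eta>) = delbar \<omega> + delbar \<eta>"
  using periodic_smoothD[OF smooth_formsD(1)[OF assms(1)]] periodic_smoothD[OF smooth_formsD(1)[OF assms(2)]]
  by (simp add: delbar_def plus_fun_def wirtinger_bar_cdir cdir_add distrib_left sum.distrib)

lemma delbar_scale:
  assumes "\<omega> \<in> smooth_forms \<Lambda> r s"
  shows "delbar (form_scale c \<omega>) = form_scale c (delbar \<omega>)"
  using periodic_smoothD[OF smooth_formsD(1)[OF assms(1)]]
  by (simp add: delbar_def form_scale_def wirtinger_bar_cdir cdir_cmult sum_distrib_left mult.left_commute)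

text \<open>\<open>del\<close> and \<open>delbar\<close> are linear on smooth forms only, so closure
  of the image is derived from linearity on that domain.\<close>

lemma subspace_ddbar_image:
  fixes \<Lambda> :: "(complex ^ 'n::{finite, linorder}) set"
  shows "form.subspace ((\<lambda>\<omega>. del (delbar \<omega>)) ` smooth_forms \<Lambda> r s)"
proof (rule form.subspaceI)
  note S = subspace_smooth_forms[of \<Lambda> r s]
  let ?F = "\<lambda>\<omega>. del (delbar \<omega>)"
  have sc: "?F (form_scale c \<omega>) = form_scale c (?F \<omega>)" if "\<omega> \<in> smooth_forms \<Lambda> r s" for c \<omega>
    unfolding delbar_scale[OF that] del_scale[OF delbar_smooth_forms[OF that]] ..
  from sc[OF form.subspace_0[OF S], of 0] have "0 = ?F (0 :: 'n form)" by simp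
  then show "0 \<in> ?F ` smooth_forms \<Lambda> r s" by (rule image_eqI[OF _ form.subspace_0[OF S]])
  fix \<omega> assume "\<omega> \<in> ?F ` smooth_forms \<Lambda> r s"
  then obtain \<omega>' where \<omega>': "\<omega> = ?F \<omega>'" "\<omega>' \<in> smooth_forms \<Lambda> r s" by (rule imageE)
  show "form_scale c \<omega> \<in> ?F ` smooth_forms \<Lambda> r s" for c
    unfolding \<omega>'(1) sc[OF \<omega>'(2), symmetric] by (rule imageI[OF form.subspace_scale[OF S \<omega>'(2)]])
  fix \<eta> assume "\<eta> \<in> ?F ` smooth_forms \<Lambda> r s"
  then obtain \<eta>' where \<eta>': "\<eta> = ?F \<eta>'" "\<eta>' \<in> smooth_forms \<Lambda> r s" by (rule imageE)
  have "?F (\<omega>' + \<eta>') = ?F \<omega>' + ?F \<eta>'"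
    unfolding delbar_add[OF \<omega>'(2) \<eta>'(2)] del_add[OF delbar_smooth_forms[OF \<omega>'(2)] delbar_smooth_forms[OF \<eta>'(2)]] ..
  then show "\<omega> + \<eta> \<in> ?F ` smooth_forms \<Lambda> r s"
    unfolding \<omega>'(1) \<eta>'(1) by (rule image_eqI[OF sym form.subspace_add[OF S \<omega>'(2) \<eta>'(2)]])
qed

text \<open>The invariant frame elements, which will serve as representatives of all cohomology
  classes.\<close>

definition unit_form :: "'n set \<times> 'n set \<Rightarrow> 'n::finite form" where
  "unit_form p = (\<lambda>I J x. if (I, J) = p then 1 else 0)"

definition const_form :: "('n set \<times> 'n set) set \<Rightarrow> ('n set \<times> 'n set \<Rightarrow> complex) \<Rightarrow> 'n::finite form" where
  "const_form K c = (\<lambda>I J x. if (I, J) \<in> K then c (I, J) else 0)"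

lemma sum_unit_form:
  assumes "finite K"
  shows "(\<Sum>p\<in>K. form_scale (c p) (unit_form p)) = const_form K c"
proof (intro ext)
  fix I J x
  have "(\<Sum>p\<in>K. F p) I J x = (\<Sum>p\<in>K. F p I J x)" for F :: "_ \<Rightarrow> 'a form"
    by (induction K rule: infinite_finite_induct) auto
  then show "(\<Sum>p\<in>K. form_scale (c p) (unit_form p)) I J x = const_form K c I J x"
    using assms by (simp add: const_form_def form_scale_def unit_form_def if_distrib sum.delta cong: if_cong)
qed

lemma unit_form_smooth:
  "card (fst p) = r \<Longrightarrow> card (snd p) = s \<Longrightarrow> unit_form p \<in> smooth_forms \<Lambda> r s"
  by (rule smooth_formsI) (auto simp: unit_form_def periodic_smooth_const)

lemma unit_form_closed: "ext_d (unit_form p) = 0"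
proof -
  have "unit_form p I J = (\<lambda>x. if (I, J) = p then 1 else 0)" for I J by (simp add: unit_form_def)
  then show ?thesis
    by (simp add: ext_d_def del_def delbar_def wirtinger_eqs cdir_const zero_fun_def plus_fun_def)
qed

text \<open>Constant forms are closed, so for a basis of frame elements only spanning and
  independence modulo coboundaries remain to be shown.\<close>

lemma bott_chern_dim_eq:
  assumes W: "form.subspace (bott_chern_coboundaries \<Lambda> r s)"
    and K: "\<And>I J. (I, J) \<in> K \<Longrightarrow> card I = r \<and> card J = s"
    and sp: "\<And>\<omega>. \<omega> \<in> smooth_forms \<Lambda> r s \<Longrightarrow> ext_d \<omega> = 0 \<Longrightarrow> \<exists>c. \<omega> - const_form K c \<in> bott_chern_coboundaries \<Lambda> r s"
    and ind: "\<And>c. const_form K c \<in> bott_chern_coboundaries \<Lambda> r s \<Longrightarrow> \<forall>p\<in>K. c p = 0"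
  shows "bott_chern_dim \<Lambda> r s = enat (card K)"
  unfolding bott_chern_dim_def
proof (rule form.quotient_dim_family[OF W, where E = unit_form])
  show fin: "finite K" by simp
  show "unit_form i \<in> bott_chern_cocycles \<Lambda> r s" if "i \<in> K" for i
    using K[of "fst i" "snd i"] that unit_form_smooth[of i r s \<Lambda>]
    by (simp add: bott_chern_cocycles_def unit_form_closed)
  show "\<exists>c. u - (\<Sum>i\<in>K. form_scale (c i) (unit_form i)) \<in> bott_chern_coboundaries \<Lambda> r s"
    if "u \<in> bott_chern_cocycles \<Lambda> r s" for u
    unfolding sum_unit_form[OF fin] using that by (intro sp) (simp_all add: bott_chern_cocycles_def)
  show "\<forall>i\<in>K. c i = 0" if "(\<Sum>i\<in>K. form_scale (c i) (unit_form i)) \<in> bott_chern_coboundaries \<Lambda> r s" for c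
    using that unfolding sum_unit_form[OF fin] by (rule ind)
qed

lemma const_form_smooth:
  "(\<And>I J. (I, J) \<in> K \<Longrightarrow> card I = r \<and> card J = s) \<Longrightarrow> const_form K c \<in> smooth_forms \<Lambda> r s"
  by (rule smooth_formsI) (auto simp: const_form_def periodic_smooth_const)

text \<open>Cutting off outside the bidegree allows a form to be prescribed by coefficients that are
  meaningful only inside it.\<close>

definition degree_form :: "nat \<Rightarrow> nat \<Rightarrow> 'n form \<Rightarrow> 'n::finite form" where
  "degree_form r s u = (\<lambda>I J. if card I = r \<and> card J = s then u I J else (\<lambda>x. 0))"

lemma degree_form_smooth:
  "(\<And>I J. card I = r \<Longrightarrow> card J = s \<Longrightarrow> u I J \<in> periodic_smooth \<Lambda>) \<Longrightarrow> degree_form r s u \<in> smooth_forms \<Lambda> r s"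
  by (rule smooth_formsI) (auto simp: degree_form_def)

lemma wirtinger_wirtinger_bar:
  "smooth f \<Longrightarrow> wirtinger_bar k (wirtinger j f) = wirtinger j (wirtinger_bar k f)"
  unfolding wirtinger_eqs by (rule cdir_commute)

lemma wirtinger_add:
  "smooth f \<Longrightarrow> smooth g \<Longrightarrow> wirtinger k (\<lambda>x. f x + g x) = (\<lambda>x. wirtinger k f x + wirtinger k g x)"
  unfolding wirtinger_eqs by (rule cdir_add)

lemma wirtinger_diff:
  "smooth f \<Longrightarrow> smooth g \<Longrightarrow> wirtinger k (\<lambda>x. f x - g x) = (\<lambda>x. wirtinger k f x - wirtinger k g x)"
  unfolding wirtinger_eqs by (rule cdir_diff)

lemma wirtinger_cmult:
  "smooth f \<Longrightarrow> wirtinger k (\<lambda>x. c * f x) = (\<lambda>x. c * wirtinger k f x)"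
  unfolding wirtinger_eqs by (rule cdir_cmult)

lemma wirtinger_const: "wirtinger k (\<lambda>x. c) = (\<lambda>x. 0)"
  unfolding wirtinger_eqs by (rule cdir_const)

lemma wirtinger_uminus:
  "smooth f \<Longrightarrow> wirtinger k (\<lambda>x. - f x) = (\<lambda>x. - wirtinger k f x)"
  using wirtinger_cmult[of f k "- 1"] by simp

lemma periodic_smooth_uminus: "f \<in> periodic_smooth \<Lambda> \<Longrightarrow> (\<lambda>x. - f x) \<in> periodic_smooth \<Lambda>"
  using periodic_smooth_cmult[of f \<Lambda> "- 1"] by simp

lemma smooth_wirtinger: "smooth f \<Longrightarrow> smooth (wirtinger k f)" "smooth f \<Longrightarrow> smooth (wirtinger_bar k f)"
  unfolding wirtinger_eqs by (simp_all add: smooth_cdir)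

text \<open>The (2,1) component is rearranged into \<open>wirtinger_bar b\<close> of a single
  function, the shape of the normal forms for delbar; smoothness permits the interchange, and the
  sign of \<open>delbar\<close> on (1,0)-forms reverses the difference.\<close>

lemma ddbar_two:
  fixes \<eta> :: "2 form"
  shows "del (delbar \<eta>) {a} {b} = wirtinger a (wirtinger_bar b (\<eta> {} {}))"
    and "\<eta> \<in> smooth_forms \<Lambda> 1 0 \<Longrightarrow> del (delbar \<eta>) UNIV {b}
      = wirtinger_bar b (\<lambda>x. wirtinger 1 (\<eta> {2} {}) x - wirtinger 2 (\<eta> {1} {}) x)"
    and "del (delbar \<eta>) {a} UNIV
      = wirtinger a (\<lambda>x. wirtinger_bar 2 (\<eta> {} {1}) x - wirtinger_bar 1 (\<eta> {} {2}) x)"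
    and "del (delbar \<eta>) UNIV UNIV = (\<lambda>x.
      wirtinger 2 (\<lambda>x. - (wirtinger_bar 2 (\<eta> {1} {1}) x - wirtinger_bar 1 (\<eta> {1} {2}) x)) x
      - wirtinger 1 (\<lambda>x. - (wirtinger_bar 2 (\<eta> {2} {1}) x - wirtinger_bar 1 (\<eta> {2} {2}) x)) x)"
proof -
  show "del (delbar \<eta>) {a} {b} = wirtinger a (wirtinger_bar b (\<eta> {} {}))"
    unfolding del_two delbar_two by simp
  show "del (delbar \<eta>) {a} UNIV
      = wirtinger a (\<lambda>x. wirtinger_bar 2 (\<eta> {} {1}) x - wirtinger_bar 1 (\<eta> {} {2}) x)"
    unfolding del_two delbar_two by simp
  show "del (delbar \<eta>) UNIV UNIV = (\<lambda>x.
      wirtinger 2 (\<lambda>x. - (wirtinger_bar 2 (\<eta> {1} {1}) x - wirtinger_bar 1 (\<eta> {1} {2}) x)) x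
      - wirtinger 1 (\<lambda>x. - (wirtinger_bar 2 (\<eta> {2} {1}) x - wirtinger_bar 1 (\<eta> {2} {2}) x)) x)"
    unfolding del_two delbar_two by simp
  assume \<eta>: "\<eta> \<in> smooth_forms \<Lambda> 1 0"
  have s: "smooth (\<eta> I J)" for I J by (rule periodic_smoothD[OF smooth_formsD(1)[OF \<eta>]])
  show "del (delbar \<eta>) UNIV {b}
      = wirtinger_bar b (\<lambda>x. wirtinger 1 (\<eta> {2} {}) x - wirtinger 2 (\<eta> {1} {}) x)"
    unfolding wirtinger_bar_diff[OF smooth_wirtinger(1)[OF s] smooth_wirtinger(1)[OF s]]
      wirtinger_wirtinger_bar[OF s] del_two delbar_two
    by (simp add: wirtinger_uminus smooth_wirtinger s)
qed

lemma constant_coefficients_closed: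
  assumes "\<And>I J. \<exists>c. \<omega> I J = (\<lambda>x. c)"
  shows "del \<omega> = 0" "delbar \<omega> = 0"
proof -
  obtain c where "\<omega> = (\<lambda>I J x. c I J)" using assms by metis
  then show "del \<omega> = 0" "delbar \<omega> = 0"
    by (simp_all add: del_def delbar_def wirtinger_const wirtinger_bar_const zero_fun_def)
qed

lemma card_fixed_size_two: "card ({S :: 2 set. card S = r} \<times> {{} :: 2 set}) = 2 choose r"
  "card ({{} :: 2 set} \<times> {S :: 2 set. card S = r}) = 2 choose r"
  using n_subsets[of "UNIV :: 2 set" r] by (simp_all add: card_cartesian_product)

text \<open>\<open>del \<omega>\<close> and \<open>delbar \<omega>\<close> have different bidegrees,
  so they cannot cancel each other.\<close>

lemma ext_d_components:
  assumes \<omega>: "\<omega> \<in> smooth_forms \<Lambda> r s" and d: "ext_d \<omega> = 0"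
  shows "del \<omega> = 0" "delbar \<omega> = 0"
proof -
  have sum: "del \<omega> I J x + delbar \<omega> I J x = 0" for I J x
    using fun_cong[OF fun_cong[OF fun_cong[OF d, of I], of J], of x] by (simp add: ext_d_def)
  note 1 = smooth_formsD(3)[OF del_smooth_forms[OF \<omega>]] smooth_formsD(3)[OF delbar_smooth_forms[OF \<omega>]]
  have "del \<omega> I J x = 0 \<and> delbar \<omega> I J x = 0" for I J x
    using sum[of I J x] 1[of J I] by (cases "card J = s") auto
  then show "del \<omega> = 0" "delbar \<omega> = 0" by (simp_all add: fun_eq_iff)
qed

section \<open>Bidegrees with r = 0 or s = 0\<close>

context toroidal_coordinate
begin

lemma antiholomorphic_constant:
  assumes f: "f \<in> periodic_smooth \<Lambda>" and hol: "\<And>k. wirtinger k f = (\<lambda>x. 0)"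
  shows "\<exists>c. f = (\<lambda>x. c)"
proof -
  have "wirtinger_bar k (\<lambda>x. cnj (f x)) = (\<lambda>x. 0)" for k
    unfolding wirtinger_bar_cnj[OF periodic_smoothD[OF f]] hol by simp
  from holomorphic_constant[OF periodic_smooth_cnj[OF f] this]
  obtain c where "\<And>x. cnj (f x) = c" by metis
  then have "f x = cnj c" for x by (metis complex_cnj_cnj)
  then show ?thesis by blast
qed

lemma holomorphic_forms_constant:
  assumes "\<omega> \<in> holomorphic_forms \<Lambda> r"
  shows "\<exists>c. \<omega> I J = (\<lambda>x. c)"
proof -
  have *: "if card I = r \<and> J = {} then entire (\<omega> I J) \<and> periodic_wrt \<Lambda> (\<omega> I J) else \<omega> I J = 0"
    by (rule assms[unfolded holomorphic_forms_def, THEN CollectD, THEN spec, THEN spec])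
  show ?thesis
  proof (cases "card I = r \<and> J = {}")
    case True
    then have "\<omega> I J constant_on UNIV" using * entire_constant by simp
    then show ?thesis unfolding constant_on_def by auto
  next
    case False
    then have "\<omega> I J = (\<lambda>x. 0)" using * unfolding zero_fun_def by (simp only: if_False)
    then show ?thesis by (rule exI)
  qed
qed

lemma zero_holomorphic_form: "0 \<in> holomorphic_forms \<Lambda> r"
proof -
  have "entire (0 :: complex ^ 'n \<Rightarrow> complex)"
    unfolding entire_def zero_fun_def
    by (intro allI exI[of _ "\<lambda>_. 0"] conjI has_derivative_const) simp_all
  then show ?thesis by (simp add: holomorphic_forms_def periodic_wrt_def)
qed

end

text \<open>Holomorphic forms on a toroidal group have constant coefficients, and so have their
  conjugates; every derivative occurring in these denominators vanishes.\<close>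

lemma coboundaries_trivial:
  fixes \<Lambda> :: "(complex ^ 2) set"
  assumes "toroidal_coordinate \<Lambda> h e" and "r = 0 \<or> s = 0"
  shows "bott_chern_coboundaries \<Lambda> r s = {0}"
proof -
  interpret toroidal_coordinate \<Lambda> h e by fact
  have hol: "del ` holomorphic_forms \<Lambda> q = {0}" for q
  proof -
    have "del \<omega> = 0" if "\<omega> \<in> holomorphic_forms \<Lambda> q" for \<omega>
      by (rule constant_coefficients_closed(1)[OF holomorphic_forms_constant[OF that]])
    then show ?thesis using zero_holomorphic_form[of q] by force
  qed
  have anti: "delbar ` antiholomorphic_forms \<Lambda> q = {0}" for q
  proof -
    have "delbar (conj_form \<omega>) = 0" if w: "\<omega> \<in> holomorphic_forms \<Lambda> q" for \<omega>
    proof (rule constant_coefficients_closed(2))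
      fix I J
      obtain c where "\<omega> J I = (\<lambda>x. c)" using holomorphic_forms_constant[OF w, of J I] by blast
      then show "\<exists>c. conj_form \<omega> I J = (\<lambda>x. c)" by (auto simp: conj_form_def)
    qed
    then show ?thesis using zero_holomorphic_form[of q] unfolding antiholomorphic_forms_def by force
  qed
  show ?thesis using assms(2) by (auto simp: bott_chern_coboundaries_def hol anti)
qed

lemma const_form_eq_0: "const_form K c = 0 \<Longrightarrow> \<forall>p\<in>K. c p = 0"
proof
  fix p assume "const_form K c = 0" "p \<in> K"
  then have "const_form K c (fst p) (snd p) 0 = 0" by simp
  with \<open>p \<in> K\<close> show "c p = 0" by (simp add: const_form_def)
qed

text \<open>A closed (r,0)-form is holomorphic, hence constant, and no relations exist; what is
  counted is the index sets of size \<open>r\<close>.\<close>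

lemma bott_chern_dim_r_0:
  fixes \<Lambda> :: "(complex ^ 2) set"
  assumes "toroidal_coordinate \<Lambda> h e"
  shows "bott_chern_dim \<Lambda> r 0 = enat (2 choose r)"
proof -
  interpret toroidal_coordinate \<Lambda> h e by fact
  let ?K = "{S :: 2 set. card S = r} \<times> {{} :: 2 set}"
  have triv: "bott_chern_coboundaries \<Lambda> r 0 = {0}" by (rule coboundaries_trivial[OF assms]) simp
  have "bott_chern_dim \<Lambda> r 0 = enat (card ?K)"
  proof (rule bott_chern_dim_eq)
    show "form.subspace (bott_chern_coboundaries \<Lambda> r 0)" unfolding triv by (rule form.subspace_single_0)
    show K: "card I = r \<and> card J = 0" if "(I, J) \<in> ?K" for I J using that by auto
    fix \<omega> assume \<omega>: "\<omega> \<in> smooth_forms \<Lambda> r 0" "ext_d \<omega> = 0"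
    have "\<exists>c. \<omega> I {} = (\<lambda>x. c)" for I
    proof (rule holomorphic_constant[OF smooth_formsD(1)[OF \<omega>(1)]])
      fix k
      have "delbar \<omega> I {k} = (\<lambda>x. 0)" using ext_d_components(2)[OF \<omega>] by (simp add: zero_fun_def)
      then show "wirtinger_bar k (\<omega> I {}) = (\<lambda>x. 0)" unfolding delbar_two by (simp add: fun_eq_iff)
    qed
    then obtain c where c: "\<And>I. \<omega> I {} = (\<lambda>x. c I)" by metis
    have "\<omega> = const_form ?K (\<lambda>p. c (fst p))"
      by (rule smooth_forms_eqI[OF \<omega>(1) const_form_smooth[OF K]]) (auto simp: const_form_def c)
    then show "\<exists>c. \<omega> - const_form ?K c \<in> bott_chern_coboundaries \<Lambda> r 0" unfolding triv by auto
  next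
    fix c assume "const_form ?K c \<in> bott_chern_coboundaries \<Lambda> r 0"
    then show "\<forall>p\<in>?K. c p = 0" unfolding triv by (intro const_form_eq_0) simp
  qed
  then show ?thesis unfolding card_fixed_size_two .
qed

text \<open>Here the vanishing of \<open>del\<close> makes the coefficients antiholomorphic, and
  conjugation reduces them to the holomorphic case.\<close>

lemma bott_chern_dim_0_s:
  fixes \<Lambda> :: "(complex ^ 2) set"
  assumes "toroidal_coordinate \<Lambda> h e"
  shows "bott_chern_dim \<Lambda> 0 s = enat (2 choose s)"
proof -
  interpret toroidal_coordinate \<Lambda> h e by fact
  let ?K = "{{} :: 2 set} \<times> {S :: 2 set. card S = s}"
  have triv: "bott_chern_coboundaries \<Lambda> 0 s = {0}" by (rule coboundaries_trivial[OF assms]) simp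
  have "bott_chern_dim \<Lambda> 0 s = enat (card ?K)"
  proof (rule bott_chern_dim_eq)
    show "form.subspace (bott_chern_coboundaries \<Lambda> 0 s)" unfolding triv by (rule form.subspace_single_0)
    show K: "card I = 0 \<and> card J = s" if "(I, J) \<in> ?K" for I J using that by auto
    fix \<omega> assume \<omega>: "\<omega> \<in> smooth_forms \<Lambda> 0 s" "ext_d \<omega> = 0"
    have "\<exists>c. \<omega> {} J = (\<lambda>x. c)" for J
    proof (rule antiholomorphic_constant[OF smooth_formsD(1)[OF \<omega>(1)]])
      fix k
      have "del \<omega> {k} J = (\<lambda>x. 0)" using ext_d_components(1)[OF \<omega>] by (simp add: zero_fun_def)
      then show "wirtinger k (\<omega> {} J) = (\<lambda>x. 0)" unfolding del_two .
    qed
    then obtain c where c: "\<And>J. \<omega> {} J = (\<lambda>x. c J)" by metis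
    have "\<omega> = const_form ?K (\<lambda>p. c (snd p))"
      by (rule smooth_forms_eqI[OF \<omega>(1) const_form_smooth[OF K]]) (auto simp: const_form_def c)
    then show "\<exists>c. \<omega> - const_form ?K c \<in> bott_chern_coboundaries \<Lambda> 0 s" unfolding triv by auto
  next
    fix c assume "const_form ?K c \<in> bott_chern_coboundaries \<Lambda> 0 s"
    then show "\<forall>p\<in>?K. c p = 0" unfolding triv by (intro const_form_eq_0) simp
  qed
  then show ?thesis unfolding card_fixed_size_two .
qed

section \<open>Bott--Chern cohomology of toroidal surfaces\<close>

lemma card_two_iff: "card (I :: 2 set) = 2 \<longleftrightarrow> I = UNIV"
  using card_eq_UNIV_imp_eq_UNIV[of I] by auto

text \<open>\<open>P\<close> and \<open>Q\<close> enumerate the components of the bidegree, and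
  \<open>S\<close> holds the positions still free after normalising constants by the relations from
  \<open>h\<close>; existence and uniqueness of normal forms make these positions a basis.\<close>

lemma bott_chern_dim_ddbar:
  fixes \<Lambda> :: "(complex ^ 'n::{finite, linorder}) set" and P Q :: "'i::finite \<Rightarrow> 'n set"
  assumes inj: "inj (\<lambda>i. (P i, Q i))"
    and deg: "\<And>I J. card I = Suc r \<and> card J = Suc s \<longleftrightarrow> (\<exists>i. I = P i \<and> J = Q i)"
    and normal: "\<And>\<omega>. \<omega> \<in> smooth_forms \<Lambda> (Suc r) (Suc s) \<Longrightarrow> del \<omega> = 0 \<Longrightarrow> delbar \<omega> = 0 \<Longrightarrow>
      \<exists>M. (\<forall>i. i \<notin> S \<longrightarrow> M i = 0) \<and> (\<exists>\<eta>\<in>smooth_forms \<Lambda> r s.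
        \<forall>i. \<omega> (P i) (Q i) = (\<lambda>x. M i + del (delbar \<eta>) (P i) (Q i) x))"
    and unique: "\<And>M \<eta> i. \<forall>i. i \<notin> S \<longrightarrow> M i = 0 \<Longrightarrow> \<eta> \<in> smooth_forms \<Lambda> r s \<Longrightarrow>
      \<forall>i. del (delbar \<eta>) (P i) (Q i) = (\<lambda>x. M i) \<Longrightarrow> M i = 0"
  shows "bott_chern_dim \<Lambda> (Suc r) (Suc s) = enat (card S)"
proof -
  let ?p = "\<lambda>i. (P i, Q i)"
  let ?K = "?p ` S"
  have cob: "bott_chern_coboundaries \<Lambda> (Suc r) (Suc s) = (\<lambda>\<omega>. del (delbar \<omega>)) ` smooth_forms \<Lambda> r s"
    by (simp add: bott_chern_coboundaries_def)
  have K: "card I = Suc r \<and> card J = Suc s" if "(I, J) \<in> ?K" for I J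
    unfolding deg using that by auto
  have cf: "const_form ?K c (P i) (Q i) = (\<lambda>x. if i \<in> S then c (?p i) else 0)" for c i
    using inj_image_mem_iff[OF inj, of i S] by (simp add: const_form_def)
  have "bott_chern_dim \<Lambda> (Suc r) (Suc s) = enat (card ?K)"
  proof (rule bott_chern_dim_eq)
    show "form.subspace (bott_chern_coboundaries \<Lambda> (Suc r) (Suc s))"
      unfolding cob by (rule subspace_ddbar_image)
    show "card I = Suc r \<and> card J = Suc s" if "(I, J) \<in> ?K" for I J by (rule K[OF that])
  next
    fix \<omega> assume \<omega>: "\<omega> \<in> smooth_forms \<Lambda> (Suc r) (Suc s)" and d: "ext_d \<omega> = 0"
    from normal[OF \<omega> ext_d_components[OF \<omega> d]] obtain M \<eta> where M: "\<forall>i. i \<notin> S \<longrightarrow> M i = 0"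
      and \<eta>: "\<eta> \<in> smooth_forms \<Lambda> r s" and eq: "\<forall>i. \<omega> (P i) (Q i) = (\<lambda>x. M i + del (delbar \<eta>) (P i) (Q i) x)"
      by (elim exE conjE bexE)
    define c where "c p = M (inv ?p p)" for p
    have c: "(if i \<in> S then c (?p i) else 0) = M i" for i
      using M by (simp add: c_def inv_f_f[OF inj])
    have "\<omega> - const_form ?K c = del (delbar \<eta>)"
    proof (rule smooth_forms_eqI)
      show "\<omega> - const_form ?K c \<in> smooth_forms \<Lambda> (Suc r) (Suc s)"
        by (rule form.subspace_diff[OF subspace_smooth_forms \<omega> const_form_smooth[OF K]])
      show "del (delbar \<eta>) \<in> smooth_forms \<Lambda> (Suc r) (Suc s)"
        by (rule del_smooth_forms[OF delbar_smooth_forms[OF \<eta>]])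
      fix I J :: "'n set" assume "card I = Suc r" "card J = Suc s"
      then obtain i where i: "I = P i" "J = Q i" using deg by blast
      have "\<omega> (P i) (Q i) x - const_form ?K c (P i) (Q i) x = del (delbar \<eta>) (P i) (Q i) x" for x
        unfolding cf c eq[rule_format] by simp
      then show "(\<omega> - const_form ?K c) I J = del (delbar \<eta>) I J"
        unfolding i by (simp add: fun_eq_iff)
    qed
    then show "\<exists>c. \<omega> - const_form ?K c \<in> bott_chern_coboundaries \<Lambda> (Suc r) (Suc s)"
      unfolding cob using \<eta> by (intro exI[of _ c] image_eqI[of _ _ \<eta>])
  next
    fix c assume "const_form ?K c \<in> bott_chern_coboundaries \<Lambda> (Suc r) (Suc s)"
    then obtain \<eta> where \<eta>: "\<eta> \<in> smooth_forms \<Lambda> r s" and eq: "const_form ?K c = del (delbar \<eta>)"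
      unfolding cob by (elim imageE)
    have z: "(if i \<in> S then c (?p i) else 0) = 0" for i
      by (rule unique[OF _ \<eta>, of "\<lambda>i. if i \<in> S then c (?p i) else 0"]) (simp_all add: eq[symmetric] cf)
    show "\<forall>p\<in>?K. c p = 0"
    proof (rule ballI, elim imageE)
      fix p i assume "p = ?p i" "i \<in> S"
      then show "c p = 0" using z[of i] by simp
    qed
  qed
  then show ?thesis using card_image[OF inj_on_subset[OF inj subset_UNIV]] by simp
qed

section \<open>Normal forms for rows and columns of coefficients\<close>

locale toroidal_surface = toroidal_coordinate \<Lambda> h e
  for \<Lambda> :: "(complex ^ 2) set" and h e +
  assumes finite_H01: "ps.finite_codim (dbar_closed \<Lambda>) (dbar_exact \<Lambda>)"
    and finite_H02: "fs.finite_codim (periodic_smooth \<Lambda>) (dbar_range \<Lambda>)"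
begin

text \<open>Subtracting a multiple of delbar h makes the constant part vanish at an index where
  \<open>\<theta>\<close> does not; this selects a complement of the one relation between constant
  forms.\<close>

lemma dbar_normal_form:
  assumes j: "\<theta> j \<noteq> 0" and \<phi>: "\<And>k. \<phi> k \<in> periodic_smooth \<Lambda>"
    and cl: "wirtinger_bar 2 (\<phi> 1) = wirtinger_bar 1 (\<phi> 2)"
  shows "\<exists>M. M j = 0 \<and> (\<exists>f\<in>periodic_smooth \<Lambda>. \<forall>k. \<phi> k = (\<lambda>x. M k + wirtinger_bar k f x))"
proof -
  have "wirtinger_bar j (\<phi> k) = wirtinger_bar k (\<phi> j)" for j k
    using cl exhaust_2[of j] exhaust_2[of k] by (elim disjE) simp_all
  then have "\<phi> \<in> dbar_closed \<Lambda>" using \<phi> unfolding dbar_closed_def by (intro CollectI conjI allI)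
  then obtain f c
    where f: "f \<in> periodic_smooth \<Lambda>" and eq: "\<And>k. \<phi> k = (\<lambda>x. c k + wirtinger_bar k f x)"
    by (rule dbar_closed_decomposition[OF finite_H01]) (rule that)
  define t where "t = c j / cnj (\<theta> j)"
  note hs = periodic_smoothD[OF coordinate_periodic_smooth]
  note q = periodic_smooth_cmult[OF coordinate_periodic_smooth, of t]
  let ?F = "\<lambda>x. f x + t * complex_of_real (h x)"
  have "wirtinger_bar k ?F = (\<lambda>x. wirtinger_bar k f x + t * cnj (\<theta> k))" for k
    unfolding wirtinger_bar_add[OF periodic_smoothD[OF f] periodic_smoothD[OF q]]
      wirtinger_bar_cmult[OF hs] wirtinger_coordinate ..
  then have "\<phi> k = (\<lambda>x. (c k - t * cnj (\<theta> k)) + wirtinger_bar k ?F x)" for k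
    unfolding eq by simp
  moreover have "c j - t * cnj (\<theta> j) = 0" using j by (simp add: t_def)
  ultimately show ?thesis
    by (intro exI[of _ "\<lambda>k. c k - t * cnj (\<theta> k)"] conjI bexI[OF _ periodic_smooth_add[OF f q]] allI)
qed

text \<open>Conjugation exchanges \<open>wirtinger\<close> and \<open>wirtinger_bar\<close> and
  preserves periodicity, so the delbar statement applies to the conjugate tuple.\<close>

lemma del_normal_form:
  assumes j: "\<theta> j \<noteq> 0" and \<phi>: "\<And>k. \<phi> k \<in> periodic_smooth \<Lambda>"
    and cl: "wirtinger 2 (\<phi> 1) = wirtinger 1 (\<phi> 2)"
  shows "\<exists>M. M j = 0 \<and> (\<exists>f\<in>periodic_smooth \<Lambda>. \<forall>k. \<phi> k = (\<lambda>x. M k + wirtinger k f x))"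
proof -
  note s = periodic_smoothD[OF \<phi>]
  have "wirtinger_bar 2 (\<lambda>x. cnj (\<phi> 1 x)) = wirtinger_bar 1 (\<lambda>x. cnj (\<phi> 2 x))"
    unfolding wirtinger_bar_cnj[OF s] cl ..
  from dbar_normal_form[OF j, of "\<lambda>k x. cnj (\<phi> k x)", OF periodic_smooth_cnj[OF \<phi>] this]
  obtain c f where c: "c j = 0" and f: "f \<in> periodic_smooth \<Lambda>"
      "\<forall>k. (\<lambda>x. cnj (\<phi> k x)) = (\<lambda>x. c k + wirtinger_bar k f x)"
    by (elim exE conjE bexE)
  have "\<phi> k x = cnj (c k) + wirtinger k (\<lambda>x. cnj (f x)) x" for k x
  proof -
    have "cnj (\<phi> k x) = c k + wirtinger_bar k f x" using f(2) by meson
    then have "cnj (cnj (\<phi> k x)) = cnj (c k + wirtinger_bar k f x)" by (rule arg_cong)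
    then show ?thesis unfolding wirtinger_cnj[OF periodic_smoothD[OF f(1)]] by simp
  qed
  then show ?thesis
    using c by (intro exI[of _ "\<lambda>k. cnj (c k)"] conjI bexI[OF _ periodic_smooth_cnj[OF f(1)]] allI ext) simp_all
qed

text \<open>A constant exact tuple is a multiple of delbar h, and a zero at the pivot forces the
  multiple to be 0.\<close>

lemma dbar_normal_form_unique:
  assumes j: "\<theta> j \<noteq> 0" "M j = 0" and f: "f \<in> periodic_smooth \<Lambda>" "\<And>k. wirtinger_bar k f = (\<lambda>x. M k)"
  shows "M k = 0"
proof -
  obtain t where t: "\<forall>k. M k = t * cnj (\<theta> k)" using constant_dbar_exact[OF f] by (rule exE)
  then have "t * cnj (\<theta> j) = 0" using j(2) by metis
  then have "t = 0" using j(1) by simp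
  then show ?thesis using t by simp
qed

lemma del_normal_form_unique:
  assumes j: "\<theta> j \<noteq> 0" "M j = 0" and f: "f \<in> periodic_smooth \<Lambda>" "\<And>k. wirtinger k f = (\<lambda>x. M k)"
  shows "M k = 0"
proof -
  have wc: "wirtinger_bar k (\<lambda>x. cnj (f x)) = (\<lambda>x. cnj (M k))" for k
    unfolding wirtinger_bar_cnj[OF periodic_smoothD[OF f(1)]] f(2) ..
  have "cnj (M j) = 0" using j(2) by simp
  from dbar_normal_form_unique[of j "\<lambda>k. cnj (M k)", OF j(1) this periodic_smooth_cnj[OF f(1)] wc]
  show ?thesis by simp
qed

text \<open>The vanishing of H^{0,2} in the sign pattern of \<open>delbar_two\<close>, with the
  minus sign absorbed in \<open>q\<close>.\<close>

lemma dbar_surjective: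
  assumes g: "g \<in> periodic_smooth \<Lambda>"
  obtains p q where "p \<in> periodic_smooth \<Lambda>" "q \<in> periodic_smooth \<Lambda>"
    "g = (\<lambda>x. wirtinger_bar 2 p x - wirtinger_bar 1 q x)"
proof -
  have "g \<in> dbar_range \<Lambda>" by (rule subsetD[OF periodic_smooth_subset_dbar_range[OF finite_H02] g])
  then obtain a where a: "\<forall>k. a k \<in> periodic_smooth \<Lambda>" "g = (\<lambda>x. \<Sum>k\<in>UNIV. wirtinger_bar k (a k) x)"
    unfolding dbar_range_def by blast
  have m: "(\<lambda>x. - 1 * a 1 x) \<in> periodic_smooth \<Lambda>" using a by (intro periodic_smooth_cmult) simp
  have s: "smooth (a 1)" by (rule periodic_smoothD[OF a(1)[rule_format]])
  have "g = (\<lambda>x. wirtinger_bar 2 (a 2) x - wirtinger_bar 1 (\<lambda>x. - 1 * a 1 x) x)"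
    unfolding a(2) wirtinger_bar_cmult[OF s] by (simp add: sum_2 add.commute)
  with m a(1) show thesis by (intro that[of "a 2"]) simp_all
qed

lemma del_surjective:
  assumes g: "g \<in> periodic_smooth \<Lambda>"
  obtains p q where "p \<in> periodic_smooth \<Lambda>" "q \<in> periodic_smooth \<Lambda>"
    "g = (\<lambda>x. wirtinger 2 p x - wirtinger 1 q x)"
proof -
  obtain p q where pq: "p \<in> periodic_smooth \<Lambda>" "q \<in> periodic_smooth \<Lambda>"
    "(\<lambda>x. cnj (g x)) = (\<lambda>x. wirtinger_bar 2 p x - wirtinger_bar 1 q x)"
    by (rule dbar_surjective[OF periodic_smooth_cnj[OF g]])
  have "g = (\<lambda>x. wirtinger 2 (\<lambda>x. cnj (p x)) x - wirtinger 1 (\<lambda>x. cnj (q x)) x)"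
  proof
    fix x
    have "cnj (cnj (g x)) = cnj (wirtinger_bar 2 p x - wirtinger_bar 1 q x)"
      using fun_cong[OF pq(3), of x] by (rule arg_cong)
    then show "g x = wirtinger 2 (\<lambda>x. cnj (p x)) x - wirtinger 1 (\<lambda>x. cnj (q x)) x"
      unfolding wirtinger_cnj[OF periodic_smoothD[OF pq(1)]] wirtinger_cnj[OF periodic_smoothD[OF pq(2)]] by simp
  qed
  then show thesis by (rule that[OF periodic_smooth_cnj[OF pq(1)] periodic_smooth_cnj[OF pq(2)]])
qed

text \<open>Each row has a delbar-potential \<open>f a\<close>, up to constants. Closedness of the
  columns makes the del-derivative of the tuple \<open>f\<close> holomorphic, hence a constant
  \<open>\<delta>\<close> that may differ from 0. Multiples of \<open>h\<close> subtracted from the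
  \<open>f a\<close> remove it, at the price of other constants, and the corrected tuple has a
  del-potential.\<close>

lemma ddbar_decomposition:
  assumes g: "\<And>a b. g a b \<in> periodic_smooth \<Lambda>"
    and dbar: "\<And>a. wirtinger_bar 2 (g a 1) = wirtinger_bar 1 (g a 2)"
    and del: "\<And>b. wirtinger 2 (g 1 b) = wirtinger 1 (g 2 b)"
  shows "\<exists>M. \<exists>f\<in>periodic_smooth \<Lambda>. \<forall>a b. g a b = (\<lambda>x. M a b + wirtinger a (wirtinger_bar b f) x)"
proof -
  obtain j where j: "\<theta> j \<noteq> 0" using theta_nonzero by blast
  have "\<forall>a. \<exists>c. \<exists>f\<in>periodic_smooth \<Lambda>. \<forall>b. g a b = (\<lambda>x. c b + wirtinger_bar b f x)"
  proof
    fix a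
    show "\<exists>c. \<exists>f\<in>periodic_smooth \<Lambda>. \<forall>b. g a b = (\<lambda>x. c b + wirtinger_bar b f x)"
      using dbar_normal_form[OF j, of "g a", OF g dbar] by (elim exE conjE) (rule exI)
  qed
  then obtain c f where f: "\<And>a. f a \<in> periodic_smooth \<Lambda>"
    and gf: "\<And>a b. g a b = (\<lambda>x. c a b + wirtinger_bar b (f a) x)"
    by metis
  note s = periodic_smoothD[OF f]
  define d where "d = (\<lambda>x. wirtinger 2 (f 1) x - wirtinger 1 (f 2) x)"
  have dg: "wirtinger j (g a b) = wirtinger j (wirtinger_bar b (f a))" for j a b
    unfolding gf wirtinger_add[OF smooth_const smooth_wirtinger(2)[OF s]] wirtinger_const by simp
  have "d \<in> periodic_smooth \<Lambda>"
    unfolding d_def by (intro periodic_smooth_diff periodic_smooth_wirtinger f)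
  moreover have "wirtinger_bar b d = (\<lambda>x. 0)" for b
    using del[of b] unfolding d_def wirtinger_bar_diff[OF smooth_wirtinger(1)[OF s] smooth_wirtinger(1)[OF s]]
      wirtinger_wirtinger_bar[OF s] dg by simp
  ultimately obtain \<delta> where \<delta>: "d = (\<lambda>x. \<delta>)" using holomorphic_constant by blast
  \<comment> \<open>One entry of \<open>\<alpha>\<close> is 0 and the other is divided by an entry
    of \<open>\<theta>\<close> that does not vanish.\<close>
  have "\<exists>\<alpha> :: 2 \<Rightarrow> complex. \<alpha> 1 * \<theta> 2 - \<alpha> 2 * \<theta> 1 = \<delta>"
  proof -
    consider "\<theta> 1 \<noteq> 0" | "\<theta> 2 \<noteq> 0" using j exhaust_2[of j] by metis
    then show ?thesis
    proof cases
      case 1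
      then show ?thesis by (intro exI[of _ "\<lambda>k. if k = 1 then 0 else - \<delta> / \<theta> 1"]) simp
    next
      case 2
      then show ?thesis by (intro exI[of _ "\<lambda>k. if k = 1 then \<delta> / \<theta> 2 else 0"]) simp
    qed
  qed
  then obtain \<alpha> :: "2 \<Rightarrow> complex" where \<alpha>: "\<alpha> 1 * \<theta> 2 - \<alpha> 2 * \<theta> 1 = \<delta>" by blast
  note hA = coordinate_periodic_smooth
  note hs = periodic_smoothD[OF hA]
  define f' where "f' a = (\<lambda>x. f a x - \<alpha> a * complex_of_real (h x))" for a
  have f'A: "f' a \<in> periodic_smooth \<Lambda>" for a
    unfolding f'_def by (intro periodic_smooth_diff f periodic_smooth_cmult hA)
  have df': "wirtinger j (f' a) = (\<lambda>x. wirtinger j (f a) x - \<alpha> a * \<theta> j)" for j a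
    unfolding f'_def wirtinger_diff[OF s smooth_cmult[OF hs]] wirtinger_cmult[OF hs] wirtinger_coordinate ..
  have "wirtinger 2 (f' 1) = wirtinger 1 (f' 2)"
  proof
    fix x
    have "wirtinger 2 (f 1) x - wirtinger 1 (f 2) x = \<alpha> 1 * \<theta> 2 - \<alpha> 2 * \<theta> 1"
      using fun_cong[OF \<delta>, of x] by (simp add: d_def \<alpha>)
    then show "wirtinger 2 (f' 1) x = wirtinger 1 (f' 2) x"
      unfolding df' by (simp add: algebra_simps)
  qed
  from del_normal_form[OF j f'A this] obtain c' F where F: "F \<in> periodic_smooth \<Lambda>"
    and f'F: "\<forall>k. f' k = (\<lambda>x. c' k + wirtinger k F x)" by (elim exE conjE bexE)
  note sF = periodic_smoothD[OF F]
  have "g a b = (\<lambda>x. (c a b + \<alpha> a * cnj (\<theta> b)) + wirtinger a (wirtinger_bar b F) x)" for a b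
  proof
    fix x
    have "wirtinger_bar b (f' a) = (\<lambda>x. wirtinger_bar b (f a) x - \<alpha> a * cnj (\<theta> b))"
      unfolding f'_def wirtinger_bar_diff[OF s smooth_cmult[OF hs]] wirtinger_bar_cmult[OF hs] wirtinger_coordinate ..
    moreover have "wirtinger_bar b (f' a) = wirtinger a (wirtinger_bar b F)"
      unfolding f'F[rule_format, of a] wirtinger_bar_add[OF smooth_const smooth_wirtinger(1)[OF sF]]
        wirtinger_wirtinger_bar[OF sF] wirtinger_bar_const by simp
    ultimately have "wirtinger_bar b (f a) x = wirtinger a (wirtinger_bar b F) x + \<alpha> a * cnj (\<theta> b)"
      by (simp add: fun_eq_iff algebra_simps)
    then show "g a b x = (c a b + \<alpha> a * cnj (\<theta> b)) + wirtinger a (wirtinger_bar b F) x"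
      unfolding gf by simp
  qed
  then show ?thesis
    by (intro exI[of _ "\<lambda>a b. c a b + \<alpha> a * cnj (\<theta> b)"] bexI[OF _ F] allI)
qed

text \<open>Four constant entries less one relation. That relation is nonzero at
  \<open>(j, j)\<close>, so this entry can be normalised to 0.\<close>

lemma bott_chern_dim_1_1: "bott_chern_dim \<Lambda> 1 1 = 3"
proof -
  obtain j where j: "\<theta> j \<noteq> 0" using theta_nonzero by blast
  let ?S = "UNIV - {(j, j)}"
  have "bott_chern_dim \<Lambda> (Suc 0) (Suc 0) = enat (card ?S)"
  proof (rule bott_chern_dim_ddbar)
    show "inj (\<lambda>i. ({fst i}, {snd i}))" by (auto simp: inj_on_def)
    show "card I = Suc 0 \<and> card J = Suc 0 \<longleftrightarrow> (\<exists>i. I = {fst i} \<and> J = {snd i})" for I J :: "2 set"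
      by (auto simp: card_1_singleton_iff)
  next
    fix \<omega> assume \<omega>: "\<omega> \<in> smooth_forms \<Lambda> (Suc 0) (Suc 0)" and dd: "del \<omega> = 0" "delbar \<omega> = 0"
    have "\<exists>M. \<exists>f\<in>periodic_smooth \<Lambda>. \<forall>a b. \<omega> {a} {b} = (\<lambda>x. M a b + wirtinger a (wirtinger_bar b f) x)"
    proof (rule ddbar_decomposition)
      show "\<omega> {a} {b} \<in> periodic_smooth \<Lambda>" for a b by (rule smooth_formsD(1)[OF \<omega>])
      have "delbar \<omega> {a} UNIV x = 0" for a x unfolding dd by simp
      then show "wirtinger_bar 2 (\<omega> {a} {1}) = wirtinger_bar 1 (\<omega> {a} {2})" for a
        unfolding delbar_two by (simp add: fun_eq_iff)
      have "del \<omega> UNIV {b} x = 0" for b x unfolding dd by simp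
      then show "wirtinger 2 (\<omega> {1} {b}) = wirtinger 1 (\<omega> {2} {b})" for b
        unfolding del_two by (simp add: fun_eq_iff)
    qed
    then obtain M f where f: "f \<in> periodic_smooth \<Lambda>"
      and M: "\<forall>a b. \<omega> {a} {b} = (\<lambda>x. M a b + wirtinger a (wirtinger_bar b f) x)" by (elim exE bexE)
    \<comment> \<open>The multiple of the relation visible at \<open>(j, j)\<close>; the potential
      carries \<open>t / 2\<close> because of the 2 in
      \<open>ddbar_coordinate_square\<close>.\<close>
    define t where "t = M j j / (\<theta> j * cnj (\<theta> j))"
    let ?q = "\<lambda>x. t / 2 * (complex_of_real (h x) * complex_of_real (h x))"
    define F where "F = (\<lambda>x. f x + ?q x)"
    note q = coordinate_square_periodic_smooth[of "t / 2"]
    note sf = periodic_smoothD[OF f] and sq = periodic_smoothD[OF q]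
    have FA: "F \<in> periodic_smooth \<Lambda>" unfolding F_def by (rule periodic_smooth_add[OF f q])
    have dF: "wirtinger a (wirtinger_bar b F) = (\<lambda>x. wirtinger a (wirtinger_bar b f) x + t * \<theta> a * cnj (\<theta> b))" for a b
      unfolding F_def wirtinger_bar_add[OF sf sq]
        wirtinger_add[OF smooth_wirtinger(2)[OF sf] smooth_wirtinger(2)[OF sq]] ddbar_coordinate_square by simp
    define \<eta> :: "2 form" where "\<eta> = degree_form 0 0 (\<lambda>I J. F)"
    have \<eta>: "\<eta> \<in> smooth_forms \<Lambda> 0 0" unfolding \<eta>_def by (rule degree_form_smooth[OF FA])
    have \<eta>F: "\<eta> {} {} = F" by (simp add: \<eta>_def degree_form_def)
    let ?M = "\<lambda>i. M (fst i) (snd i) - t * \<theta> (fst i) * cnj (\<theta> (snd i))"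
    have "?M i = 0" if "i \<notin> ?S" for i using that j by (auto simp: t_def)
    moreover have "\<omega> {fst i} {snd i} = (\<lambda>x. ?M i + del (delbar \<eta>) {fst i} {snd i} x)" for i
      unfolding ddbar_two \<eta>F dF M[rule_format] by simp
    ultimately show "\<exists>M. (\<forall>i. i \<notin> ?S \<longrightarrow> M i = 0) \<and> (\<exists>\<eta>\<in>smooth_forms \<Lambda> 0 0.
        \<forall>i. \<omega> {fst i} {snd i} = (\<lambda>x. M i + del (delbar \<eta>) {fst i} {snd i} x))"
      using \<eta> by (intro exI[of _ ?M] conjI bexI[of _ \<eta>] allI impI)
  next
    fix M \<eta> i assume M: "\<forall>i. i \<notin> ?S \<longrightarrow> M i = 0" and \<eta>: "\<eta> \<in> smooth_forms \<Lambda> 0 0"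
      and eq: "\<forall>i. del (delbar \<eta>) {fst i} {snd i} = (\<lambda>x. M i)"
    have "wirtinger a (wirtinger_bar b (\<eta> {} {})) = (\<lambda>x. M (a, b))" for a b
      using eq[rule_format, of "(a, b)"] unfolding ddbar_two by simp
    from constant_ddbar_exact[OF smooth_formsD(1)[OF \<eta>] this]
    obtain t where t: "\<forall>a b. M (a, b) = t * \<theta> a * cnj (\<theta> b)" by (rule exE)
    have "M (j, j) = 0" using M by simp
    then have "t = 0" using t j by simp
    then show "M i = 0" using t by (cases i) simp
  qed
  moreover have "card ?S = 3"
    by (simp add: card_Diff_singleton UNIV_Times_UNIV[symmetric] card_cartesian_product del: UNIV_Times_UNIV)
  ultimately show ?thesis by (simp add: numeral_eq_enat)
qed

text \<open>There is one row, and it has a delbar-potential \<open>F\<close> up to a normalised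
  constant. Since \<open>del\<close> is onto, \<open>F\<close> is in turn a del-derivative, which
  turns the exact part into one of type del delbar.\<close>

lemma bott_chern_dim_2_1: "bott_chern_dim \<Lambda> 2 1 = 1"
proof -
  obtain j where j: "\<theta> j \<noteq> 0" using theta_nonzero by blast
  have "bott_chern_dim \<Lambda> (Suc 1) (Suc 0) = enat (card (UNIV - {j}))"
  proof (rule bott_chern_dim_ddbar)
    show "inj (\<lambda>b. (UNIV :: 2 set, {b :: 2}))" by (auto simp: inj_on_def)
    show "card I = Suc 1 \<and> card J = Suc 0 \<longleftrightarrow> (\<exists>b. I = UNIV \<and> J = {b})" for I J :: "2 set"
      using card_two_iff[of I] by (simp add: card_1_singleton_iff numeral_2_eq_2)
  next
    fix \<omega> assume \<omega>: "\<omega> \<in> smooth_forms \<Lambda> (Suc 1) (Suc 0)" and dd: "del \<omega> = 0" "delbar \<omega> = 0"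
    have "delbar \<omega> UNIV UNIV x = 0" for x unfolding dd by simp
    then have "wirtinger_bar 2 (\<omega> UNIV {1}) = wirtinger_bar 1 (\<omega> UNIV {2})"
      unfolding delbar_two by (simp add: fun_eq_iff)
    from dbar_normal_form[OF j, of "\<lambda>b. \<omega> UNIV {b}", OF smooth_formsD(1)[OF \<omega>] this]
    obtain M F where M: "M j = 0" and F: "F \<in> periodic_smooth \<Lambda>"
        "\<forall>b. \<omega> UNIV {b} = (\<lambda>x. M b + wirtinger_bar b F x)" by (elim exE conjE bexE)
    \<comment> \<open>The minus sign matches the reversed difference in the (2,1) component of
      \<open>ddbar_two\<close>.\<close>
    obtain p q where pq: "p \<in> periodic_smooth \<Lambda>" "q \<in> periodic_smooth \<Lambda>"
      "(\<lambda>x. - F x) = (\<lambda>x. wirtinger 2 p x - wirtinger 1 q x)"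
      by (rule del_surjective[OF periodic_smooth_uminus[OF F(1)]])
    define \<eta> :: "2 form" where "\<eta> = degree_form 1 0 (\<lambda>I J. if I = {1} then p else q)"
    have \<eta>: "\<eta> \<in> smooth_forms \<Lambda> 1 0" unfolding \<eta>_def by (rule degree_form_smooth) (simp add: pq)
    have \<eta>F: "(\<lambda>x. wirtinger 1 (\<eta> {2} {}) x - wirtinger 2 (\<eta> {1} {}) x) = F"
    proof
      fix x
      have "- F x = wirtinger 2 p x - wirtinger 1 q x" using pq(3) by (rule fun_cong)
      then show "wirtinger 1 (\<eta> {2} {}) x - wirtinger 2 (\<eta> {1} {}) x = F x"
        by (simp add: \<eta>_def degree_form_def algebra_simps)
    qed
    have "\<omega> UNIV {b} = (\<lambda>x. M b + del (delbar \<eta>) UNIV {b} x)" for b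
      unfolding ddbar_two(2)[OF \<eta>] \<eta>F by (rule F(2)[rule_format])
    with M \<eta> show "\<exists>M. (\<forall>b. b \<notin> UNIV - {j} \<longrightarrow> M b = 0) \<and> (\<exists>\<eta>\<in>smooth_forms \<Lambda> 1 0.
        \<forall>b. \<omega> UNIV {b} = (\<lambda>x. M b + del (delbar \<eta>) UNIV {b} x))"
      by (intro exI[of _ M] conjI bexI[of _ \<eta>] allI impI) simp_all
  next
    fix M \<eta> b assume M: "\<forall>b. b \<notin> UNIV - {j} \<longrightarrow> M b = 0" and \<eta>: "\<eta> \<in> smooth_forms \<Lambda> 1 0"
      and eq: "\<forall>b. del (delbar \<eta>) UNIV {b} = (\<lambda>x. M b)"
    show "M b = 0"
      by (rule dbar_normal_form_unique[OF j _ _ eq[unfolded ddbar_two(2)[OF \<eta>], rule_format]])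
        (use M in \<open>auto intro!: periodic_smooth_diff periodic_smooth_wirtinger smooth_formsD(1)[OF \<eta>]\<close>)
  qed
  then show ?thesis by (simp add: card_Diff_singleton one_enat_def numeral_2_eq_2)
qed

text \<open>The mirror image for one column: a del-potential \<open>F\<close>, itself obtained by
  \<open>delbar\<close> from a (0,1)-form. No sign arises, because \<open>delbar\<close> meets no
  holomorphic differentials there.\<close>

lemma bott_chern_dim_1_2: "bott_chern_dim \<Lambda> 1 2 = 1"
proof -
  obtain j where j: "\<theta> j \<noteq> 0" using theta_nonzero by blast
  have "bott_chern_dim \<Lambda> (Suc 0) (Suc 1) = enat (card (UNIV - {j}))"
  proof (rule bott_chern_dim_ddbar)
    show "inj (\<lambda>a. ({a :: 2}, UNIV :: 2 set))" by (auto simp: inj_on_def)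
    show "card I = Suc 0 \<and> card J = Suc 1 \<longleftrightarrow> (\<exists>a. I = {a} \<and> J = UNIV)" for I J :: "2 set"
      using card_two_iff[of J] by (simp add: card_1_singleton_iff numeral_2_eq_2)
  next
    fix \<omega> assume \<omega>: "\<omega> \<in> smooth_forms \<Lambda> (Suc 0) (Suc 1)" and dd: "del \<omega> = 0" "delbar \<omega> = 0"
    have "del \<omega> UNIV UNIV x = 0" for x unfolding dd by simp
    then have "wirtinger 2 (\<omega> {1} UNIV) = wirtinger 1 (\<omega> {2} UNIV)"
      unfolding del_two by (simp add: fun_eq_iff)
    from del_normal_form[OF j, of "\<lambda>a. \<omega> {a} UNIV", OF smooth_formsD(1)[OF \<omega>] this]
    obtain M F where M: "M j = 0" and F: "F \<in> periodic_smooth \<Lambda>"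
        "\<forall>a. \<omega> {a} UNIV = (\<lambda>x. M a + wirtinger a F x)" by (elim exE conjE bexE)
    obtain p q where pq: "p \<in> periodic_smooth \<Lambda>" "q \<in> periodic_smooth \<Lambda>"
      "F = (\<lambda>x. wirtinger_bar 2 p x - wirtinger_bar 1 q x)"
      by (rule dbar_surjective[OF F(1)])
    define \<eta> :: "2 form" where "\<eta> = degree_form 0 1 (\<lambda>I J. if J = {1} then p else q)"
    have \<eta>: "\<eta> \<in> smooth_forms \<Lambda> 0 1" unfolding \<eta>_def by (rule degree_form_smooth) (simp add: pq)
    have \<eta>F: "(\<lambda>x. wirtinger_bar 2 (\<eta> {} {1}) x - wirtinger_bar 1 (\<eta> {} {2}) x) = F"
      unfolding pq(3) by (simp add: \<eta>_def degree_form_def)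
    have "\<omega> {a} UNIV = (\<lambda>x. M a + del (delbar \<eta>) {a} UNIV x)" for a
      unfolding ddbar_two(3) \<eta>F by (rule F(2)[rule_format])
    with M \<eta> show "\<exists>M. (\<forall>a. a \<notin> UNIV - {j} \<longrightarrow> M a = 0) \<and> (\<exists>\<eta>\<in>smooth_forms \<Lambda> 0 1.
        \<forall>a. \<omega> {a} UNIV = (\<lambda>x. M a + del (delbar \<eta>) {a} UNIV x))"
      by (intro exI[of _ M] conjI bexI[of _ \<eta>] allI impI) simp_all
  next
    fix M \<eta> a assume M: "\<forall>a. a \<notin> UNIV - {j} \<longrightarrow> M a = 0" and \<eta>: "\<eta> \<in> smooth_forms \<Lambda> 0 1"
      and eq: "\<forall>a. del (delbar \<eta>) {a} UNIV = (\<lambda>x. M a)"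
    show "M a = 0"
      by (rule del_normal_form_unique[OF j _ _ eq[unfolded ddbar_two(3), rule_format]])
        (use M in \<open>auto intro!: periodic_smooth_diff periodic_smooth_wirtinger smooth_formsD(1)[OF \<eta>]\<close>)
  qed
  then show ?thesis by (simp add: card_Diff_singleton one_enat_def numeral_2_eq_2)
qed

text \<open>The single coefficient is solved for \<open>del\<close> and then both resulting
  functions for \<open>delbar\<close>, so no constant survives. The index type \<open>unit\<close>
  with empty \<open>S\<close> encodes one component and dimension 0.\<close>

lemma bott_chern_dim_2_2: "bott_chern_dim \<Lambda> 2 2 = 0"
proof -
  have "bott_chern_dim \<Lambda> (Suc 1) (Suc 1) = enat (card ({} :: unit set))"
  proof (rule bott_chern_dim_ddbar)
    show "inj (\<lambda>_ :: unit. (UNIV :: 2 set, UNIV :: 2 set))" by (simp add: inj_on_def)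
    show "card I = Suc 1 \<and> card J = Suc 1 \<longleftrightarrow> (\<exists>_ :: unit. I = UNIV \<and> J = UNIV)" for I J :: "2 set"
      using card_two_iff[of I] card_two_iff[of J] by (simp add: numeral_2_eq_2)
    show "M i = 0" if "\<forall>i. i \<notin> {} \<longrightarrow> M i = 0" for M :: "unit \<Rightarrow> complex" and i using that by simp
    fix \<omega> assume \<omega>: "\<omega> \<in> smooth_forms \<Lambda> (Suc 1) (Suc 1)"
    obtain P Q where PQ: "P \<in> periodic_smooth \<Lambda>" "Q \<in> periodic_smooth \<Lambda>"
      "\<omega> UNIV UNIV = (\<lambda>x. wirtinger 2 P x - wirtinger 1 Q x)"
      by (rule del_surjective[OF smooth_formsD(1)[OF \<omega>]])
    \<comment> \<open>The minus signs compensate the factor -1 that \<open>delbar\<close> carries on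
      forms with one holomorphic differential.\<close>
    obtain p1 p2 where p: "p1 \<in> periodic_smooth \<Lambda>" "p2 \<in> periodic_smooth \<Lambda>"
      "(\<lambda>x. - P x) = (\<lambda>x. wirtinger_bar 2 p1 x - wirtinger_bar 1 p2 x)"
      by (rule dbar_surjective[OF periodic_smooth_uminus[OF PQ(1)]])
    obtain q1 q2 where q: "q1 \<in> periodic_smooth \<Lambda>" "q2 \<in> periodic_smooth \<Lambda>"
      "(\<lambda>x. - Q x) = (\<lambda>x. wirtinger_bar 2 q1 x - wirtinger_bar 1 q2 x)"
      by (rule dbar_surjective[OF periodic_smooth_uminus[OF PQ(2)]])
    define \<eta> :: "2 form" where "\<eta> = degree_form 1 1 (\<lambda>I J.
      if I = {1} then if J = {1} then p1 else p2 else if J = {1} then q1 else q2)"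
    have \<eta>: "\<eta> \<in> smooth_forms \<Lambda> 1 1" unfolding \<eta>_def by (rule degree_form_smooth) (simp add: p q)
    have \<eta>s: "\<eta> {1} {1} = p1" "\<eta> {1} {2} = p2" "\<eta> {2} {1} = q1" "\<eta> {2} {2} = q2"
      by (simp_all add: \<eta>_def degree_form_def)
    have "\<omega> UNIV UNIV = (\<lambda>x. 0 + del (delbar \<eta>) UNIV UNIV x)"
      unfolding ddbar_two(4) \<eta>s fun_cong[OF p(3), symmetric] fun_cong[OF q(3), symmetric] PQ(3) by simp
    with \<eta> show "\<exists>M :: unit \<Rightarrow> complex. (\<forall>i. i \<notin> {} \<longrightarrow> M i = 0) \<and> (\<exists>\<eta>\<in>smooth_forms \<Lambda> 1 1.
        \<forall>i. \<omega> UNIV UNIV = (\<lambda>x. M i + del (delbar \<eta>) UNIV UNIV x))"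
      by (intro exI[of _ "\<lambda>_. 0"] conjI bexI[of _ \<eta>] allI impI) simp_all
  qed
  then show ?thesis by (simp add: zero_enat_def numeral_2_eq_2)
qed

end

section \<open>From finite Dolbeault dimension to finite codimension of coefficient spaces\<close>

lemma form_sum_apply: "(\<Sum>b\<in>B. form_scale (c b) (F b)) I J x = (\<Sum>b\<in>B. c b * F b I J x)"
  by (induction B rule: infinite_finite_induct) (auto simp: form_scale_def)

lemma tuple_sum_apply: "(\<Sum>b\<in>B. tuple_scale (c b) (F b)) k x = (\<Sum>b\<in>B. c b * F b k x)"
  by (induction B rule: infinite_finite_induct) auto

lemma fun_sum_apply: "(\<Sum>b\<in>B. fun_scale (c b) (F b)) x = (\<Sum>b\<in>B. c b * F b x)"
  by (induction B rule: infinite_finite_induct) (auto simp: fun_scale_def)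

text \<open>A spanning set is carried along the coefficient map \<open>T\<close>; injectivity on
  \<open>B\<close> keeps the coefficients of a combination well defined on the image.\<close>

lemma (in complex_vector_space) finite_codim_image:
  assumes "finite B" "inj_on T B" "T ` B \<subseteq> U"
    and sp: "\<And>u. u \<in> U \<Longrightarrow> \<exists>c. u - (\<Sum>b\<in>B. scale (c b) (T b)) \<in> W"
  shows "finite_codim U W"
  unfolding finite_codim_def
proof (intro exI[of _ "T ` B"] conjI ballI)
  show "finite (T ` B)" using assms(1) by simp
  show "T ` B \<subseteq> U" by fact
  fix u assume "u \<in> U"
  from sp[OF this] obtain c where c: "u - (\<Sum>b\<in>B. scale (c b) (T b)) \<in> W" by (rule exE)
  have "(\<Sum>b\<in>T ` B. scale (c (inv_into B T b)) b) = (\<Sum>b\<in>B. scale (c b) (T b))"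
    using assms(2) by (simp add: sum.reindex cong: sum.cong)
  with c show "\<exists>c. u - (\<Sum>b\<in>T ` B. scale (c b) b) \<in> W"
    by (intro exI[of _ "\<lambda>b. c (inv_into B T b)"]) simp
qed

lemma dolbeault_basis:
  assumes "dolbeault_dim \<Lambda> r s \<noteq> \<infinity>"
  obtains B where "finite B" "B \<subseteq> {\<omega> \<in> smooth_forms \<Lambda> r s. delbar \<omega> = 0}"
    "\<forall>\<omega>\<in>{\<omega> \<in> smooth_forms \<Lambda> r s. delbar \<omega> = 0}. \<exists>c. \<omega> - (\<Sum>b\<in>B. form_scale (c b) b)
      \<in> (if s = 0 then {0} else delbar ` smooth_forms \<Lambda> r (s - 1))"
proof -
  let ?U = "{\<omega> \<in> smooth_forms \<Lambda> r s. delbar \<omega> = 0}"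
  let ?W = "if s = 0 then {0} else delbar ` smooth_forms \<Lambda> r (s - 1)"
  have "\<exists>B. basis_modulo form_scale ?U ?W B"
    using assms unfolding dolbeault_dim_def quotient_dim_def by (rule contrapos_np) simp
  then obtain B where "basis_modulo form_scale ?U ?W B" by (rule exE)
  then show thesis unfolding basis_modulo_def by (elim conjE) (rule that)
qed

lemma dolbeault_finite_H01:
  fixes \<Lambda> :: "(complex ^ 2) set"
  assumes "dolbeault_dim \<Lambda> 0 1 \<noteq> \<infinity>"
  shows "ps.finite_codim (dbar_closed \<Lambda>) (dbar_exact \<Lambda>)"
proof -
  let ?U = "{\<omega> \<in> smooth_forms \<Lambda> 0 1. delbar \<omega> = 0}"
  obtain B where B: "finite B" "B \<subseteq> ?U"
    and sp: "\<forall>\<omega>\<in>?U. \<exists>c. \<omega> - (\<Sum>b\<in>B. form_scale (c b) b) \<in>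
      (if (1::nat) = 0 then {0} else delbar ` smooth_forms \<Lambda> 0 (1 - 1))"
    by (rule dolbeault_basis[OF assms])
  define T :: "2 form \<Rightarrow> 2 \<Rightarrow> complex ^ 2 \<Rightarrow> complex" where "T \<omega> k = \<omega> {} {k}" for \<omega> k
  show ?thesis
  proof (rule ps.finite_codim_image[OF B(1), of T])
    show "inj_on T B"
    proof (rule inj_onI)
      fix \<omega> \<eta> assume "\<omega> \<in> B" "\<eta> \<in> B" and eq: "T \<omega> = T \<eta>"
      then have m: "\<omega> \<in> smooth_forms \<Lambda> 0 1" "\<eta> \<in> smooth_forms \<Lambda> 0 1" using B(2) by auto
      show "\<omega> = \<eta>"
      proof (rule smooth_forms_eqI[OF m])
        fix I J :: "2 set" assume IJ: "card I = 0" "card J = 1"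
        then obtain k where "J = {k}" by (metis card_1_singletonE)
        moreover have "I = {}" using IJ by simp
        ultimately show "\<omega> I J = \<eta> I J" using fun_cong[OF eq, of k] by (simp add: T_def)
      qed
    qed
    show "T ` B \<subseteq> dbar_closed \<Lambda>"
    proof (rule image_subsetI)
      fix \<omega> assume "\<omega> \<in> B"
      then have \<omega>: "\<omega> \<in> smooth_forms \<Lambda> 0 1" "delbar \<omega> = 0" using B(2) by auto
      have "delbar \<omega> {} UNIV x = 0" for x unfolding \<omega>(2) by simp
      then have "wirtinger_bar 2 (\<omega> {} {1}) = wirtinger_bar 1 (\<omega> {} {2})"
        unfolding delbar_two by (simp add: fun_eq_iff)
      then have "wirtinger_bar j (T \<omega> k) = wirtinger_bar k (T \<omega> j)" for j k
        using exhaust_2[of j] exhaust_2[of k] unfolding T_def by (elim disjE) simp_all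
      then show "T \<omega> \<in> dbar_closed \<Lambda>"
        using smooth_formsD(1)[OF \<omega>(1)] unfolding dbar_closed_def
        by (intro CollectI conjI allI) (simp_all add: T_def)
    qed
    fix \<phi> assume \<phi>: "\<phi> \<in> dbar_closed \<Lambda>"
    \<comment> \<open>\<open>the_elem\<close> recovers the index from a singleton \<open>J\<close>;
      all other index sets are cut off by \<open>degree_form\<close>.\<close>
    define \<omega> :: "2 form" where "\<omega> = degree_form 0 1 (\<lambda>I J. \<phi> (the_elem J))"
    have \<omega>: "\<omega> \<in> smooth_forms \<Lambda> 0 1"
      unfolding \<omega>_def by (rule degree_form_smooth) (rule dbar_closedD(1)[OF \<phi>])
    have \<omega>k: "\<omega> {} {k} = \<phi> k" for k by (simp add: \<omega>_def degree_form_def)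
    have "delbar \<omega> = 0"
    proof -
      have "0 \<in> smooth_forms \<Lambda> 0 (Suc 1)" by (rule form.subspace_0[OF subspace_smooth_forms])
      then show ?thesis
      proof (rule smooth_forms_eqI[OF delbar_smooth_forms[OF \<omega>]])
        fix I J :: "2 set" assume "card I = 0" "card J = Suc 1"
        then have "I = {}" "J = UNIV" by (auto intro!: card_eq_UNIV_imp_eq_UNIV)
        then show "delbar \<omega> I J = (0 :: 2 form) I J"
          using dbar_closedD(3)[OF \<phi>, of 2 1] by (simp add: delbar_two \<omega>k fun_eq_iff)
      qed
    qed
    with \<omega> sp obtain c \<eta> where \<eta>: "\<eta> \<in> smooth_forms \<Lambda> 0 0"
      and eq: "\<omega> - (\<Sum>b\<in>B. form_scale (c b) b) = delbar \<eta>" by auto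
    have "\<phi> - (\<Sum>b\<in>B. tuple_scale (c b) (T b)) \<in> dbar_exact \<Lambda>"
    proof (rule dbar_exactI[OF smooth_formsD(1)[OF \<eta>]])
      fix k
      have "(\<omega> - (\<Sum>b\<in>B. form_scale (c b) b)) {} {k} = wirtinger_bar k (\<eta> {} {})"
        unfolding eq delbar_two by simp
      then show "(\<phi> - (\<Sum>b\<in>B. tuple_scale (c b) (T b))) k = wirtinger_bar k (\<eta> {} {})"
        by (simp add: fun_eq_iff form_sum_apply tuple_sum_apply \<omega>k T_def del: tuple_scale_apply)
    qed
    then show "\<exists>c. \<phi> - (\<Sum>b\<in>B. tuple_scale (c b) (T b)) \<in> dbar_exact \<Lambda>" by (rule exI[of _ c])
  qed
qed

text \<open>Two variables admit no (0,3)-forms, so every (0,2)-form is closed and the cocycles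
  correspond to all of \<open>periodic_smooth\<close>.\<close>

lemma dolbeault_finite_H02:
  fixes \<Lambda> :: "(complex ^ 2) set"
  assumes "dolbeault_dim \<Lambda> 0 2 \<noteq> \<infinity>"
  shows "fs.finite_codim (periodic_smooth \<Lambda>) (dbar_range \<Lambda>)"
proof -
  let ?U = "{\<omega> \<in> smooth_forms \<Lambda> 0 2. delbar \<omega> = 0}"
  obtain B where B: "finite B" "B \<subseteq> ?U"
    and sp: "\<forall>\<omega>\<in>?U. \<exists>c. \<omega> - (\<Sum>b\<in>B. form_scale (c b) b) \<in>
      (if (2::nat) = 0 then {0} else delbar ` smooth_forms \<Lambda> 0 (2 - 1))"
    by (rule dolbeault_basis[OF assms])
  define T :: "2 form \<Rightarrow> complex ^ 2 \<Rightarrow> complex" where "T \<omega> = \<omega> {} UNIV" for \<omega>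
  have top: "I = {}" "J = UNIV" if "card I = 0" "card J = 2" for I J :: "2 set"
    using that by (auto intro!: card_eq_UNIV_imp_eq_UNIV)
  show ?thesis
  proof (rule fs.finite_codim_image[OF B(1), of T])
    show "inj_on T B"
    proof (rule inj_onI)
      fix \<omega> \<eta> assume "\<omega> \<in> B" "\<eta> \<in> B" and eq: "T \<omega> = T \<eta>"
      then have m: "\<omega> \<in> smooth_forms \<Lambda> 0 2" "\<eta> \<in> smooth_forms \<Lambda> 0 2" using B(2) by auto
      show "\<omega> = \<eta>"
      proof (rule smooth_forms_eqI[OF m])
        fix I J :: "2 set" assume "card I = 0" "card J = 2"
        from top[OF this] show "\<omega> I J = \<eta> I J" using eq by (simp add: T_def)
      qed
    qed
    show "T ` B \<subseteq> periodic_smooth \<Lambda>"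
      unfolding T_def by (rule image_subsetI) (use B(2) smooth_formsD(1) in blast)
    fix g assume g: "g \<in> periodic_smooth \<Lambda>"
    define \<omega> :: "2 form" where "\<omega> = degree_form 0 2 (\<lambda>I J. g)"
    have \<omega>: "\<omega> \<in> smooth_forms \<Lambda> 0 2" unfolding \<omega>_def by (rule degree_form_smooth[OF g])
    have \<omega>g: "\<omega> {} UNIV = g" by (simp add: \<omega>_def degree_form_def)
    have "delbar \<omega> = 0"
    proof -
      have "0 \<in> smooth_forms \<Lambda> 0 (Suc 2)" by (rule form.subspace_0[OF subspace_smooth_forms])
      then show ?thesis
      proof (rule smooth_forms_eqI[OF delbar_smooth_forms[OF \<omega>]])
        fix I J :: "2 set" assume "card J = Suc 2"
        moreover have "card J \<le> 2" using card_mono[of UNIV J] by simp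
        ultimately show "delbar \<omega> I J = (0 :: 2 form) I J" by simp
      qed
    qed
    with \<omega> sp obtain c \<eta> where \<eta>: "\<eta> \<in> smooth_forms \<Lambda> 0 1"
      and eq: "\<omega> - (\<Sum>b\<in>B. form_scale (c b) b) = delbar \<eta>" by auto
    note s = periodic_smoothD[OF smooth_formsD(1)[OF \<eta>]]
    have "(\<omega> - (\<Sum>b\<in>B. form_scale (c b) b)) {} UNIV
        = (\<lambda>x. wirtinger_bar 2 (\<eta> {} {1}) x - wirtinger_bar 1 (\<eta> {} {2}) x)"
      unfolding eq delbar_two by simp
    then have 1: "g - (\<Sum>b\<in>B. fun_scale (c b) (T b))
        = (\<lambda>x. wirtinger_bar 2 (\<eta> {} {1}) x - wirtinger_bar 1 (\<eta> {} {2}) x)"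
      by (simp add: fun_eq_iff form_sum_apply fun_sum_apply \<omega>g T_def)
    \<comment> \<open>\<open>dbar_range\<close> uses a plain sum over the indices, so the
      alternating sign of \<open>delbar\<close> goes into the coefficient differentiated in
      direction 1.\<close>
    define a where "a k = (if k = 1 then (\<lambda>x. - 1 * \<eta> {} {2} x) else \<eta> {} {1})" for k :: 2
    have "a k \<in> periodic_smooth \<Lambda>" for k
      unfolding a_def using periodic_smooth_cmult[of "\<eta> {} {2}" \<Lambda> "- 1"] smooth_formsD(1)[OF \<eta>] by simp
    moreover have "g - (\<Sum>b\<in>B. fun_scale (c b) (T b)) = (\<lambda>x. \<Sum>k\<in>UNIV. wirtinger_bar k (a k) x)"
      unfolding 1 sum_2 using wirtinger_bar_cmult[OF s, of 1 "- 1" "{}" "{2}"] by (simp add: a_def fun_eq_iff)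
    ultimately have "g - (\<Sum>b\<in>B. fun_scale (c b) (T b)) \<in> dbar_range \<Lambda>"
      unfolding dbar_range_def by (intro CollectI exI[of _ a] conjI allI)
    then show "\<exists>c. g - (\<Sum>b\<in>B. fun_scale (c b) (T b)) \<in> dbar_range \<Lambda>" by (rule exI[of _ c])
  qed
qed

theorem theorem1p2:
  fixes \<Lambda> :: "(complex ^ 2) set"
  assumes "theta_toroidal \<Lambda>"
    and "\<not> compact_space (quotient_group_topology \<Lambda>)"
  shows "bott_chern_dim \<Lambda> 0 0 = 1 \<and>
         bott_chern_dim \<Lambda> 1 0 = 2 \<and> bott_chern_dim \<Lambda> 0 1 = 2 \<and>
         bott_chern_dim \<Lambda> 2 0 = 1 \<and> bott_chern_dim \<Lambda> 0 2 = 1 \<and>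
         bott_chern_dim \<Lambda> 1 1 = 3 \<and>
         bott_chern_dim \<Lambda> 2 1 = 1 \<and> bott_chern_dim \<Lambda> 1 2 = 1 \<and>
         bott_chern_dim \<Lambda> 2 2 = 0"
proof -
  have tor: "toroidal \<Lambda>" and fin: "dolbeault_dim \<Lambda> r s \<noteq> \<infinity>" for r s
    using assms(1) by (simp_all add: theta_toroidal_def)
  obtain h e where tc: "toroidal_coordinate \<Lambda> h e"
    using toroidal_coordinate_exists[OF tor assms(2)] by blast
  interpret toroidal_surface \<Lambda> h e
    by (intro toroidal_surface.intro toroidal_surface_axioms.intro tc
        dolbeault_finite_H01 dolbeault_finite_H02 fin)
  have "enat 1 = 1" "enat 2 = 2" "(2::nat) choose 2 = 1"
    by (simp_all add: one_enat_def numeral_eq_enat)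
  then show ?thesis
    using bott_chern_dim_1_1 bott_chern_dim_2_1 bott_chern_dim_1_2 bott_chern_dim_2_2
    by (simp add: bott_chern_dim_r_0[OF tc] bott_chern_dim_0_s[OF tc])
qed

end
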